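(* There is a universal constant $c>0$ such that the following holds. Let $m,s$ be positive integers with $s\le m^2$ and let $\delta\in(0,1)$. Let $\epsilon$ be a Rademacher vector of length $m$ and consider the Gabor synthesis matrix $\Psi_h\in\mathbb{C}^{m\times m^2}$ generated by $h=\frac1{\sqrt m}\epsilon$. If $$m\ge c\,\delta^{-2}\,s\,(\log s)^2(\log m)^2,$$ then with probability at least $1-m^{-(\log m)(\log s)^2}$ the restricted isometry constant $\delta_s$ of $\Psi_h$ satisfies $\delta_s\le\delta$.
   Context: A Rademacher vector is a random vector with independent entries taking the values $\pm1$ with probability $1/2$ each. The translation and modulation operators on $\mathbb{C}^m$ are $(Th)_j=h_{j\ominus1}$ and $(Mh)_j=\omega^jh_j$, where $\omega=e^{2\pi i/m}$ and $\ominus$ is subtraction modulo $m$; thus $(T^kh)_j=h_{j\ominus k}$ and $(M^\ell h)_j=\omega^{\ell j}h_j$. For $\lambda=(k,\ell)\in\mathbb{Z}_m^2=\{0,\dots,m-1\}^2$ the time-frequency shift is $\pi(\lambda)=M^\ell T^k$. The Gabor synthesis matrix $\Psi_h\in\mathbb{C}^{m\times m^2}$ generated by $h\in\mathbb{C}^m\setminus\{0\}$ is the matrix whose columns are the vectors $\pi(\lambda)h$, $\lambda\in\mathbb{Z}_m^2$. A vector is $s$-sparse if it has at most $s$ nonzero entries. The restricted isometry constant $\delta_s$ of a matrix $\Psi\in\mathbb{C}^{m\times n}$ (here $n=m^2$) is the smallest number such that $(1-\delta_s)\|x\|_2^2\le\|\Psi x\|_2^2\le(1+\delta_s)\|x\|_2^2$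 for all $s$-sparse $x\in\mathbb{C}^n$. *)

theory Defs
  imports
    "HOL-Probability.Product_PMF"
    "Jordan_Normal_Form.Matrix"
begin

text \<open>The dimension \<open>m\<close> is quantified after the universal constant, so the vectors and matrices are
  those of \<^theory>\<open>Jordan_Normal_Form.Matrix\<close>.\<close>

hide_type (open) Finite_Cartesian_Product.vec
hide_const (open) Finite_Cartesian_Product.vec Finite_Cartesian_Product.mat
no_notation Finite_Cartesian_Product.vec_nth (infixl \<open>$\<close> 90)

section \<open>Gabor synthesis matrices\<close>

definition translation :: "complex vec \<Rightarrow> complex vec" where
  "translation h = vec (dim_vec h) (\<lambda>j. h $ nat ((int j - 1) mod int (dim_vec h)))"

definition modulation :: "complex vec \<Rightarrow> complex vec" where
  "modulation h = vec (dim_vec h)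
     (\<lambda>j. exp (2 * complex_of_real pi * \<i> / of_nat (dim_vec h)) ^ j * h $ j)"

definition tf_shift :: "nat \<times> nat \<Rightarrow> complex vec \<Rightarrow> complex vec" where
  "tf_shift = (\<lambda>(k, l) h. (modulation ^^ l) ((translation ^^ k) h))"

text \<open>The columns are enumerated lexicographically in \<open>\<lambda> = (k, l)\<close>; the restricted isometry
  constants do not depend on this choice.\<close>

definition gabor_matrix :: "complex vec \<Rightarrow> complex mat" where
  "gabor_matrix h = (let m = dim_vec h in
     mat_of_cols m (map (\<lambda>p. tf_shift p h) (List.product [0..<m] [0..<m])))"

lemma dim_translation [simp]: "dim_vec (translation h) = dim_vec h"
  by (simp add: translation_def)

lemma dim_modulation [simp]: "dim_vec (modulation h) = dim_vec h"
  by (simp add: modulation_def)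

lemma translation_pow:
  "(translation ^^ k) h = vec (dim_vec h) (\<lambda>j. h $ nat ((int j - int k) mod int (dim_vec h)))"
proof (induction k)
  case 0
  show ?case by (rule eq_vecI) (auto simp flip: of_nat_mod)
next
  case (Suc k)
  show ?case
  proof (rule eq_vecI)
    fix j assume "j < dim_vec (vec (dim_vec h)
        (\<lambda>j. h $ nat ((int j - int (Suc k)) mod int (dim_vec h))))"
    hence j: "j < dim_vec h" by simp
    let ?m = "int (dim_vec h)"
    have "nat ((int j - 1) mod ?m) < dim_vec h" using j by (simp add: nat_less_iff)
    moreover have "((int j - 1) mod ?m - int k) mod ?m = (int j - int (Suc k)) mod ?m"
      by (simp add: mod_diff_left_eq algebra_simps)
    ultimately show "(translation ^^ Suc k) h $ j =
        vec (dim_vec h) (\<lambda>j. h $ nat ((int j - int (Suc k)) mod ?m)) $ j"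
      using j by (simp add: Suc translation_def)
  qed (simp add: Suc)
qed

lemma modulation_pow:
  "(modulation ^^ l) h = vec (dim_vec h)
     (\<lambda>j. exp (2 * complex_of_real pi * \<i> / of_nat (dim_vec h)) ^ (l * j) * h $ j)"
proof (induction l)
  case 0
  show ?case by (rule eq_vecI) auto
next
  case (Suc l)
  show ?case
    by (rule eq_vecI) (simp_all add: Suc modulation_def[of "vec _ _"] power_add)
qed

lemma gabor_matrix_carrier: "h \<in> carrier_vec m \<Longrightarrow> gabor_matrix h \<in> carrier_mat m (m\<^sup>2)"
  by (drule carrier_vecD, rule carrier_matI)
    (simp_all add: gabor_matrix_def Let_def power2_eq_square)


section \<open>The restricted isometry constant\<close>

definition sparse :: "nat \<Rightarrow> complex vec \<Rightarrow> bool" where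
  "sparse s x \<longleftrightarrow> card {i. i < dim_vec x \<and> x $ i \<noteq> 0} \<le> s"

definition l2_norm :: "complex vec \<Rightarrow> real" where
  "l2_norm x = sqrt (\<Sum>i<dim_vec x. (cmod (x $ i))\<^sup>2)"

definition restricted_isometry_bound :: "nat \<Rightarrow> complex mat \<Rightarrow> real \<Rightarrow> bool" where
  "restricted_isometry_bound s \<Psi> d \<longleftrightarrow>
     (\<forall>x \<in> carrier_vec (dim_col \<Psi>). sparse s x \<longrightarrow>
        (1 - d) * (l2_norm x)\<^sup>2 \<le> (l2_norm (\<Psi> *\<^sub>v x))\<^sup>2 \<and>
        (l2_norm (\<Psi> *\<^sub>v x))\<^sup>2 \<le> (1 + d) * (l2_norm x)\<^sup>2)"

definition restricted_isometry_constant :: "nat \<Rightarrow> complex mat \<Rightarrow> real" where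
  "restricted_isometry_constant s \<Psi> = (LEAST d. restricted_isometry_bound s \<Psi> d)"

lemma l2_norm_sq: "(l2_norm x)\<^sup>2 = (\<Sum>i<dim_vec x. (cmod (x $ i))\<^sup>2)"
  by (simp add: l2_norm_def sum_nonneg)

lemma l2_norm_mult_mat_vec_bound:
  fixes x :: "complex vec"
  assumes x: "x \<in> carrier_vec (dim_col \<Psi>)"
  shows "(l2_norm (\<Psi> *\<^sub>v x))\<^sup>2 \<le>
    (\<Sum>i<dim_row \<Psi>. \<Sum>j<dim_col \<Psi>. (cmod (\<Psi> $$ (i, j)))\<^sup>2) * (l2_norm x)\<^sup>2"
proof -
  have "(cmod ((\<Psi> *\<^sub>v x) $ i))\<^sup>2 \<le>
      (\<Sum>j<dim_col \<Psi>. (cmod (\<Psi> $$ (i, j)))\<^sup>2) * (l2_norm x)\<^sup>2" if i: "i < dim_row \<Psi>" for i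
  proof -
    have "cmod ((\<Psi> *\<^sub>v x) $ i) \<le> (\<Sum>j<dim_col \<Psi>. cmod (\<Psi> $$ (i, j)) * cmod (x $ j))"
      using i assms by (auto simp: scalar_prod_def atLeast0LessThan norm_mult
          intro!: order_trans[OF norm_sum] sum_mono)
    hence "(cmod ((\<Psi> *\<^sub>v x) $ i))\<^sup>2 \<le>
        (\<Sum>j<dim_col \<Psi>. cmod (\<Psi> $$ (i, j)) * cmod (x $ j))\<^sup>2"
      by (intro power_mono) auto
    also have "\<dots> \<le> (\<Sum>j<dim_col \<Psi>. (cmod (\<Psi> $$ (i, j)))\<^sup>2) * (\<Sum>j<dim_col \<Psi>. (cmod (x $ j))\<^sup>2)"
      by (rule Cauchy_Schwarz_ineq_sum)
    finally show ?thesis using assms by (simp add: l2_norm_sq)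
  qed
  hence "(\<Sum>i<dim_row \<Psi>. (cmod ((\<Psi> *\<^sub>v x) $ i))\<^sup>2) \<le>
      (\<Sum>i<dim_row \<Psi>. (\<Sum>j<dim_col \<Psi>. (cmod (\<Psi> $$ (i, j)))\<^sup>2) * (l2_norm x)\<^sup>2)"
    by (intro sum_mono) simp
  thus ?thesis by (simp add: l2_norm_sq[of "\<Psi> *\<^sub>v x"] sum_distrib_right[symmetric])
qed

lemma restricted_isometry_constant_least:
  assumes "s > 0" and "dim_col \<Psi> > 0"
  shows "restricted_isometry_bound s \<Psi> (restricted_isometry_constant s \<Psi>)"
    and "restricted_isometry_bound s \<Psi> d \<Longrightarrow> restricted_isometry_constant s \<Psi> \<le> d"
proof -
  define S where "S = {d. restricted_isometry_bound s \<Psi> d}"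
  define C where "C = (\<Sum>i<dim_row \<Psi>. \<Sum>j<dim_col \<Psi>. (cmod (\<Psi> $$ (i, j)))\<^sup>2)"
  have C0: "C \<ge> 0" by (simp add: C_def sum_nonneg)
  have "1 + C \<in> S"
    unfolding S_def restricted_isometry_bound_def mem_Collect_eq
  proof (intro ballI impI conjI)
    fix x :: "complex vec" assume x: "x \<in> carrier_vec (dim_col \<Psi>)"
    have "(1 - (1 + C)) * (l2_norm x)\<^sup>2 \<le> 0" using C0 by simp
    also have "0 \<le> (l2_norm (\<Psi> *\<^sub>v x))\<^sup>2" by simp
    finally show "(1 - (1 + C)) * (l2_norm x)\<^sup>2 \<le> (l2_norm (\<Psi> *\<^sub>v x))\<^sup>2" .
    have "(l2_norm (\<Psi> *\<^sub>v x))\<^sup>2 \<le> C * (l2_norm x)\<^sup>2"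
      using l2_norm_mult_mat_vec_bound[OF x] by (simp add: C_def)
    also have "\<dots> \<le> (1 + (1 + C)) * (l2_norm x)\<^sup>2" by (intro mult_right_mono) auto
    finally show "(l2_norm (\<Psi> *\<^sub>v x))\<^sup>2 \<le> (1 + (1 + C)) * (l2_norm x)\<^sup>2" .
  qed
  hence ne: "S \<noteq> {}" by auto
  have key: "d \<in> S \<longleftrightarrow> (\<forall>x \<in> carrier_vec (dim_col \<Psi>). sparse s x \<longrightarrow> l2_norm x \<noteq> 0 \<longrightarrow>
      \<bar>(l2_norm (\<Psi> *\<^sub>v x))\<^sup>2 / (l2_norm x)\<^sup>2 - 1\<bar> \<le> d)" for d
  proof -
    have "(1 - d) * (l2_norm x)\<^sup>2 \<le> (l2_norm (\<Psi> *\<^sub>v x))\<^sup>2 \<and>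
        (l2_norm (\<Psi> *\<^sub>v x))\<^sup>2 \<le> (1 + d) * (l2_norm x)\<^sup>2 \<longleftrightarrow>
        (l2_norm x \<noteq> 0 \<longrightarrow> \<bar>(l2_norm (\<Psi> *\<^sub>v x))\<^sup>2 / (l2_norm x)\<^sup>2 - 1\<bar> \<le> d)"
      if x: "x \<in> carrier_vec (dim_col \<Psi>)" for x :: "complex vec"
    proof (cases "l2_norm x = 0")
      case True
      thus ?thesis using l2_norm_mult_mat_vec_bound[OF x] by simp
    next
      case False
      hence "(l2_norm x)\<^sup>2 > 0" by simp
      thus ?thesis using False by (auto simp: abs_le_iff field_simps)
    qed
    thus ?thesis unfolding S_def restricted_isometry_bound_def by auto
  qed
  have nz: "l2_norm (unit_vec (dim_col \<Psi>) 0) \<noteq> 0"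
  proof -
    have "(cmod (unit_vec (dim_col \<Psi>) 0 $ 0))\<^sup>2 \<le> (l2_norm (unit_vec (dim_col \<Psi>) 0))\<^sup>2"
      unfolding l2_norm_sq using assms(2) by (intro member_le_sum) auto
    thus ?thesis using assms(2) by auto
  qed
  have sp: "sparse s (unit_vec (dim_col \<Psi>) 0)"
  proof -
    have "{i. i < dim_vec (unit_vec (dim_col \<Psi>) 0 :: complex vec) \<and>
        unit_vec (dim_col \<Psi>) 0 $ i \<noteq> (0::complex)} \<subseteq> {0}"
      by (auto simp: unit_vec_def split: if_splits)
    from card_mono[OF _ this] show ?thesis using assms(1) by (simp add: sparse_def)
  qed
  have low: "0 \<le> d" if "d \<in> S" for d
  proof -
    have "\<bar>(l2_norm (\<Psi> *\<^sub>v unit_vec (dim_col \<Psi>) 0))\<^sup>2 / (l2_norm (unit_vec (dim_col \<Psi>) 0))\<^sup>2 - 1\<bar> \<le> d"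
      using that[unfolded key, rule_format, OF unit_vec_carrier sp nz] .
    thus ?thesis by linarith
  qed
  hence "bdd_below S" by (rule bdd_belowI)
  hence lower: "Inf S \<le> d" if "d \<in> S" for d
    using that by (intro cInf_lower)
  have inf: "Inf S \<in> S"
  proof (subst key, intro ballI impI cInf_greatest[OF ne])
    fix x :: "complex vec" and d
    assume "x \<in> carrier_vec (dim_col \<Psi>)" "sparse s x" "l2_norm x \<noteq> 0" "d \<in> S"
    thus "\<bar>(l2_norm (\<Psi> *\<^sub>v x))\<^sup>2 / (l2_norm x)\<^sup>2 - 1\<bar> \<le> d"
      using key[of d] by blast
  qed
  have eq: "restricted_isometry_constant s \<Psi> = Inf S"
    unfolding restricted_isometry_constant_def
  proof (rule Least_equality)
    show "restricted_isometry_bound s \<Psi> (Inf S)" using inf unfolding S_def by (rule CollectD)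
    show "Inf S \<le> d" if "restricted_isometry_bound s \<Psi> d" for d
      by (rule lower) (use that in \<open>simp add: S_def\<close>)
  qed
  show "restricted_isometry_bound s \<Psi> (restricted_isometry_constant s \<Psi>)"
    unfolding eq using inf unfolding S_def by (rule CollectD)
  show "restricted_isometry_constant s \<Psi> \<le> d" if "restricted_isometry_bound s \<Psi> d"
    unfolding eq by (rule lower) (use that in \<open>simp add: S_def\<close>)
qed


section \<open>Rademacher vectors\<close>

text \<open>The law of a Rademacher vector of length \<open>m\<close>. The lemma below shows that this is the law of
  every such vector, on whatever probability space it is defined.\<close>

definition rademacher_vec :: "nat \<Rightarrow> real vec pmf" where
  "rademacher_vec m = map_pmf (vec m) (Pi_pmf {..<m} 0 (\<lambda>_. pmf_of_set {-1, 1}))"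

lemma (in prob_space) prob_rademacher_vec:
  fixes \<epsilon> :: "nat \<Rightarrow> 'a \<Rightarrow> real"
  assumes indep: "indep_vars (\<lambda>_. count_space {-1, 1}) \<epsilon> {..<m}"
    and half: "\<And>i. i < m \<Longrightarrow> prob {\<omega> \<in> space M. \<epsilon> i \<omega> = 1} = 1 / 2"
  shows "measure_pmf.prob (rademacher_vec m) {x. P x} =
    prob {\<omega> \<in> space M. P (vec m (\<lambda>i. \<epsilon> i \<omega>))}"
proof -
  define F where "F = PiE_dflt {..<m} (0::real) (\<lambda>_. {-1, 1})"
  define V where "V = vec m ` F"
  define X where "X = (\<lambda>\<omega>. vec m (\<lambda>i. \<epsilon> i \<omega>))"
  have finF: "finite F" by (simp add: F_def finite_PiE_dflt)
  hence finV: "finite V" by (simp add: V_def)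
  have injF: "inj_on (vec m) F"
  proof (rule inj_onI, rule ext)
    fix f g i assume fg: "f \<in> F" "g \<in> F" "vec m f = vec m g"
    show "f i = g i"
    proof (cases "i < m")
      case True
      thus ?thesis using arg_cong[OF fg(3), of "\<lambda>v. v $ i"] by simp
    next
      case False
      thus ?thesis using fg(1,2) by (auto simp: F_def PiE_dflt_def)
    qed
  qed
  have setF: "set_pmf (Pi_pmf {..<m} 0 (\<lambda>_. pmf_of_set {-1, 1 :: real})) = F"
    by (simp add: set_Pi_pmf F_def)
  have meas: "\<epsilon> i \<in> measurable M (count_space {-1, 1})" if "i < m" for i
    using indep that by (auto simp: indep_vars_def)
  have val: "\<epsilon> i \<omega> \<in> {-1, 1}" if "i < m" "\<omega> \<in> space M" for i \<omega>
    using measurable_space[OF meas[OF that(1)] that(2)] by simp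
  have ev: "{\<omega> \<in> space M. \<epsilon> i \<omega> = a} \<in> events" if "i < m" "a \<in> {-1, 1}" for i a
  proof -
    have "\<epsilon> i -` {a} \<inter> space M \<in> events"
      using that by (intro measurable_sets[OF meas]) auto
    also have "\<epsilon> i -` {a} \<inter> space M = {\<omega> \<in> space M. \<epsilon> i \<omega> = a}" by auto
    finally show ?thesis .
  qed
  have half': "prob {\<omega> \<in> space M. \<epsilon> i \<omega> = a} = 1 / 2" if i: "i < m" and a: "a \<in> {-1, 1}" for i a
  proof (cases "a = 1")
    case True
    thus ?thesis using half i by simp
  next
    case False
    hence "{\<omega> \<in> space M. \<epsilon> i \<omega> = a} = space M - {\<omega> \<in> space M. \<epsilon> i \<omega> = 1}"
      using a val[OF i] by auto
    thus ?thesis using prob_compl[OF ev[OF i, of 1]] half[OF i] by simp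
  qed
  have XV: "X \<omega> \<in> V" if "\<omega> \<in> space M" for \<omega>
  proof -
    have "X \<omega> = vec m (\<lambda>i. if i < m then \<epsilon> i \<omega> else 0)" unfolding X_def by (rule eq_vecI) auto
    moreover have "(\<lambda>i. if i < m then \<epsilon> i \<omega> else 0) \<in> F"
      using val that by (auto simp: F_def PiE_dflt_def)
    ultimately show ?thesis unfolding V_def by blast
  qed
  have Xf: "{\<omega> \<in> space M. X \<omega> = vec m f} = space M \<inter> (\<Inter>i\<in>{..<m}. {\<omega> \<in> space M. \<epsilon> i \<omega> = f i})" for f
    by (auto simp: X_def vec_eq_iff)
  have point: "pmf (rademacher_vec m) v = prob {\<omega> \<in> space M. X \<omega> = v} \<and>
      {\<omega> \<in> space M. X \<omega> = v} \<in> events" if "v \<in> V" for v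
  proof -
    obtain f where f: "f \<in> F" "v = vec m f" using \<open>v \<in> V\<close> by (auto simp: V_def)
    have fi: "f i \<in> {-1, 1}" if "i < m" for i using f(1) that by (auto simp: F_def PiE_dflt_def)
    have f0: "f i = 0" if "\<not> i < m" for i using f(1) that by (auto simp: F_def PiE_dflt_def)
    have "pmf (rademacher_vec m) v = pmf (Pi_pmf {..<m} 0 (\<lambda>_. pmf_of_set {-1, 1})) f"
      unfolding rademacher_vec_def f(2) using f(1) injF setF by (intro pmf_map_inj) auto
    also have "\<dots> = (\<Prod>i<m. pmf (pmf_of_set {-1, 1}) (f i))"
      using f0 by (intro pmf_Pi') auto
    also have "\<dots> = (\<Prod>i<m. prob {\<omega> \<in> space M. \<epsilon> i \<omega> = f i})"
    proof (rule prod.cong)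
      fix i assume "i \<in> {..<m}"
      hence i: "i < m" by simp
      have "pmf (pmf_of_set {-1, 1}) (f i) = 1 / 2"
        using fi[OF i] by (subst pmf_of_set) auto
      thus "pmf (pmf_of_set {-1, 1}) (f i) = prob {\<omega> \<in> space M. \<epsilon> i \<omega> = f i}"
        using half'[OF i fi[OF i]] by simp
    qed simp
    also have "\<dots> = prob {\<omega> \<in> space M. X \<omega> = v}"
    proof (cases "m = 0")
      case True
      thus ?thesis unfolding f(2) Xf by (simp add: prob_space)
    next
      case False
      have "prob (\<Inter>i\<in>{..<m}. \<epsilon> i -` {f i} \<inter> space M) = (\<Prod>i<m. prob (\<epsilon> i -` {f i} \<inter> space M))"
        using False fi by (intro indep_varsD[OF indep]) auto
      moreover have "\<epsilon> i -` {f i} \<inter> space M = {\<omega> \<in> space M. \<epsilon> i \<omega> = f i}" for i by auto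
      moreover have "space M \<inter> (\<Inter>i\<in>{..<m}. {\<omega> \<in> space M. \<epsilon> i \<omega> = f i}) =
          (\<Inter>i\<in>{..<m}. {\<omega> \<in> space M. \<epsilon> i \<omega> = f i})" using False by auto
      ultimately show ?thesis unfolding f(2) Xf by simp
    qed
    finally have "pmf (rademacher_vec m) v = prob {\<omega> \<in> space M. X \<omega> = v}" .
    moreover have "{\<omega> \<in> space M. X \<omega> = v} \<in> events"
    proof (cases "m = 0")
      case True
      thus ?thesis unfolding f(2) Xf by simp
    next
      case False
      thus ?thesis unfolding f(2) Xf using ev fi by (intro sets.Int sets.finite_INT) auto
    qed
    ultimately show ?thesis by blast
  qed
  have setV: "set_pmf (rademacher_vec m) = V" by (simp add: rademacher_vec_def V_def setF)
  have "measure_pmf.prob (rademacher_vec m) {x. P x} =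
      measure_pmf.prob (rademacher_vec m) ({x. P x} \<inter> set_pmf (rademacher_vec m))"
    by (rule measure_Int_set_pmf[symmetric])
  also have "{x. P x} \<inter> set_pmf (rademacher_vec m) = {v \<in> V. P v}"
    unfolding setV by blast
  also have "measure_pmf.prob (rademacher_vec m) {v \<in> V. P v} =
      (\<Sum>v\<in>{v \<in> V. P v}. pmf (rademacher_vec m) v)"
    using finV by (intro measure_measure_pmf_finite) auto
  also have "\<dots> = (\<Sum>v\<in>{v \<in> V. P v}. prob {\<omega> \<in> space M. X \<omega> = v})"
    using point by (intro sum.cong) auto
  also have "\<dots> = prob (\<Union>v\<in>{v \<in> V. P v}. {\<omega> \<in> space M. X \<omega> = v})"
    using finV point by (intro finite_measure_finite_Union[symmetric]) (auto simp: disjoint_family_on_def)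
  also have "(\<Union>v\<in>{v \<in> V. P v}. {\<omega> \<in> space M. X \<omega> = v}) = {\<omega> \<in> space M. P (X \<omega>)}"
    using XV by auto
  finally show ?thesis by (simp add: X_def)
qed

end

theory Submission
  imports Defs
begin

text \<open>
Write \<open>V x\<close> for the combination of the time-frequency shifts with coefficients \<open>x\<close>. Then
\<open>\<Psi>\<^sub>h x\<close> is \<open>V x \<epsilon>\<close> divided by \<open>sqrt m\<close>. The shifts are orthogonal, with squared Frobenius norm
\<open>m\<close>, so the squared norm of \<open>\<Psi>\<^sub>h x\<close> has mean \<open>\<parallel>x\<parallel>\<^sup>2\<close>. The restricted isometry constant is therefore the
supremum, over sparse unit vectors \<open>x\<close>, of a centred quadratic form in random signs. As in the work
of Krahmer, Mendelson and Rauhut, the moments of such a supremum are bounded by chaining.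
Below, \<open>A\<close> stands for \<open>V x\<close> divided by \<open>sqrt m\<close>.

\<^item> The chaos. For independent sign vectors \<open>\<epsilon>\<close> and \<open>\<epsilon>'\<close> the difference of the two values of the
form is the real part of the inner product of \<open>A (\<epsilon> + \<epsilon>')\<close> and \<open>A (\<epsilon> - \<epsilon>')\<close>. The vectors
\<open>\<epsilon> + \<epsilon>'\<close> and \<open>\<epsilon> - \<epsilon>'\<close> have disjoint supports, and the first can be multiplied by a further
sign vector without changing the joint law. Given the second one, an increment along a chain of nets is
thus a Rademacher sum. Its size is at most the operator norm of the increment times the norm of
\<open>A (\<epsilon> - \<epsilon>')\<close>, and the latter norm is controlled by the supremum itself. The resulting inequality
for the moments is solved in \<open>chaos_sup_moment\<close>.

\<^item> The nets. The metric is the operator norm of \<open>V x\<close>. A signed sum of \<open>n\<close> contractions of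
dimension \<open>m\<close> can be balanced to norm of order \<open>sqrt (n * ln m)\<close> (\<open>exists_balanced_signing\<close>):
after expanding a high trace moment into words, the noncommutative sum is dominated by the scalar sum
of the signs. Halving a long average of contractions repeatedly in this way yields nets whose
logarithmic size is of order \<open>2 ^ i * (ln m)\<^sup>2\<close> at distance of order \<open>sqrt (s / 2 ^ i)\<close>
(\<open>exists_net\<close>).

\<^item> The sum over the levels. Each level contributes \<open>sqrt (s / m) * ln m\<close> to the bound. Once
\<open>2 ^ i\<close> exceeds \<open>s\<close> the full set of sparse grid vectors is reached in one more step, so there are
only about \<open>ln s\<close> levels. For \<open>p\<close> of order \<open>(ln m * ln s)\<^sup>2\<close> the \<open>p\<close>-th moment of the supremum is
therefore at most the \<open>p\<close>-th power of a multiple of \<open>sqrt (s / m) * ln s * ln m\<close>, which is a small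
multiple of \<open>\<delta>\<close> by hypothesis. Markov's inequality gives the failure probability \<open>exp (- p)\<close>
(\<open>sparse_combinations_rip\<close>).

Sign vectors are averaged over explicitly, and matrices are functions of two indices below \<open>m\<close>.
\<close>

section \<open>Uniform averages over sign vectors\<close>

text \<open>Sign vectors vanish from \<open>n\<close> on, so that products and negatives of sign vectors, formed
  pointwise, stay in the set, and so that the set carries the law of a Rademacher vector.\<close>

definition signs :: "nat \<Rightarrow> (nat \<Rightarrow> real) set" where
  "signs n = PiE_dflt {..<n} 0 (\<lambda>_. {-1, 1})"

definition avg :: "nat \<Rightarrow> ((nat \<Rightarrow> real) \<Rightarrow> real) \<Rightarrow> real" where
  "avg n f = (\<Sum>\<epsilon>\<in>signs n. f \<epsilon>) / 2 ^ n"

lemma mem_signs_iff: "\<epsilon> \<in> signs n \<longleftrightarrow> (\<forall>i<n. \<epsilon> i = 1 \<or> \<epsilon> i = -1) \<and> (\<forall>i\<ge>n. \<epsilon> i = 0)"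
  by (auto simp: signs_def PiE_dflt_def not_less)

lemma finite_signs [simp]: "finite (signs n)"
  by (auto simp: signs_def)

lemma card_signs [simp]: "card (signs n) = 2 ^ n"
  by (simp add: signs_def card_PiE_dflt numeral_2_eq_2[symmetric])

lemma avg_const [simp]: "avg n (\<lambda>_. c) = c"
  by (simp add: avg_def)

lemma avg_add: "avg n (\<lambda>\<epsilon>. f \<epsilon> + g \<epsilon>) = avg n f + avg n g"
  by (simp add: avg_def sum.distrib add_divide_distrib)

lemma avg_diff: "avg n (\<lambda>\<epsilon>. f \<epsilon> - g \<epsilon>) = avg n f - avg n g"
  by (simp add: avg_def sum_subtractf diff_divide_distrib)

lemma avg_cmult: "avg n (\<lambda>\<epsilon>. c * f \<epsilon>) = c * avg n f"
  by (simp add: avg_def sum_distrib_left)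

lemma avg_sum: "avg n (\<lambda>\<epsilon>. \<Sum>i\<in>I. f i \<epsilon>) = (\<Sum>i\<in>I. avg n (f i))"
proof -
  have "(\<Sum>\<epsilon>\<in>signs n. \<Sum>i\<in>I. f i \<epsilon>) = (\<Sum>i\<in>I. \<Sum>\<epsilon>\<in>signs n. f i \<epsilon>)" by (rule sum.swap)
  thus ?thesis by (simp add: avg_def sum_divide_distrib)
qed

lemma avg_mono: "(\<And>\<epsilon>. \<epsilon> \<in> signs n \<Longrightarrow> f \<epsilon> \<le> g \<epsilon>) \<Longrightarrow> avg n f \<le> avg n g"
  by (auto simp: avg_def intro!: divide_right_mono sum_mono)

lemma avg_cong: "(\<And>\<epsilon>. \<epsilon> \<in> signs n \<Longrightarrow> f \<epsilon> = g \<epsilon>) \<Longrightarrow> avg n f = avg n g"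
  by (auto simp: avg_def)

lemma avg_nonneg: "(\<And>\<epsilon>. \<epsilon> \<in> signs n \<Longrightarrow> 0 \<le> f \<epsilon>) \<Longrightarrow> 0 \<le> avg n f"
  by (auto simp: avg_def intro!: divide_nonneg_nonneg sum_nonneg)

lemma exists_le_avg: "\<exists>\<epsilon>\<in>signs n. f \<epsilon> \<le> avg n f"
proof (rule ccontr)
  assume "\<not> ?thesis"
  hence "\<forall>\<epsilon>\<in>signs n. avg n f < f \<epsilon>" by auto
  moreover have "signs n \<noteq> {}" by (metis card.empty card_signs power_not_zero zero_neq_numeral)
  ultimately have "(\<Sum>\<epsilon>\<in>signs n. avg n f) < (\<Sum>\<epsilon>\<in>signs n. f \<epsilon>)"
    by (intro sum_strict_mono) auto
  thus False by (simp add: avg_def)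
qed

lemma avg_swap: "avg n (\<lambda>\<epsilon>. avg k (\<lambda>\<eta>. f \<epsilon> \<eta>)) = avg k (\<lambda>\<eta>. avg n (\<lambda>\<epsilon>. f \<epsilon> \<eta>))"
proof -
  have "(\<Sum>\<epsilon>\<in>signs n. \<Sum>\<eta>\<in>signs k. f \<epsilon> \<eta>) = (\<Sum>\<eta>\<in>signs k. \<Sum>\<epsilon>\<in>signs n. f \<epsilon> \<eta>)" by (rule sum.swap)
  thus ?thesis by (simp add: avg_def sum_divide_distrib[symmetric])
qed

lemma avg_avg_eq_sum: "avg n (\<lambda>\<epsilon>. avg n (f \<epsilon>)) = (\<Sum>(\<epsilon>,\<epsilon>')\<in>signs n \<times> signs n. f \<epsilon> \<epsilon>') / 4 ^ n"
proof -
  have "(4::real) ^ n = 2 ^ n * 2 ^ n" by (simp flip: power_mult_distrib)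
  thus ?thesis by (simp add: avg_def sum_divide_distrib[symmetric] sum.cartesian_product)
qed

lemma avg_prod:
  "avg n (\<lambda>\<epsilon>. \<Prod>i<n. f i (\<epsilon> i)) = (\<Prod>i<n. (f i 1 + f i (-1)) / 2)"
proof -
  have bij: "bij_betw (\<lambda>h. restrict h {..<n}) (signs n) (PiE {..<n} (\<lambda>_. {-1, 1 :: real}))"
  proof (rule bij_betw_imageI)
    show "inj_on (\<lambda>h. restrict h {..<n}) (signs n)"
    proof (rule inj_onI, rule ext)
      fix f g :: "nat \<Rightarrow> real" and i
      assume "f \<in> signs n" "g \<in> signs n" "restrict f {..<n} = restrict g {..<n}"
      thus "f i = g i"
        by (cases "i < n") (metis lessThan_iff restrict_apply', simp add: mem_signs_iff)
    qed
    show "(\<lambda>h. restrict h {..<n}) ` signs n = PiE {..<n} (\<lambda>_. {-1, 1})"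
      unfolding signs_def by (rule restrict_PiE_dflt)
  qed
  have "(\<Prod>i<n. f i 1 + f i (-1)) = (\<Prod>i<n. \<Sum>y\<in>{-1,1}. f i y)"
    by (intro prod.cong) auto
  also have "\<dots> = (\<Sum>g\<in>PiE {..<n} (\<lambda>_. {-1, 1 :: real}). \<Prod>i<n. f i (g i))"
    by (rule prod_sum_PiE) auto
  also have "\<dots> = (\<Sum>\<epsilon>\<in>signs n. \<Prod>i<n. f i (\<epsilon> i))"
    by (subst sum.reindex_bij_betw[OF bij, symmetric]) (auto intro!: sum.cong prod.cong)
  finally show ?thesis by (simp add: avg_def prod_dividef)
qed

text \<open>Even powers of a sign are \<open>1\<close>, and odd powers have average \<open>0\<close>.\<close>

lemma avg_word_nonneg:
  assumes "set w \<subseteq> {..<n}"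
  shows "0 \<le> avg n (\<lambda>\<epsilon>. prod_list (map \<epsilon> w))"
proof -
  have "prod_list (map \<epsilon> w) = (\<Prod>i<n. \<epsilon> i ^ count_list w i)" for \<epsilon> :: "nat \<Rightarrow> real"
    using assms
  proof (induction w)
    case (Cons a w)
    have "(\<Prod>i<n. \<epsilon> i ^ count_list (a # w) i) = (\<Prod>i<n. (if i = a then \<epsilon> a else 1) * \<epsilon> i ^ count_list w i)"
      by (intro prod.cong) auto
    also have "\<dots> = \<epsilon> a * (\<Prod>i<n. \<epsilon> i ^ count_list w i)"
      using Cons.prems by (simp add: prod.distrib)
    finally show ?case using Cons by simp
  qed simp
  hence "avg n (\<lambda>\<epsilon>. prod_list (map \<epsilon> w)) = (\<Prod>i<n. (1 ^ count_list w i + (-1) ^ count_list w i) / 2)"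
    using avg_prod[of n "\<lambda>i e. e ^ count_list w i"] by simp
  also have "\<dots> \<ge> 0"
    by (intro prod_nonneg) (auto simp: uminus_power_if)
  finally show ?thesis .
qed

lemma avg_sign_mult:
  assumes "j < n" "k < n"
  shows "avg n (\<lambda>\<epsilon>. \<epsilon> j * \<epsilon> k) = (if j = k then 1 else 0)"
proof -
  have "\<epsilon> j * \<epsilon> k = (\<Prod>i<n. (if i = j then \<epsilon> i else 1) * (if i = k then \<epsilon> i else 1))" for \<epsilon> :: "nat \<Rightarrow> real"
    using assms by (simp add: prod.distrib)
  hence "avg n (\<lambda>\<epsilon>. \<epsilon> j * \<epsilon> k) =
      (\<Prod>i<n. ((if i = j then 1 else 1) * (if i = k then 1 else 1)
        + (if i = j then -1 else 1) * (if i = k then -1 else 1)) / 2)"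
    using avg_prod[of n "\<lambda>i e. (if i = j then e else 1) * (if i = k then e else 1)"] by simp
  also have "\<dots> = (if j = k then 1 else 0)"
  proof (cases "j = k")
    case True
    thus ?thesis by (auto intro!: prod.neutral)
  next
    case False
    hence "(if j = k then 1 else 0) = (0::real)" by simp
    moreover have "(\<Prod>i<n. ((if i = j then 1 else 1) * (if i = k then 1 else 1)
        + (if i = j then -1 else 1) * (if i = k then -1 else 1)) / 2) = (0::real)"
      by (rule prod_zero) (use False assms(1) in \<open>auto intro!: bexI[of _ j]\<close>)
    ultimately show ?thesis by simp
  qed
  finally show ?thesis .
qed

lemma cosh_le_exp_half_square: "cosh x \<le> exp (x\<^sup>2 / 2)" for x :: real
proof -
  have main: "cosh x \<le> exp (x\<^sup>2 / 2)" if "x \<ge> 0" for x :: real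
  proof -
    have tanh: "tanh y \<le> y" if "y \<ge> 0" for y :: real
    proof -
      have "0 - tanh 0 \<le> y - tanh y"
      proof (rule DERIV_nonneg_imp_nondecreasing[OF that])
        fix z :: real
        have "((\<lambda>z. z - tanh z) has_real_derivative (tanh z)\<^sup>2) (at z)"
          by (auto intro!: derivative_eq_intros simp: cosh_real_nonzero)
        thus "\<exists>d. ((\<lambda>z. z - tanh z) has_real_derivative d) (at z) \<and> 0 \<le> d" by force
      qed
      thus ?thesis by simp
    qed
    have "0\<^sup>2 / 2 - ln (cosh 0) \<le> x\<^sup>2 / 2 - ln (cosh x)"
    proof (rule DERIV_nonneg_imp_nondecreasing[OF that])
      fix z :: real assume z: "0 \<le> z"
      have "((\<lambda>z. z\<^sup>2 / 2 - ln (cosh z)) has_real_derivative (z - tanh z)) (at z)"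
        by (auto intro!: derivative_eq_intros simp: tanh_def cosh_real_pos)
      thus "\<exists>d. ((\<lambda>z. z\<^sup>2 / 2 - ln (cosh z)) has_real_derivative d) (at z) \<and> 0 \<le> d"
        using tanh[OF z] by force
    qed
    hence "ln (cosh x) \<le> x\<^sup>2 / 2" by simp
    thus ?thesis by (metis cosh_real_pos exp_le_cancel_iff exp_ln)
  qed
  show ?thesis using main[of x] main[of "-x"] by (cases "x \<ge> 0") auto
qed

lemma avg_exp_le:
  "avg n (\<lambda>\<epsilon>. exp (\<Sum>i<n. a i * \<epsilon> i)) \<le> exp ((\<Sum>i<n. (a i)\<^sup>2) / 2)"
proof -
  have "avg n (\<lambda>\<epsilon>. exp (\<Sum>i<n. a i * \<epsilon> i)) = avg n (\<lambda>\<epsilon>. \<Prod>i<n. exp (a i * \<epsilon> i))"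
    by (simp add: exp_sum)
  also have "\<dots> = (\<Prod>i<n. cosh (a i))"
    by (subst avg_prod[of n "\<lambda>i e. exp (a i * e)"]) (simp add: cosh_field_def)
  also have "\<dots> \<le> (\<Prod>i<n. exp ((a i)\<^sup>2 / 2))"
    by (intro prod_mono conjI cosh_le_exp_half_square) simp
  also have "\<dots> = exp ((\<Sum>i<n. (a i)\<^sup>2) / 2)"
    by (simp add: exp_sum sum_divide_distrib)
  finally show ?thesis .
qed

lemma even_power_le_fact_cosh: "x ^ (2 * q) \<le> fact (2 * q) * cosh x" for x :: real
proof -
  have "(\<Sum>n\<in>{2 * q}. if even n then x ^ n /\<^sub>R fact n else 0) \<le> (\<Sum>n. if even n then x ^ n /\<^sub>R fact n else 0)"
    by (intro sum_le_suminf sums_summable[OF cosh_converges]) auto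
  hence "x ^ (2 * q) / fact (2 * q) \<le> cosh x"
    using sums_unique[OF cosh_converges[of x]] by (simp add: divide_inverse_commute)
  thus ?thesis by (simp add: field_simps)
qed

text \<open>Khintchine's inequality. The growth of the constant like \<open>q ^ q\<close> is what allows the order of
  the moment to be adapted to the logarithm of the number of sums in a union bound.\<close>

lemma khintchine:
  assumes "q \<ge> 1"
  shows "avg n (\<lambda>\<epsilon>. (\<Sum>i<n. a i * \<epsilon> i) ^ (2 * q)) \<le> (6 * real q * (\<Sum>i<n. (a i)\<^sup>2)) ^ q"
proof (cases "(\<Sum>i<n. (a i)\<^sup>2) = 0")
  case True
  hence "\<forall>i<n. a i = 0" by (subst (asm) sum_nonneg_eq_0_iff) auto
  thus ?thesis using assms by (simp add: zero_power)
next
  case False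
  define A where "A = (\<Sum>i<n. (a i)\<^sup>2)"
  have A: "A > 0" using False by (simp add: A_def order_less_le sum_nonneg)
  \<comment> \<open>The exponential moment is used at the parameter that minimises the resulting bound.\<close>
  define l where "l = sqrt (2 * real q / A)"
  have l2: "l\<^sup>2 = 2 * real q / A" and l0: "l > 0" using A assms by (auto simp: l_def)
  have lA: "(\<Sum>i<n. (l * a i)\<^sup>2) / 2 = real q" "(\<Sum>i<n. (- l * a i)\<^sup>2) / 2 = real q"
  proof -
    have "l\<^sup>2 * A / 2 = real q" using A by (simp add: l2)
    thus "(\<Sum>i<n. (l * a i)\<^sup>2) / 2 = real q" "(\<Sum>i<n. (- l * a i)\<^sup>2) / 2 = real q"
      by (simp_all add: power_mult_distrib A_def sum_distrib_left)
  qed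
  define S where "S \<epsilon> = (\<Sum>i<n. a i * \<epsilon> i)" for \<epsilon> :: "nat \<Rightarrow> real"
  have Sl: "l * S \<epsilon> = (\<Sum>i<n. (l * a i) * \<epsilon> i)" "- (l * S \<epsilon>) = (\<Sum>i<n. (- l * a i) * \<epsilon> i)" for \<epsilon>
    by (simp_all add: S_def sum_distrib_left sum_negf mult.assoc)
  have "l ^ (2 * q) * avg n (\<lambda>\<epsilon>. S \<epsilon> ^ (2 * q)) = avg n (\<lambda>\<epsilon>. (l * S \<epsilon>) ^ (2 * q))"
    by (simp add: power_mult_distrib avg_cmult)
  also have "\<dots> \<le> avg n (\<lambda>\<epsilon>. fact (2 * q) * cosh (l * S \<epsilon>))"
    by (intro avg_mono even_power_le_fact_cosh)
  also have "\<dots> = fact (2 * q) * ((avg n (\<lambda>\<epsilon>. exp (l * S \<epsilon>)) + avg n (\<lambda>\<epsilon>. exp (- (l * S \<epsilon>)))) / 2)"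
    unfolding avg_cmult avg_add[symmetric] cosh_field_def
    using avg_cmult[of n "1/2"] by simp
  also have "\<dots> \<le> fact (2 * q) * ((exp (real q) + exp (real q)) / 2)"
  proof -
    have "avg n (\<lambda>\<epsilon>. exp (l * S \<epsilon>)) \<le> exp (real q)"
      unfolding Sl(1) lA(1)[symmetric] by (rule avg_exp_le)
    moreover have "avg n (\<lambda>\<epsilon>. exp (- (l * S \<epsilon>))) \<le> exp (real q)"
      unfolding Sl(2) lA(2)[symmetric] by (rule avg_exp_le)
    ultimately
    show ?thesis by (intro mult_left_mono divide_right_mono add_mono) auto
  qed
  also have "\<dots> = fact (2 * q) * exp (real q)" by simp
  also have "\<dots> \<le> (2 * real q) ^ (2 * q) * 3 ^ q"
  proof (intro mult_mono)
    show "fact (2 * q) \<le> (2 * real q) ^ (2 * q)"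
      using fact_le_power[where n = "2 * q" and 'a = real] by simp
    have "exp (real q) = exp 1 ^ q" by (simp flip: exp_of_nat_mult)
    also have "\<dots> \<le> 3 ^ q" by (intro power_mono exp_le) auto
    finally show "exp (real q) \<le> 3 ^ q" .
  qed auto
  also have "\<dots> = l ^ (2 * q) * (6 * real q * A) ^ q"
  proof -
    have "l\<^sup>2 * (6 * real q * A) = (l\<^sup>2 * A) * (6 * real q)" by (simp only: mult_ac)
    also have "l\<^sup>2 * A = 2 * real q" using A by (simp add: l2)
    finally have "(2 * real q)\<^sup>2 * 3 = l\<^sup>2 * (6 * real q * A)" by (simp only: power2_eq_square)
    thus ?thesis by (simp only: power_mult power_mult_distrib[symmetric])
  qed
  finally show ?thesis
    using l0 by (simp add: S_def A_def)
qed

section \<open>Moments of sums\<close>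

lemma avg_power_le:
  assumes "even p"
  shows "avg n f ^ p \<le> avg n (\<lambda>\<epsilon>. f \<epsilon> ^ p)"
proof -
  have "signs n \<noteq> {}" by (metis card.empty card_signs power_not_zero zero_neq_numeral)
  hence "(\<Sum>\<epsilon>\<in>signs n. (1 / 2 ^ n) *\<^sub>R f \<epsilon>) ^ p \<le> (\<Sum>\<epsilon>\<in>signs n. (1 / 2 ^ n) * f \<epsilon> ^ p)"
    by (intro convex_on_sum[OF _ _ convex_power_even[OF assms]]) auto
  thus ?thesis by (simp add: avg_def sum_divide_distrib)
qed

text \<open>Minkowski's inequality for even exponents. With \<open>B\<close> the sum of the \<open>b i\<close>, the sum of the
  \<open>Y i\<close> is the mean of the \<open>(B / b i) Y i\<close> for the weights \<open>b i / B\<close>, so it is Jensen's inequality.\<close>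

lemma minkowski_even:
  fixes Y :: "'i \<Rightarrow> 'w \<Rightarrow> real"
  assumes p: "even p" and I: "finite I" "I \<noteq> {}" and b: "\<And>i. i \<in> I \<Longrightarrow> b i > 0"
    and Y: "\<And>i. i \<in> I \<Longrightarrow> (\<Sum>w\<in>S. Y i w ^ p) \<le> c * b i ^ p"
  shows "(\<Sum>w\<in>S. (\<Sum>i\<in>I. Y i w) ^ p) \<le> c * (\<Sum>i\<in>I. b i) ^ p"
proof -
  define B where "B = (\<Sum>i\<in>I. b i)"
  have B: "B > 0" using I b by (auto simp: B_def intro!: sum_pos)
  have w1: "(\<Sum>i\<in>I. b i / B) = 1" using B by (simp add: B_def sum_divide_distrib[symmetric])
  have "(\<Sum>w\<in>S. (\<Sum>i\<in>I. Y i w) ^ p) \<le> (\<Sum>w\<in>S. \<Sum>i\<in>I. (b i / B) * ((B / b i) * Y i w) ^ p)"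
  proof (rule sum_mono)
    fix w
    have "(\<Sum>i\<in>I. (b i / B) *\<^sub>R ((B / b i) * Y i w)) ^ p \<le> (\<Sum>i\<in>I. (b i / B) * ((B / b i) * Y i w) ^ p)"
      by (rule convex_on_sum[OF I convex_power_even[OF p] w1]) (use b B in \<open>auto intro: less_imp_le\<close>)
    moreover have "(b i / B) *\<^sub>R ((B / b i) * Y i w) = Y i w" if "i \<in> I" for i
      using b[OF that] B by simp
    ultimately show "(\<Sum>i\<in>I. Y i w) ^ p \<le> (\<Sum>i\<in>I. (b i / B) * ((B / b i) * Y i w) ^ p)" by simp
  qed
  also have "\<dots> = (\<Sum>i\<in>I. (b i / B) * (B / b i) ^ p * (\<Sum>w\<in>S. Y i w ^ p))"
    by (subst sum.swap) (simp only: power_mult_distrib sum_distrib_left mult.assoc)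
  also have "\<dots> \<le> (\<Sum>i\<in>I. (b i / B) * (B / b i) ^ p * (c * b i ^ p))"
    using b B Y by (intro sum_mono mult_left_mono mult_nonneg_nonneg) (auto simp: less_imp_le)
  also have "\<dots> = (\<Sum>i\<in>I. (b i / B) * (c * B ^ p))"
  proof (intro sum.cong refl)
    fix i assume "i \<in> I"
    hence "B = (B / b i) * b i" using b by force
    hence "B ^ p = (B / b i) ^ p * b i ^ p" by (metis power_mult_distrib)
    thus "b i / B * (B / b i) ^ p * (c * b i ^ p) = b i / B * (c * B ^ p)" by (simp only: mult_ac)
  qed
  also have "\<dots> = c * B ^ p" using w1 by (simp only: sum_distrib_right[symmetric])
  finally show ?thesis by (simp add: B_def)
qed

text \<open>This replaces Jensen's inequality when a \<open>p\<close>-th moment is bounded through a higher one: if \<open>b\<close>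
  is at least \<open>3\<close> times the \<open>q\<close>-th moment norm of \<open>y\<close>, then the second term has mean at most
  \<open>b ^ p / 3 ^ q\<close>, which leaves room for a sum over many such variables.\<close>

lemma power_le_power_add_higher:
  fixes y b :: real
  assumes "0 \<le> y" "0 < b" "p \<le> q"
  shows "y ^ p \<le> b ^ p + y ^ q / b ^ (q - p)"
proof (cases "y \<le> b")
  case True
  hence "y ^ p \<le> b ^ p" using assms by (intro power_mono)
  thus ?thesis using assms by (simp add: add_increasing2)
next
  case False
  have "y ^ p * b ^ (q - p) \<le> y ^ p * y ^ (q - p)"
    using False assms by (intro mult_left_mono power_mono) auto
  also have "\<dots> = y ^ q" using assms by (simp flip: power_add)
  finally have "y ^ p \<le> y ^ q / b ^ (q - p)" using assms by (simp add: field_simps)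
  thus ?thesis using assms by (simp add: add_increasing)
qed

section \<open>Operator norms of complex matrices\<close>

definition norm2 :: "nat \<Rightarrow> (nat \<Rightarrow> complex) \<Rightarrow> real" where
  "norm2 m f = L2_set (\<lambda>i. cmod (f i)) {..<m}"

definition cinner :: "nat \<Rightarrow> (nat \<Rightarrow> complex) \<Rightarrow> (nat \<Rightarrow> complex) \<Rightarrow> complex" where
  "cinner m f g = (\<Sum>i<m. f i * cnj (g i))"

definition mat_app :: "nat \<Rightarrow> (nat \<Rightarrow> nat \<Rightarrow> complex) \<Rightarrow> (nat \<Rightarrow> complex) \<Rightarrow> nat \<Rightarrow> complex" where
  "mat_app m A f = (\<lambda>i. \<Sum>j<m. A i j * f j)"

definition adj :: "(nat \<Rightarrow> nat \<Rightarrow> complex) \<Rightarrow> nat \<Rightarrow> nat \<Rightarrow> complex" where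
  "adj A = (\<lambda>i j. cnj (A j i))"

text \<open>Bounds for the operator norm are stated as a relation, which spares the discussion of a supremum.\<close>

definition op_norm_le :: "nat \<Rightarrow> real \<Rightarrow> (nat \<Rightarrow> nat \<Rightarrow> complex) \<Rightarrow> bool" where
  "op_norm_le m D A \<longleftrightarrow> (\<forall>f. norm2 m (mat_app m A f) \<le> D * norm2 m f)"

lemma norm2_nonneg [simp]: "0 \<le> norm2 m f"
  by (simp add: norm2_def)

lemma norm2_sq: "(norm2 m f)\<^sup>2 = (\<Sum>i<m. (cmod (f i))\<^sup>2)"
  by (simp add: norm2_def L2_set_def sum_nonneg)

lemma norm2_cong: "(\<And>i. i < m \<Longrightarrow> f i = g i) \<Longrightarrow> norm2 m f = norm2 m g"
  by (auto simp: norm2_def intro: L2_set_cong)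

lemma norm2_eq_0_iff: "norm2 m f = 0 \<longleftrightarrow> (\<forall>i<m. f i = 0)"
  by (auto simp: norm2_def L2_set_eq_0_iff)

lemma norm2_triangle: "norm2 m (\<lambda>i. f i + g i) \<le> norm2 m f + norm2 m g"
  unfolding norm2_def
  by (rule order_trans[OF L2_set_mono[OF norm_triangle_ineq] L2_set_triangle_ineq]) auto

lemma norm2_cmult: "norm2 m (\<lambda>i. c * f i) = cmod c * norm2 m f"
  by (simp add: norm2_def norm_mult L2_set_right_distrib)

lemma norm2_diff_commute: "norm2 m (\<lambda>i. f i - g i) = norm2 m (\<lambda>i. g i - f i)"
  by (simp add: norm2_def norm_minus_commute)

lemma norm2_triangle_diff: "norm2 m (\<lambda>i. f i - g i) \<le> norm2 m f + norm2 m g"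
  using norm2_triangle[of m f "\<lambda>i. (-1) * g i"] norm2_cmult[of m "-1" g] by simp

lemma norm2_zero [simp]: "norm2 m (\<lambda>_. 0) = 0"
  by (simp add: norm2_eq_0_iff)

lemma norm2_sum: "norm2 m (\<lambda>i. \<Sum>k\<in>K. f k i) \<le> (\<Sum>k\<in>K. norm2 m (f k))"
proof (induction K rule: infinite_finite_induct)
  case (insert k K)
  thus ?case using norm2_triangle[of m "f k" "\<lambda>i. \<Sum>k\<in>K. f k i"] by simp
qed auto

lemma cinner_le: "cmod (cinner m f g) \<le> norm2 m f * norm2 m g"
proof -
  have "cmod (cinner m f g) \<le> (\<Sum>i<m. \<bar>cmod (f i)\<bar> * \<bar>cmod (g i)\<bar>)"
    unfolding cinner_def by (rule order_trans[OF norm_sum]) (simp add: norm_mult)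
  also have "\<dots> \<le> norm2 m f * norm2 m g" unfolding norm2_def by (rule L2_set_mult_ineq)
  finally show ?thesis .
qed

lemma cinner_self: "cinner m f f = complex_of_real ((norm2 m f)\<^sup>2)"
  unfolding norm2_sq cinner_def of_real_sum by (intro sum.cong refl) (metis complex_norm_square)

lemma cinner_adj: "cinner m (mat_app m A f) g = cinner m f (mat_app m (adj A) g)"
proof -
  have "cinner m (mat_app m A f) g = (\<Sum>i<m. \<Sum>j<m. A i j * f j * cnj (g i))"
    by (simp add: cinner_def mat_app_def sum_distrib_right)
  also have "\<dots> = (\<Sum>j<m. \<Sum>i<m. A i j * f j * cnj (g i))" by (rule sum.swap)
  also have "\<dots> = cinner m f (mat_app m (adj A) g)"
    by (simp add: cinner_def mat_app_def adj_def sum_distrib_left mult_ac)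
  finally show ?thesis .
qed

lemma mat_app_add: "mat_app m A (\<lambda>i. f i + g i) = (\<lambda>i. mat_app m A f i + mat_app m A g i)"
  by (simp add: mat_app_def algebra_simps sum.distrib)

lemma mat_app_diff: "mat_app m A (\<lambda>i. f i - g i) = (\<lambda>i. mat_app m A f i - mat_app m A g i)"
  by (simp add: mat_app_def algebra_simps sum_subtractf)

lemma mat_app_cmult: "mat_app m A (\<lambda>i. c * f i) = (\<lambda>i. c * mat_app m A f i)"
  by (simp add: mat_app_def sum_distrib_left mult_ac)

lemma mat_app_sum: "mat_app m A (\<lambda>i. \<Sum>k\<in>K. f k i) = (\<lambda>i. \<Sum>k\<in>K. mat_app m A (f k) i)"
  by (rule ext, simp add: mat_app_def sum_distrib_left, rule sum.swap)

lemma mat_app_matrix_sum: "mat_app m (\<lambda>i j. \<Sum>k\<in>K. A k i j) f = (\<lambda>i. \<Sum>k\<in>K. mat_app m (A k) f i)"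
  by (rule ext, simp add: mat_app_def sum_distrib_right, rule sum.swap)

lemma mat_app_matrix_cmult: "mat_app m (\<lambda>i j. c * A i j) f = (\<lambda>i. c * mat_app m A f i)"
  by (simp add: mat_app_def sum_distrib_left mult_ac)

lemma mat_app_matrix_diff: "mat_app m (\<lambda>i j. A i j - B i j) f = (\<lambda>i. mat_app m A f i - mat_app m B f i)"
  by (simp add: mat_app_def algebra_simps sum_subtractf)

lemma mat_app_matrix_add: "mat_app m (\<lambda>i j. A i j + B i j) f = (\<lambda>i. mat_app m A f i + mat_app m B f i)"
  by (simp add: mat_app_def algebra_simps sum.distrib)

lemma mat_app_cong: "(\<And>i. i < m \<Longrightarrow> f i = g i) \<Longrightarrow> mat_app m A f = mat_app m A g"
  by (auto simp: mat_app_def fun_eq_iff intro!: sum.cong)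

lemma op_norm_leD: "op_norm_le m D A \<Longrightarrow> norm2 m (mat_app m A f) \<le> D * norm2 m f"
  by (simp add: op_norm_le_def)

lemma op_norm_le_adj:
  assumes "op_norm_le m D A" "0 \<le> D"
  shows "op_norm_le m D (adj A)"
  unfolding op_norm_le_def
proof
  fix g
  let ?h = "mat_app m (adj A) g"
  have "(norm2 m ?h)\<^sup>2 = cmod (cinner m ?h ?h)" by (simp add: cinner_self norm_power)
  also have "cinner m ?h ?h = cinner m (mat_app m A ?h) g"
    by (simp only: cinner_adj)
  also have "cmod \<dots> \<le> norm2 m (mat_app m A ?h) * norm2 m g" by (rule cinner_le)
  also have "\<dots> \<le> (D * norm2 m ?h) * norm2 m g" by (intro mult_right_mono op_norm_leD assms) auto
  finally have "norm2 m ?h * norm2 m ?h \<le> (D * norm2 m g) * norm2 m ?h"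
    by (simp add: power2_eq_square mult_ac)
  thus "norm2 m ?h \<le> D * norm2 m g"
    using assms(2) by (cases "norm2 m ?h = 0") (auto simp: order_less_le)
qed

lemma op_norm_le_mono: "op_norm_le m D A \<Longrightarrow> D \<le> E \<Longrightarrow> op_norm_le m E A"
  unfolding op_norm_le_def by (meson mult_right_mono norm2_nonneg order_trans)

lemma op_norm_le_cmult: "op_norm_le m D A \<Longrightarrow> op_norm_le m (cmod c * D) (\<lambda>i j. c * A i j)"
  unfolding op_norm_le_def mat_app_matrix_cmult norm2_cmult by (simp add: mult_left_mono mult.assoc)

lemma op_norm_le_add: "op_norm_le m D A \<Longrightarrow> op_norm_le m E B \<Longrightarrow> op_norm_le m (D + E) (\<lambda>i j. A i j + B i j)"
  unfolding op_norm_le_def mat_app_matrix_add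
  by (intro allI order_trans[OF norm2_triangle]) (simp add: add_mono distrib_right)

lemma op_norm_le_sum:
  assumes "\<And>k. k \<in> K \<Longrightarrow> op_norm_le m (D k) (A k)"
  shows "op_norm_le m (\<Sum>k\<in>K. D k) (\<lambda>i j. \<Sum>k\<in>K. A k i j)"
  unfolding op_norm_le_def mat_app_matrix_sum
proof
  fix f
  have "norm2 m (\<lambda>i. \<Sum>k\<in>K. mat_app m (A k) f i) \<le> (\<Sum>k\<in>K. norm2 m (mat_app m (A k) f))" by (rule norm2_sum)
  also have "\<dots> \<le> (\<Sum>k\<in>K. D k * norm2 m f)" by (intro sum_mono op_norm_leD assms)
  finally show "norm2 m (\<lambda>i. \<Sum>k\<in>K. mat_app m (A k) f i) \<le> (\<Sum>k\<in>K. D k) * norm2 m f"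
    by (simp add: sum_distrib_right)
qed

lemma op_norm_le_diff: "op_norm_le m D A \<Longrightarrow> op_norm_le m E B \<Longrightarrow> op_norm_le m (D + E) (\<lambda>i j. A i j - B i j)"
  using op_norm_le_add[of m D A E "\<lambda>i j. (-1) * B i j"] op_norm_le_cmult[of m E B "-1"] by simp

lemma op_norm_le_triangle:
  "op_norm_le m D (\<lambda>i j. A i j - B i j) \<Longrightarrow> op_norm_le m E (\<lambda>i j. B i j - C i j) \<Longrightarrow> op_norm_le m (D + E) (\<lambda>i j. A i j - C i j)"
  using op_norm_le_add[of m D "\<lambda>i j. A i j - B i j" E "\<lambda>i j. B i j - C i j"] by simp

lemma op_norm_le_diff_commute: "op_norm_le m D (\<lambda>i j. A i j - B i j) \<Longrightarrow> op_norm_le m D (\<lambda>i j. B i j - A i j)"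
  using op_norm_le_cmult[of m D "\<lambda>i j. A i j - B i j" "-1"] by simp

lemma op_norm_le_zero: "0 \<le> D \<Longrightarrow> op_norm_le m D (\<lambda>i j. 0)"
  by (simp add: op_norm_le_def mat_app_def)

lemma op_norm_leI_unit_ball:
  assumes "\<And>f. norm2 m f \<le> 1 \<Longrightarrow> norm2 m (mat_app m A f) \<le> D"
  shows "op_norm_le m D A"
  unfolding op_norm_le_def
proof
  fix f
  show "norm2 m (mat_app m A f) \<le> D * norm2 m f"
  proof (cases "norm2 m f = 0")
    case True
    hence "mat_app m A f = (\<lambda>_. 0)" by (auto simp: norm2_eq_0_iff mat_app_def)
    thus ?thesis using True by simp
  next
    case False
    define c where "c = complex_of_real (1 / norm2 m f)"
    have c: "cmod c = 1 / norm2 m f" by (simp add: c_def norm_divide)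
    have "norm2 m (mat_app m A (\<lambda>i. c * f i)) \<le> D"
      by (rule assms) (use False in \<open>simp add: norm2_cmult c\<close>)
    hence "norm2 m (mat_app m A f) / norm2 m f \<le> D" by (simp add: mat_app_cmult norm2_cmult c)
    thus ?thesis using False by (simp add: field_simps order_less_le)
  qed
qed

section \<open>Balancing contractions by signs\<close>

definition gram :: "nat \<Rightarrow> (nat \<Rightarrow> nat \<Rightarrow> complex) \<Rightarrow> (nat \<Rightarrow> complex) \<Rightarrow> nat \<Rightarrow> complex" where
  "gram m A f = mat_app m (adj A) (mat_app m A f)"

lemma adj_adj [simp]: "adj (adj A) = A"
  by (simp add: adj_def)

lemma cinner_gram_pow: "cinner m ((gram m A ^^ k) f) g = cinner m f ((gram m A ^^ k) g)"
proof (induction k arbitrary: f g)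
  case (Suc k)
  have "cinner m (gram m A f) g = cinner m f (gram m A g)" for f g
    using cinner_adj[of m "adj A"] by (simp add: gram_def cinner_adj)
  hence "cinner m ((gram m A ^^ Suc k) f) g = cinner m ((gram m A ^^ k) f) (gram m A g)" by simp
  also have "\<dots> = cinner m f ((gram m A ^^ k) (gram m A g))" by (rule Suc)
  finally show ?case by (simp add: funpow_swap1)
qed simp

text \<open>Since \<open>A\<^sup>* A\<close> is self-adjoint, each squaring of it only improves the bound, by the
  Cauchy-Schwarz inequality. This avoids the spectral theorem, at the cost of exponents that are
  powers of two.\<close>

lemma norm2_power_le_gram_pow:
  assumes "norm2 m f \<le> 1"
  shows "norm2 m (mat_app m A f) ^ (2 ^ Suc t) \<le> norm2 m ((gram m A ^^ (2 ^ t)) f)"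
proof (induction t)
  case 0
  have "(norm2 m (mat_app m A f))\<^sup>2 = cmod (cinner m f (gram m A f))"
    unfolding gram_def cinner_adj[symmetric] by (simp add: cinner_self norm_power)
  also have "\<dots> \<le> norm2 m f * norm2 m (gram m A f)" by (rule cinner_le)
  also have "\<dots> \<le> norm2 m (gram m A f)" using assms by (simp add: mult_left_le_one_le)
  finally show ?case by simp
next
  case (Suc t)
  let ?g = "(gram m A ^^ (2 ^ t)) f"
  have "norm2 m (mat_app m A f) ^ (2 ^ Suc (Suc t)) = (norm2 m (mat_app m A f) ^ (2 ^ Suc t))\<^sup>2"
    by (simp flip: power_mult add: mult.commute)
  also have "\<dots> \<le> (norm2 m ?g)\<^sup>2" using Suc by (intro power_mono) auto
  also have "\<dots> = cmod (cinner m ?g ?g)" by (simp add: cinner_self norm_power)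
  also have "cinner m ?g ?g = cinner m f ((gram m A ^^ (2 ^ t)) ?g)" by (rule cinner_gram_pow)
  also have "(gram m A ^^ (2 ^ t)) ?g = (gram m A ^^ (2 ^ Suc t)) f"
    by (simp add: mult_2 funpow_add)
  also have "cmod (cinner m f \<dots>) \<le> norm2 m f * norm2 m ((gram m A ^^ (2 ^ Suc t)) f)" by (rule cinner_le)
  also have "\<dots> \<le> norm2 m ((gram m A ^^ (2 ^ Suc t)) f)" using assms by (simp add: mult_left_le_one_le)
  finally show ?case .
qed

definition basis :: "nat \<Rightarrow> nat \<Rightarrow> complex" where
  "basis i = (\<lambda>j. if j = i then 1 else 0)"

lemma norm2_basis_le: "norm2 m (basis i) \<le> 1"
proof -
  have "(norm2 m (basis i))\<^sup>2 = (\<Sum>j<m. if j = i then 1 else 0)"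
    unfolding norm2_sq by (intro sum.cong) (auto simp: basis_def)
  also have "\<dots> \<le> 1" by simp
  finally show ?thesis by (simp add: power_le_one_iff abs_square_le_1)
qed

lemma gram_pow_basis:
  assumes "j < m"
  shows "(gram m A ^^ k) f j = (\<Sum>i<m. f i * (gram m A ^^ k) (basis i) j)"
  using assms
proof (induction k arbitrary: j)
  case 0
  have "(\<Sum>i<m. f i * basis i j) = (\<Sum>i<m. if i = j then f i else 0)"
    by (intro sum.cong) (auto simp: basis_def)
  thus ?case using 0 by simp
next
  case (Suc k)
  have "gram m A ((gram m A ^^ k) f) = gram m A (\<lambda>j. \<Sum>i<m. f i * (gram m A ^^ k) (basis i) j)"
    unfolding gram_def[of m A "(gram m A ^^ k) f"] gram_def[of m A "\<lambda>j. \<Sum>i<m. f i * (gram m A ^^ k) (basis i) j"]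
    by (rule arg_cong[OF mat_app_cong]) (rule Suc.IH)
  also have "\<dots> = (\<lambda>j. \<Sum>i<m. f i * gram m A ((gram m A ^^ k) (basis i)) j)"
    by (simp only: gram_def[of m A "\<lambda>j. \<Sum>i<m. f i * (gram m A ^^ k) (basis i) j"] mat_app_sum mat_app_cmult)
      (simp only: gram_def[of m A "(gram m A ^^ k) (basis _)"])
  finally show ?case by simp
qed

text \<open>The operator norm of a power is at most its Frobenius norm; the squared Frobenius norm is the
  trace moment to which the expansion into words applies.\<close>

lemma norm2_gram_pow_le:
  "(norm2 m ((gram m A ^^ k) f))\<^sup>2 \<le> (norm2 m f)\<^sup>2 * (\<Sum>i<m. (norm2 m ((gram m A ^^ k) (basis i)))\<^sup>2)"
proof -
  have "norm2 m ((gram m A ^^ k) f) = norm2 m (\<lambda>j. \<Sum>i<m. f i * (gram m A ^^ k) (basis i) j)"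
    by (intro norm2_cong gram_pow_basis)
  also have "\<dots> \<le> (\<Sum>i<m. norm2 m (\<lambda>j. f i * (gram m A ^^ k) (basis i) j))" by (rule norm2_sum)
  also have "\<dots> = (\<Sum>i<m. \<bar>cmod (f i)\<bar> * \<bar>norm2 m ((gram m A ^^ k) (basis i))\<bar>)" by (simp add: norm2_cmult)
  also have "\<dots> \<le> L2_set (\<lambda>i. cmod (f i)) {..<m} * L2_set (\<lambda>i. norm2 m ((gram m A ^^ k) (basis i))) {..<m}"
    by (rule L2_set_mult_ineq)
  finally have "(norm2 m ((gram m A ^^ k) f))\<^sup>2 \<le> (norm2 m f * L2_set (\<lambda>i. norm2 m ((gram m A ^^ k) (basis i))) {..<m})\<^sup>2"
    unfolding norm2_def[symmetric] by (intro power_mono) auto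
  thus ?thesis by (simp add: power_mult_distrib) (simp add: L2_set_def sum_nonneg)
qed

definition signed_sum :: "nat \<Rightarrow> (nat \<Rightarrow> nat \<Rightarrow> nat \<Rightarrow> complex) \<Rightarrow> (nat \<Rightarrow> real) \<Rightarrow> nat \<Rightarrow> nat \<Rightarrow> complex" where
  "signed_sum n B \<epsilon> = (\<lambda>i j. \<Sum>k<n. complex_of_real (\<epsilon> k) * B k i j)"

text \<open>These vectors appear when a product of factors that are alternately a signed sum and its adjoint
  is multiplied out; the first factor to act on \<open>e\<close> corresponds to the last letter of the word.\<close>

fun word_vec :: "nat \<Rightarrow> (nat \<Rightarrow> nat \<Rightarrow> nat \<Rightarrow> complex) \<Rightarrow> (nat \<Rightarrow> complex) \<Rightarrow> nat list \<Rightarrow> nat \<Rightarrow> complex" where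
  "word_vec m B e [] = e"
| "word_vec m B e (k # w) = mat_app m (if even (length w) then B k else adj (B k)) (word_vec m B e w)"

fun alternating :: "nat \<Rightarrow> (nat \<Rightarrow> nat \<Rightarrow> complex) \<Rightarrow> (nat \<Rightarrow> complex) \<Rightarrow> nat \<Rightarrow> nat \<Rightarrow> complex" where
  "alternating m X e 0 = e"
| "alternating m X e (Suc l) = mat_app m (if even l then X else adj X) (alternating m X e l)"

lemma alternating_even: "alternating m X e (2 * k) = (gram m X ^^ k) e"
  by (induction k) (auto simp: gram_def)

abbreviation words :: "nat \<Rightarrow> nat \<Rightarrow> nat list set" where
  "words n l \<equiv> {w. set w \<subseteq> {..<n} \<and> length w = l}"

lemma finite_words [simp]: "finite (words n l)"
  by (rule finite_lists_length_eq) simp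

lemma sum_words_Suc: "(\<Sum>w\<in>words n (Suc l). f w) = (\<Sum>k<n. \<Sum>w\<in>words n l. f (k # w))"
proof -
  have "(\<Sum>w\<in>words n (Suc l). f w) = (\<Sum>(w, k)\<in>words n l \<times> {..<n}. f (k # w))"
    unfolding lists_length_Suc_eq by (subst sum.reindex) (auto simp: inj_on_def intro!: sum.cong)
  also have "\<dots> = (\<Sum>w\<in>words n l. \<Sum>k<n. f (k # w))" by (simp add: sum.cartesian_product)
  finally show ?thesis by (simp add: sum.swap[of _ "{..<n}"])
qed

lemma alternating_expand:
  "alternating m (signed_sum n B \<epsilon>) e l i =
    (\<Sum>w\<in>words n l. complex_of_real (prod_list (map \<epsilon> w)) * word_vec m B e w i)"
proof (induction l arbitrary: i)
  case 0
  have "words n 0 = {[]}" by auto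
  thus ?case by simp
next
  case (Suc l)
  let ?B = "\<lambda>k. if even l then B k else adj (B k)"
  have "(if even l then signed_sum n B \<epsilon> else adj (signed_sum n B \<epsilon>)) = signed_sum n ?B \<epsilon>"
    by (auto simp: signed_sum_def adj_def fun_eq_iff)
  hence "alternating m (signed_sum n B \<epsilon>) e (Suc l) i
      = mat_app m (signed_sum n ?B \<epsilon>) (\<lambda>i. \<Sum>w\<in>words n l. complex_of_real (prod_list (map \<epsilon> w)) * word_vec m B e w i) i"
    using Suc by (simp only: alternating.simps) (simp add: mat_app_def)
  also have "\<dots> = (\<Sum>k<n. complex_of_real (\<epsilon> k) *
      (\<Sum>w\<in>words n l. complex_of_real (prod_list (map \<epsilon> w)) * mat_app m (?B k) (word_vec m B e w) i))"
    unfolding signed_sum_def by (simp only: mat_app_matrix_sum mat_app_matrix_cmult mat_app_sum mat_app_cmult)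
  also have "\<dots> = (\<Sum>w\<in>words n (Suc l). complex_of_real (prod_list (map \<epsilon> w)) * word_vec m B e w i)"
    unfolding sum_words_Suc sum_distrib_left
    by (intro sum.cong refl) auto
  finally show ?case .
qed

lemma sum_words_prod: "(\<Sum>w\<in>words n l. prod_list (map \<epsilon> w)) = (\<Sum>k<n. \<epsilon> k :: real) ^ l"
proof (induction l)
  case 0
  have "words n 0 = {[]}" by auto
  thus ?case by simp
next
  case (Suc l)
  thus ?case by (simp only: sum_words_Suc list.map prod_list.Cons sum_distrib_left[symmetric]
      sum_distrib_right[symmetric] power_Suc)
qed

lemma norm2_word_vec_le:
  assumes "norm2 m e \<le> 1" "\<And>k. k < n \<Longrightarrow> op_norm_le m 1 (B k)" "set w \<subseteq> {..<n}"
  shows "norm2 m (word_vec m B e w) \<le> 1"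
  using assms(3)
proof (induction w)
  case (Cons k w)
  have "op_norm_le m 1 (B k)" "op_norm_le m 1 (adj (B k))" using Cons.prems assms(2)[of k] op_norm_le_adj[of m 1 "B k"] by auto
  hence "norm2 m (word_vec m B e (k # w)) \<le> 1 * norm2 m (word_vec m B e w)"
    by (simp only: word_vec.simps split: if_split) (use op_norm_leD in blast)
  thus ?case using Cons by simp
qed (use assms in simp)

text \<open>The noncommutative sum is dominated by the scalar sum of the signs: after expansion into
  words, every vector has norm at most \<open>1\<close>, and the averages of the sign monomials that
  multiply the inner products are nonnegative.\<close>

lemma avg_norm2_alternating_le:
  assumes B: "\<And>k. k < n \<Longrightarrow> op_norm_le m 1 (B k)" and e: "norm2 m e \<le> 1"
  shows "avg n (\<lambda>\<epsilon>. (norm2 m (alternating m (signed_sum n B \<epsilon>) e l))\<^sup>2) \<le> avg n (\<lambda>\<epsilon>. (\<Sum>k<n. \<epsilon> k) ^ (2 * l))"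
proof -
  let ?v = "word_vec m B e" and ?W = "words n l"
  define x where "x \<epsilon> w = prod_list (map \<epsilon> w)" for \<epsilon> :: "nat \<Rightarrow> real" and w
  have expand: "(norm2 m (alternating m (signed_sum n B \<epsilon>) e l))\<^sup>2
      = (\<Sum>w\<in>?W. \<Sum>w'\<in>?W. Re (cinner m (?v w) (?v w')) * (x \<epsilon> w * x \<epsilon> w'))" for \<epsilon>
  proof -
    have "complex_of_real ((norm2 m (alternating m (signed_sum n B \<epsilon>) e l))\<^sup>2) =
        (\<Sum>i<m. (\<Sum>w\<in>?W. of_real (x \<epsilon> w) * ?v w i) * cnj (\<Sum>w'\<in>?W. of_real (x \<epsilon> w') * ?v w' i))"
      unfolding cinner_self[symmetric] cinner_def alternating_expand x_def ..
    also have "\<dots> = (\<Sum>i<m. \<Sum>w\<in>?W. \<Sum>w'\<in>?W. of_real (x \<epsilon> w * x \<epsilon> w') * (?v w i * cnj (?v w' i)))"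
      by (simp add: sum_product mult_ac)
    also have "\<dots> = (\<Sum>w\<in>?W. \<Sum>i<m. \<Sum>w'\<in>?W. of_real (x \<epsilon> w * x \<epsilon> w') * (?v w i * cnj (?v w' i)))"
      by (rule sum.swap)
    also have "\<dots> = (\<Sum>w\<in>?W. \<Sum>w'\<in>?W. \<Sum>i<m. of_real (x \<epsilon> w * x \<epsilon> w') * (?v w i * cnj (?v w' i)))"
      by (intro sum.cong refl sum.swap)
    also have "\<dots> = (\<Sum>w\<in>?W. \<Sum>w'\<in>?W. of_real (x \<epsilon> w * x \<epsilon> w') * cinner m (?v w) (?v w'))"
      by (simp add: cinner_def sum_distrib_left)
    finally have "Re (complex_of_real ((norm2 m (alternating m (signed_sum n B \<epsilon>) e l))\<^sup>2)) =
        Re (\<Sum>w\<in>?W. \<Sum>w'\<in>?W. of_real (x \<epsilon> w * x \<epsilon> w') * cinner m (?v w) (?v w'))" by simp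
    also have "\<dots> = (\<Sum>w\<in>?W. \<Sum>w'\<in>?W. Re (cinner m (?v w) (?v w')) * (x \<epsilon> w * x \<epsilon> w'))"
      unfolding Re_sum by (intro sum.cong refl) (simp only: scaleR_conv_of_real[symmetric] scaleR_complex.simps mult.commute)
    finally show ?thesis by (simp only: Re_complex_of_real)
  qed
  have pair: "avg n (\<lambda>\<epsilon>. x \<epsilon> w * x \<epsilon> w') \<ge> 0" if "w \<in> ?W" "w' \<in> ?W" for w w'
    using avg_word_nonneg[of "w @ w'" n] that by (simp add: x_def)
  have inner: "Re (cinner m (?v w) (?v w')) \<le> 1" if "w \<in> ?W" "w' \<in> ?W" for w w'
  proof -
    have "Re (cinner m (?v w) (?v w')) \<le> norm2 m (?v w) * norm2 m (?v w')"
      by (rule order_trans[OF complex_Re_le_cmod cinner_le])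
    also have "\<dots> \<le> 1 * 1" using that by (intro mult_mono norm2_word_vec_le[OF e B]) auto
    finally show ?thesis by simp
  qed
  have "avg n (\<lambda>\<epsilon>. (norm2 m (alternating m (signed_sum n B \<epsilon>) e l))\<^sup>2)
      = (\<Sum>w\<in>?W. \<Sum>w'\<in>?W. Re (cinner m (?v w) (?v w')) * avg n (\<lambda>\<epsilon>. x \<epsilon> w * x \<epsilon> w'))"
    by (simp only: expand avg_sum avg_cmult)
  also have "\<dots> \<le> (\<Sum>w\<in>?W. \<Sum>w'\<in>?W. 1 * avg n (\<lambda>\<epsilon>. x \<epsilon> w * x \<epsilon> w'))"
    by (intro sum_mono mult_right_mono inner pair)
  also have "\<dots> = avg n (\<lambda>\<epsilon>. \<Sum>w\<in>?W. \<Sum>w'\<in>?W. x \<epsilon> w * x \<epsilon> w')"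
    by (simp only: avg_sum mult_1)
  also have "\<dots> = avg n (\<lambda>\<epsilon>. (\<Sum>k<n. \<epsilon> k) ^ (2 * l))"
    by (simp only: sum_product[symmetric] x_def sum_words_prod mult_2 power_add)
  finally show ?thesis .
qed

text \<open>A trace of a power exceeds the norm of that power by a factor of at most \<open>m\<close>. For powers of order
  \<open>2 ^ t\<close>, with \<open>2 ^ t\<close> at least \<open>ln m\<close>, this factor is bounded by a constant after taking the root.\<close>

lemma exists_balanced_signing:
  assumes B: "\<And>k. k < n \<Longrightarrow> op_norm_le m 1 (B k)" and m: "real m \<le> exp (2 ^ t)"
  shows "\<exists>\<epsilon>\<in>signs n. op_norm_le m (5 * sqrt (2 ^ t * n)) (signed_sum n B \<epsilon>)"
proof -
  define Q :: nat where "Q = 2 ^ t"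
  have Q: "Q \<ge> 1" by (simp add: Q_def)
  define F where "F \<epsilon> = (\<Sum>i<m. (norm2 m ((gram m (signed_sum n B \<epsilon>) ^^ Q) (basis i)))\<^sup>2)" for \<epsilon>
  obtain \<epsilon> where \<epsilon>: "\<epsilon> \<in> signs n" "F \<epsilon> \<le> avg n F" using exists_le_avg by blast
  have "avg n F = (\<Sum>i<m. avg n (\<lambda>\<epsilon>. (norm2 m (alternating m (signed_sum n B \<epsilon>) (basis i) (2 * Q)))\<^sup>2))"
    by (simp add: F_def[abs_def] avg_sum alternating_even)
  also have "\<dots> \<le> (\<Sum>i<m. avg n (\<lambda>\<epsilon>. (\<Sum>k<n. \<epsilon> k) ^ (2 * (2 * Q))))"
    by (intro sum_mono avg_norm2_alternating_le B norm2_basis_le)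
  also have "\<dots> \<le> (\<Sum>i<m. (12 * real Q * real n) ^ (2 * Q))"
    using khintchine[of "2 * Q" n "\<lambda>_. 1"] Q by (intro sum_mono) simp
  also have "\<dots> = real m * (12 * real Q * real n) ^ (2 * Q)" by simp
  \<comment> \<open>The factor \<open>m\<close> is absorbed because \<open>(25 / 12)\<^sup>2\<close> exceeds \<open>exp 1\<close>.\<close>
  also have "\<dots> \<le> ((25 / 12)\<^sup>2) ^ Q * (12 * real Q * real n) ^ (2 * Q)"
  proof (intro mult_right_mono)
    have "exp (real Q) = exp 1 ^ Q" by (simp flip: exp_of_nat_mult)
    also have "\<dots> \<le> ((25 / 12)\<^sup>2) ^ Q"
      by (intro power_mono order_trans[OF exp_le]) (auto simp: power2_eq_square)
    finally show "real m \<le> ((25 / 12)\<^sup>2) ^ Q" using m by (simp add: Q_def)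
  qed auto
  also have "\<dots> = (25 * real Q * real n) ^ (2 * Q)"
  proof -
    have "25 / 12 * (12 * real Q * real n) = 25 * real Q * real n" by simp
    thus ?thesis by (simp only: power_mult power_mult_distrib[symmetric])
  qed
  finally have F: "F \<epsilon> \<le> (25 * real Q * real n) ^ (2 * Q)" using \<epsilon> by simp
  have "op_norm_le m (5 * sqrt (2 ^ t * n)) (signed_sum n B \<epsilon>)"
  proof (rule op_norm_leI_unit_ball)
    fix f assume f: "norm2 m f \<le> 1"
    let ?x = "norm2 m (mat_app m (signed_sum n B \<epsilon>) f)"
    have "(?x\<^sup>2) ^ (2 * Q) = (?x ^ (2 ^ Suc t))\<^sup>2"
      by (simp flip: power_mult add: Q_def mult_ac)
    also have "\<dots> \<le> (norm2 m ((gram m (signed_sum n B \<epsilon>) ^^ Q) f))\<^sup>2"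
      unfolding Q_def by (intro power_mono norm2_power_le_gram_pow f) simp
    also have "\<dots> \<le> (norm2 m f)\<^sup>2 * F \<epsilon>" unfolding F_def by (rule norm2_gram_pow_le)
    also have "\<dots> \<le> F \<epsilon>"
      using f by (intro mult_left_le_one_le) (auto simp: F_def sum_nonneg power_le_one)
    also note F
    finally have "?x\<^sup>2 \<le> 25 * real Q * real n"
      using Q by (subst (asm) power_mono_iff) auto
    hence "?x \<le> sqrt (25 * real Q * real n)" by (simp add: real_le_rsqrt)
    also have "\<dots> = 5 * sqrt (2 ^ t * n)" by (simp add: Q_def real_sqrt_mult)
    finally show "?x \<le> 5 * sqrt (2 ^ t * n)" .
  qed
  thus ?thesis using \<epsilon> by blast
qed

section \<open>Approximation by short averages\<close>

definition mean :: "('b \<Rightarrow> nat \<Rightarrow> nat \<Rightarrow> complex) \<Rightarrow> nat \<Rightarrow> (nat \<Rightarrow> 'b) \<Rightarrow> nat \<Rightarrow> nat \<Rightarrow> complex" where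
  "mean B N c = (\<lambda>i j. (\<Sum>l<N. B (c l) i j) / of_nat N)"

lemma sum_pairs: "(\<Sum>l<2 * n. f l) = (\<Sum>l<n. f (2 * l) + f (2 * l + 1))"
  for f :: "nat \<Rightarrow> 'a::comm_monoid_add"
  by (induction n) (auto simp: add.assoc)

text \<open>One of each of \<open>N\<close> pairs of contractions is selected. The average of the selected ones
  differs from that of all by \<open>1 / N\<close> times a signed sum of half differences, which are
  contractions as well, so a balanced choice of signs gives a good selection.\<close>

lemma exists_half:
  assumes c: "\<And>l. l < 2 * N \<Longrightarrow> c l \<in> S" and S: "\<And>b. b \<in> S \<Longrightarrow> op_norm_le m 1 (B b)"
    and m: "real m \<le> exp (2 ^ t)" and N: "N > 0"
  shows "\<exists>c'. (\<forall>l<N. c' l \<in> S) \<and>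
    op_norm_le m (5 * sqrt (2 ^ t / real N)) (\<lambda>i j. mean B N c' i j - mean B (2 * N) c i j)"
proof -
  define D where "D l = (\<lambda>i j. complex_of_real (1 / 2) * (B (c (2 * l)) i j - B (c (2 * l + 1)) i j))" for l
  have "op_norm_le m 1 (D l)" if "l < N" for l
  proof -
    have "op_norm_le m (cmod (complex_of_real (1 / 2)) * (1 + 1)) (D l)"
      unfolding D_def by (intro op_norm_le_cmult op_norm_le_diff S c) (use that in auto)
    thus ?thesis by simp
  qed
  then obtain \<epsilon> where \<epsilon>: "\<epsilon> \<in> signs N" "op_norm_le m (5 * sqrt (2 ^ t * real N)) (signed_sum N D \<epsilon>)"
    using exists_balanced_signing[of N m D t] m by auto
  define c' where "c' l = (if \<epsilon> l = 1 then c (2 * l) else c (2 * l + 1))" for l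
  have "(\<lambda>i j. mean B N c' i j - mean B (2 * N) c i j) = (\<lambda>i j. complex_of_real (1 / real N) * signed_sum N D \<epsilon> i j)"
  proof (intro ext)
    fix i j
    have "B (c' l) i j - (B (c (2 * l)) i j + B (c (2 * l + 1)) i j) / 2 = of_real (\<epsilon> l) * D l i j"
      if "l < N" for l
      using \<epsilon>(1) that unfolding mem_signs_iff c'_def D_def by (cases "\<epsilon> l = 1") (auto simp: field_simps)
    hence "(\<Sum>l<N. B (c' l) i j - (B (c (2 * l)) i j + B (c (2 * l + 1)) i j) / 2) = signed_sum N D \<epsilon> i j"
      unfolding signed_sum_def by (intro sum.cong) auto
    hence "(\<Sum>l<N. B (c' l) i j) - (\<Sum>l<2 * N. B (c l) i j) / 2 = signed_sum N D \<epsilon> i j"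
      unfolding sum_pairs by (simp add: sum_subtractf sum_divide_distrib)
    thus "mean B N c' i j - mean B (2 * N) c i j = complex_of_real (1 / real N) * signed_sum N D \<epsilon> i j"
      using N by (simp add: mean_def field_simps)
  qed
  moreover have "op_norm_le m (cmod (complex_of_real (1 / real N)) * (5 * sqrt (2 ^ t * real N)))
      (\<lambda>i j. complex_of_real (1 / real N) * signed_sum N D \<epsilon> i j)"
    by (intro op_norm_le_cmult \<epsilon>)
  moreover have "cmod (complex_of_real (1 / real N)) * (5 * sqrt (2 ^ t * real N)) = 5 * sqrt (2 ^ t / real N)"
    using N by (simp add: real_sqrt_mult real_sqrt_divide norm_divide field_simps)
  ultimately have "op_norm_le m (5 * sqrt (2 ^ t / real N)) (\<lambda>i j. mean B N c' i j - mean B (2 * N) c i j)"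
    by (simp only:)
  moreover have "\<forall>l<N. c' l \<in> S" using c by (auto simp: c'_def)
  ultimately show ?thesis by blast
qed

text \<open>The errors of successive halvings form a geometric series with ratio \<open>sqrt 2\<close>, so the last
  halving dominates.\<close>

lemma exists_short_mean:
  assumes c: "\<And>l. l < 2 ^ J \<Longrightarrow> c l \<in> S" and S: "\<And>b. b \<in> S \<Longrightarrow> op_norm_le m 1 (B b)"
    and m: "real m \<le> exp (2 ^ t)" and j: "j \<le> J"
  shows "\<exists>c'. (\<forall>l<2 ^ j. c' l \<in> S) \<and>
    op_norm_le m (20 * sqrt (2 ^ t / 2 ^ j)) (\<lambda>i k. mean B (2 ^ j) c' i k - mean B (2 ^ J) c i k)"
  using j
proof (induction rule: inc_induct)
  case base
  show ?case by (rule exI[of _ c]) (use c in \<open>auto intro!: op_norm_le_zero\<close>)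
next
  case (step j)
  obtain c1 where c1: "\<And>l. l < 2 ^ Suc j \<Longrightarrow> c1 l \<in> S"
    "op_norm_le m (20 * sqrt (2 ^ t / 2 ^ Suc j)) (\<lambda>i k. mean B (2 ^ Suc j) c1 i k - mean B (2 ^ J) c i k)"
    using step.IH by blast
  obtain c2 where c2: "\<And>l. l < 2 ^ j \<Longrightarrow> c2 l \<in> S"
    "op_norm_le m (5 * sqrt (2 ^ t / 2 ^ j)) (\<lambda>i k. mean B (2 ^ j) c2 i k - mean B (2 ^ Suc j) c1 i k)"
    using exists_half[where N = "2 ^ j" and c = c1 and S = S and B = B, OF _ S m] c1(1) by auto
  define r where "r = sqrt (2 ^ t / 2 ^ j)"
  have "5 * r + 20 * sqrt (2 ^ t / 2 ^ Suc j) \<le> 20 * r"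
  proof -
    have "sqrt (2 ^ t / 2 ^ Suc j) = r / sqrt 2"
      by (simp add: r_def real_sqrt_divide real_sqrt_mult)
    also have "\<dots> \<le> r / (4 / 3)"
      by (intro divide_left_mono real_le_rsqrt) (auto simp: r_def power2_eq_square)
    finally show ?thesis by (simp add: r_def)
  qed
  moreover have "op_norm_le m (5 * r + 20 * sqrt (2 ^ t / 2 ^ Suc j)) (\<lambda>i k. mean B (2 ^ j) c2 i k - mean B (2 ^ J) c i k)"
    using op_norm_le_triangle[OF c2(2) c1(2)] by (simp add: r_def)
  ultimately have "op_norm_le m (20 * r) (\<lambda>i k. mean B (2 ^ j) c2 i k - mean B (2 ^ J) c i k)"
    by (rule op_norm_le_mono[rotated])
  thus ?case using c2(1) by (auto simp: r_def)
qed

text \<open>This turns integer coefficients into a list of signed atoms, to which the halving procedure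
  applies; zero steps fill the list up to the length that is needed, a power of two.\<close>

lemma exists_unit_steps:
  fixes z :: "'k \<Rightarrow> int"
  assumes K: "finite K" "k0 \<in> K" and z: "(\<Sum>k\<in>K. \<bar>z k\<bar>) \<le> int N"
  shows "\<exists>c :: nat \<Rightarrow> 'k \<times> int. (\<forall>l<N. c l \<in> K \<times> {-1, 0, 1}) \<and>
    (\<forall>f :: 'k \<Rightarrow> complex. (\<Sum>l<N. of_int (snd (c l)) * f (fst (c l))) = (\<Sum>k\<in>K. of_int (z k) * f k))"
  using z
proof (induction N arbitrary: z)
  case 0
  hence "(\<Sum>k\<in>K. \<bar>z k\<bar>) = 0" by (intro antisym) (auto intro: sum_nonneg)
  hence "\<forall>k\<in>K. z k = 0" using K by (subst (asm) sum_nonneg_eq_0_iff) auto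
  thus ?case by simp
next
  case (Suc N)
  show ?case
  proof (cases "\<forall>k\<in>K. z k = 0")
    case True
    thus ?thesis by (intro exI[of _ "\<lambda>_. (k0, 0)"]) (use K in auto)
  next
    case False
    then obtain k where k: "k \<in> K" "z k \<noteq> 0" by blast
    define z' where "z' = z(k := z k - sgn (z k))"
    have split: "(\<Sum>k\<in>K. g k) = g k + (\<Sum>k\<in>K - {k}. g k)" for g :: "'k \<Rightarrow> 'c::comm_monoid_add"
      using K k by (intro sum.remove)
    have rest: "(\<Sum>i\<in>K - {k}. g i (z' i)) = (\<Sum>i\<in>K - {k}. g i (z i))" for g :: "'k \<Rightarrow> int \<Rightarrow> 'c::comm_monoid_add"
      by (intro sum.cong) (auto simp: z'_def)
    have "\<bar>z' k\<bar> = \<bar>z k\<bar> - 1" using k by (auto simp: z'_def sgn_if)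
    hence "(\<Sum>i\<in>K. \<bar>z' i\<bar>) = (\<Sum>i\<in>K. \<bar>z i\<bar>) - 1"
      unfolding split[of "\<lambda>i. \<bar>z' i\<bar>"] split[of "\<lambda>i. \<bar>z i\<bar>"] using rest[of "\<lambda>_ x. \<bar>x\<bar>"] by simp
    hence "(\<Sum>i\<in>K. \<bar>z' i\<bar>) \<le> int N" using Suc.prems by simp
    from Suc.IH[OF this] obtain c where c: "\<And>l. l < N \<Longrightarrow> c l \<in> K \<times> {-1, 0, 1}"
      "\<And>f :: 'k \<Rightarrow> complex. (\<Sum>l<N. of_int (snd (c l)) * f (fst (c l))) = (\<Sum>k\<in>K. of_int (z' k) * f k)"
      by blast
    define c' where "c' = c(N := (k, sgn (z k)))"
    have "(\<Sum>l<Suc N. of_int (snd (c' l)) * f (fst (c' l))) = (\<Sum>k\<in>K. of_int (z k) * f k)"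
      for f :: "'k \<Rightarrow> complex"
    proof -
      have "(\<Sum>l<N. of_int (snd (c' l)) * f (fst (c' l))) = (\<Sum>l<N. of_int (snd (c l)) * f (fst (c l)))"
        by (intro sum.cong) (auto simp: c'_def)
      hence "(\<Sum>l<Suc N. of_int (snd (c' l)) * f (fst (c' l))) = (\<Sum>k\<in>K. of_int (z' k) * f k) + of_int (sgn (z k)) * f k"
        by (simp add: c(2)) (simp add: c'_def)
      also have "\<dots> = (\<Sum>k\<in>K. of_int (z k) * f k)"
        unfolding split[of "\<lambda>i. of_int (z' i) * f i"] split[of "\<lambda>i. of_int (z i) * f i"]
        using rest[of "\<lambda>i x. of_int x * f i"] by (simp add: z'_def algebra_simps)
      finally show ?thesis .
    qed
    moreover have "\<forall>l<Suc N. c' l \<in> K \<times> {-1, 0, 1}"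
      using c(1) k by (auto simp: c'_def less_Suc_eq sgn_if)
    ultimately show ?thesis by blast
  qed
qed

definition combination :: "'k set \<Rightarrow> ('k \<Rightarrow> nat \<Rightarrow> nat \<Rightarrow> complex) \<Rightarrow> ('k \<Rightarrow> real) \<Rightarrow> nat \<Rightarrow> nat \<Rightarrow> complex" where
  "combination K B y = (\<lambda>i j. \<Sum>k\<in>K. complex_of_real (y k) * B k i j)"

definition grid_vec :: "'k set \<Rightarrow> real \<Rightarrow> ('k \<Rightarrow> real) \<Rightarrow> bool" where
  "grid_vec K h y \<longleftrightarrow> (\<forall>k\<in>K. \<exists>z::int. y k = of_int z * h)"

text \<open>A derandomised form of the empirical method: a combination with coefficients of \<open>l\<^sub>1\<close>-norm
  at most \<open>\<sigma>\<close> is \<open>\<sigma>\<close> times an average of \<open>2 ^ J\<close> signed contractions, to which repeated halving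
  applies.\<close>

lemma maurey:
  fixes K :: "'k set"
  assumes K: "finite K" "k0 \<in> K" and B: "\<And>k. k \<in> K \<Longrightarrow> op_norm_le m 1 (B k)"
    and m: "real m \<le> exp (2 ^ t)" and j: "j \<le> J" and \<sigma>: "\<sigma> > 0"
    and y: "grid_vec K (\<sigma> / 2 ^ J) y" "(\<Sum>k\<in>K. \<bar>y k\<bar>) \<le> \<sigma>"
  defines "A \<equiv> \<lambda>(k, s) i j. of_int s * B k i j"
  shows "\<exists>c. (\<forall>l<2 ^ j. c l \<in> K \<times> {-1, 0, 1}) \<and>
    op_norm_le m (20 * \<sigma> * sqrt (2 ^ t / 2 ^ j)) (\<lambda>i k. of_real \<sigma> * mean A (2 ^ j) c i k - combination K B y i k)"
proof -
  obtain z where z: "\<And>k. k \<in> K \<Longrightarrow> y k = of_int (z k) * (\<sigma> / 2 ^ J)"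
    using y(1) unfolding grid_vec_def by metis
  have "(\<Sum>k\<in>K. \<bar>y k\<bar>) = (\<Sum>k\<in>K. real_of_int \<bar>z k\<bar> * (\<sigma> / 2 ^ J))"
    using \<sigma> by (intro sum.cong) (simp_all add: z abs_mult)
  also have "\<dots> = real_of_int (\<Sum>k\<in>K. \<bar>z k\<bar>) * (\<sigma> / 2 ^ J)" by (simp only: of_int_sum sum_distrib_right)
  finally have "real_of_int (\<Sum>k\<in>K. \<bar>z k\<bar>) * (\<sigma> / 2 ^ J) \<le> \<sigma>" using y(2) by simp
  hence "real_of_int (\<Sum>k\<in>K. \<bar>z k\<bar>) \<le> real_of_int (2 ^ J)" using \<sigma> by (simp add: field_simps)
  hence "(\<Sum>k\<in>K. \<bar>z k\<bar>) \<le> int (2 ^ J)" by (simp only: of_int_le_iff) simp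
  from exists_unit_steps[OF K this] obtain c :: "nat \<Rightarrow> 'k \<times> int" where c: "\<And>l. l < 2 ^ J \<Longrightarrow> c l \<in> K \<times> {-1, 0, 1}"
    and cf: "\<And>f :: 'k \<Rightarrow> complex. (\<Sum>l<2 ^ J. of_int (snd (c l)) * f (fst (c l))) = (\<Sum>k\<in>K. of_int (z k) * f k)"
    by blast
  have A: "op_norm_le m 1 (A b)" if b: "b \<in> K \<times> {-1, 0, 1}" for b
  proof -
    obtain k s where ks: "b = (k, s)" "k \<in> K" "s \<in> {-1, 0, 1}" using b by auto
    have "op_norm_le m (cmod (of_int s) * 1) (\<lambda>i j. of_int s * B k i j)" by (intro op_norm_le_cmult B ks)
    moreover have "cmod (of_int s) * 1 \<le> 1" using ks(3) by auto
    ultimately show ?thesis unfolding A_def ks by (auto intro: op_norm_le_mono)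
  qed
  obtain c' where c': "\<forall>l<2 ^ j. c' l \<in> K \<times> {-1, 0, 1}"
    "op_norm_le m (20 * sqrt (2 ^ t / 2 ^ j)) (\<lambda>i k. mean A (2 ^ j) c' i k - mean A (2 ^ J) c i k)"
    using exists_short_mean[where c = c and S = "K \<times> {-1, 0, 1}" and B = A, OF c A m j] by blast
  have "of_real \<sigma> * mean A (2 ^ J) c i k = combination K B y i k" for i k
  proof -
    have "(\<Sum>l<2 ^ J. A (c l) i k) = (\<Sum>k'\<in>K. of_int (z k') * B k' i k)"
      using cf[of "\<lambda>k'. B k' i k"] by (simp add: A_def case_prod_beta)
    hence "of_real \<sigma> * mean A (2 ^ J) c i k = (of_real \<sigma> / 2 ^ J) * (\<Sum>k'\<in>K. of_int (z k') * B k' i k)"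
      by (simp add: mean_def)
    also have "\<dots> = combination K B y i k"
      unfolding combination_def sum_distrib_left by (intro sum.cong) (auto simp: z)
    finally show ?thesis .
  qed
  hence eq: "(\<lambda>i k. of_real \<sigma> * mean A (2 ^ j) c' i k - combination K B y i k) =
      (\<lambda>i k. of_real \<sigma> * (mean A (2 ^ j) c' i k - mean A (2 ^ J) c i k))"
    by (simp add: right_diff_distrib)
  have "op_norm_le m (cmod (of_real \<sigma>) * (20 * sqrt (2 ^ t / 2 ^ j)))
      (\<lambda>i k. of_real \<sigma> * mean A (2 ^ j) c' i k - combination K B y i k)"
    unfolding eq by (intro op_norm_le_cmult c')
  hence "op_norm_le m (20 * \<sigma> * sqrt (2 ^ t / 2 ^ j))
      (\<lambda>i k. of_real \<sigma> * mean A (2 ^ j) c' i k - combination K B y i k)"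
    using \<sigma> by (simp add: mult_ac)
  thus ?thesis using c'(1) by blast
qed

text \<open>The covering points are moved into the covered set \<open>F\<close> itself, at the cost of doubling the
  distance; this matters because only for points of \<open>F\<close> is the random quadratic form controlled.\<close>

lemma exists_net:
  fixes K :: "'k set"
  assumes K: "finite K" "k0 \<in> K" and B: "\<And>k. k \<in> K \<Longrightarrow> op_norm_le m 1 (B k)"
    and m: "real m \<le> exp (2 ^ t)" and j: "j \<le> J" and \<sigma>: "\<sigma> > 0"
    and F: "\<And>y. y \<in> F \<Longrightarrow> grid_vec K (\<sigma> / 2 ^ J) y \<and> (\<Sum>k\<in>K. \<bar>y k\<bar>) \<le> \<sigma>"
  shows "\<exists>\<pi>. (\<forall>y\<in>F. \<pi> y \<in> F \<and>
      op_norm_le m (40 * \<sigma> * sqrt (2 ^ t / 2 ^ j)) (\<lambda>i k. combination K B y i k - combination K B (\<pi> y) i k)) \<and>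
    card (\<pi> ` F) \<le> (3 * card K) ^ (2 ^ j)"
proof -
  define A where "A = (\<lambda>(k, s) i j. of_int s * B k i j :: complex)"
  let ?d = "20 * \<sigma> * sqrt (2 ^ t / 2 ^ j)"
  \<comment> \<open>The short averages are encoded by the finite set \<open>T\<close>, and \<open>key y\<close> is a code of an average near \<open>y\<close>.
    Two vectors with the same key are close to each other.\<close>
  define T where "T = PiE {..<2 ^ j :: nat} (\<lambda>_. K \<times> {-1, 0, 1 :: int})"
  have ex: "\<exists>c. c \<in> T \<and> op_norm_le m ?d (\<lambda>i k. of_real \<sigma> * mean A (2 ^ j) c i k - combination K B y i k)" if yF: "y \<in> F" for y
  proof -
    have "\<exists>c. (\<forall>l<2 ^ j. c l \<in> K \<times> {-1, 0, 1}) \<and>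
      op_norm_le m ?d (\<lambda>i k. of_real \<sigma> * mean A (2 ^ j) c i k - combination K B y i k)"
      unfolding A_def by (rule maurey[OF K B m j \<sigma>]) (use F[OF yF] in auto)
    then obtain c where c: "\<forall>l<2 ^ j. c l \<in> K \<times> {-1, 0, 1}"
      "op_norm_le m ?d (\<lambda>i k. of_real \<sigma> * mean A (2 ^ j) c i k - combination K B y i k)"
      by (elim exE conjE)
    have "mean A (2 ^ j) (restrict c {..<2 ^ j}) = mean A (2 ^ j) c"
      by (simp add: mean_def)
    thus ?thesis using c by (intro exI[of _ "restrict c {..<2 ^ j}"]) (auto simp: T_def)
  qed
  have "\<exists>key. \<forall>y\<in>F. key y \<in> T \<and>
      op_norm_le m ?d (\<lambda>i k. of_real \<sigma> * mean A (2 ^ j) (key y) i k - combination K B y i k)"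
    by (intro bchoice ballI ex)
  then obtain key where keys: "\<forall>y\<in>F. key y \<in> T \<and>
      op_norm_le m ?d (\<lambda>i k. of_real \<sigma> * mean A (2 ^ j) (key y) i k - combination K B y i k)"
    by (elim exE)
  note key = conjunct1[OF bspec[OF keys]] conjunct2[OF bspec[OF keys]]
  define \<pi> where "\<pi> y = inv_into F key (key y)" for y
  have \<pi>: "\<pi> y \<in> F" "key (\<pi> y) = key y" if "y \<in> F" for y
    using that by (auto simp: \<pi>_def inv_into_into f_inv_into_f)
  have "op_norm_le m (40 * \<sigma> * sqrt (2 ^ t / 2 ^ j)) (\<lambda>i k. combination K B y i k - combination K B (\<pi> y) i k)"
    if "y \<in> F" for y
    using op_norm_le_triangle[OF op_norm_le_diff_commute[OF key(2)[OF that]], of ?d "combination K B (\<pi> y)"]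
      key(2)[OF \<pi>(1)[OF that]] \<pi>(2)[OF that] by (simp add: mult.assoc)
  moreover have "card (\<pi> ` F) \<le> (3 * card K) ^ (2 ^ j)"
  proof -
    have fin: "finite T" using K by (auto simp: T_def intro!: finite_PiE)
    have "\<pi> ` F = inv_into F key ` (key ` F)" by (auto simp: \<pi>_def)
    hence "card (\<pi> ` F) \<le> card (key ` F)"
      using fin key(1) by (metis card_image_le finite_subset image_subsetI)
    also have "\<dots> \<le> card T" using fin key(1) by (intro card_mono) auto
    also have "\<dots> = (3 * card K) ^ (2 ^ j)"
    proof -
      have "card (K \<times> {-1, 0, 1 :: int}) = 3 * card K" by (simp add: card_cartesian_product)
      thus ?thesis unfolding T_def by (subst card_PiE) (simp_all del: power_mult_distrib)
    qed
    finally show ?thesis .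
  qed
  ultimately show ?thesis using \<pi>(1) by blast
qed

section \<open>Suprema of chaos processes\<close>

definition cvec :: "(nat \<Rightarrow> real) \<Rightarrow> nat \<Rightarrow> complex" where
  "cvec u = (\<lambda>j. complex_of_real (u j))"

definition frobenius_sq :: "nat \<Rightarrow> (nat \<Rightarrow> nat \<Rightarrow> complex) \<Rightarrow> real" where
  "frobenius_sq m A = (\<Sum>i<m. \<Sum>j<m. (cmod (A i j))\<^sup>2)"

lemma cvec_add: "cvec (\<lambda>j. u j + v j) = (\<lambda>j. cvec u j + cvec v j)"
  and cvec_diff: "cvec (\<lambda>j. u j - v j) = (\<lambda>j. cvec u j - cvec v j)"
  by (simp_all add: cvec_def)

lemma Re_cinner_sym: "Re (cinner m f g) = Re (cinner m g f)"
  by (simp add: cinner_def mult.commute)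

lemma Re_cinner_cvec: "Re (cinner m (cvec u) g) = (\<Sum>j<m. u j * Re (g j))"
  by (simp add: cinner_def cvec_def)

text \<open>The diagonal part of the quadratic form is constant, because signs square to \<open>1\<close>, and the rest
  has mean \<open>0\<close>.\<close>

lemma avg_norm2_sq: "avg m (\<lambda>\<epsilon>. (norm2 m (mat_app m A (cvec \<epsilon>)))\<^sup>2) = frobenius_sq m A"
proof -
  have "(cmod (\<Sum>j<m. A i j * of_real (\<epsilon> j)))\<^sup>2 = (\<Sum>j<m. \<Sum>k<m. Re (A i j * cnj (A i k)) * (\<epsilon> j * \<epsilon> k))"
    for i and \<epsilon> :: "nat \<Rightarrow> real"
  proof -
    have "complex_of_real ((cmod (\<Sum>j<m. A i j * of_real (\<epsilon> j)))\<^sup>2)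
        = (\<Sum>j<m. \<Sum>k<m. of_real (\<epsilon> j * \<epsilon> k) * (A i j * cnj (A i k)))"
      unfolding complex_norm_square cnj_sum sum_product by (intro sum.cong refl) simp
    hence "Re (complex_of_real ((cmod (\<Sum>j<m. A i j * of_real (\<epsilon> j)))\<^sup>2))
        = Re (\<Sum>j<m. \<Sum>k<m. of_real (\<epsilon> j * \<epsilon> k) * (A i j * cnj (A i k)))" by (rule arg_cong)
    also have "\<dots> = (\<Sum>j<m. \<Sum>k<m. Re (A i j * cnj (A i k)) * (\<epsilon> j * \<epsilon> k))"
      unfolding Re_sum by (intro sum.cong refl)
        (simp only: scaleR_conv_of_real[symmetric] scaleR_complex.simps mult.commute)
    finally show ?thesis by (simp only: Re_complex_of_real)
  qed
  hence "avg m (\<lambda>\<epsilon>. (norm2 m (mat_app m A (cvec \<epsilon>)))\<^sup>2)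
      = (\<Sum>i<m. \<Sum>j<m. \<Sum>k<m. Re (A i j * cnj (A i k)) * avg m (\<lambda>\<epsilon>. \<epsilon> j * \<epsilon> k))"
    by (simp only: norm2_sq mat_app_def cvec_def avg_sum avg_cmult)
  also have "\<dots> = (\<Sum>i<m. \<Sum>j<m. \<Sum>k<m. if j = k then Re (A i j * cnj (A i k)) else 0)"
    by (intro sum.cong refl) (simp add: avg_sign_mult)
  also have "\<dots> = frobenius_sq m A"
    unfolding frobenius_sq_def by (intro sum.cong refl) (simp add: cmod_power2, simp add: power2_eq_square)
  finally show ?thesis .
qed

text \<open>The coefficients of the Rademacher sum are those of the adjoint of \<open>\<Delta>\<close> applied to \<open>w\<close>,
  multiplied by \<open>u\<close>, which takes the values \<open>0\<close>, \<open>2\<close> and \<open>-2\<close> in the application.\<close>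

lemma khintchine_cinner:
  assumes \<Delta>: "op_norm_le m d \<Delta>" "0 \<le> d" and u: "\<And>j. j < m \<Longrightarrow> \<bar>u j\<bar> \<le> 2" and q: "q \<ge> 1"
    and w: "norm2 m w \<le> W"
  shows "avg m (\<lambda>\<eta>. (Re (cinner m (mat_app m \<Delta> (cvec (\<lambda>j. \<eta> j * u j))) w)) ^ (2 * q)) \<le> (24 * real q * (d * W)\<^sup>2) ^ q"
proof -
  define h where "h = mat_app m (adj \<Delta>) w"
  have "Re (cinner m (mat_app m \<Delta> (cvec (\<lambda>j. \<eta> j * u j))) w) = (\<Sum>j<m. (u j * Re (h j)) * \<eta> j)" for \<eta>
    unfolding cinner_adj Re_cinner_cvec h_def[symmetric] by (simp add: mult_ac)
  hence "avg m (\<lambda>\<eta>. (Re (cinner m (mat_app m \<Delta> (cvec (\<lambda>j. \<eta> j * u j))) w)) ^ (2 * q))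
      \<le> (6 * real q * (\<Sum>j<m. (u j * Re (h j))\<^sup>2)) ^ q"
    using khintchine[OF q, of m "\<lambda>j. u j * Re (h j)"] by simp
  also have "\<dots> \<le> (6 * real q * (4 * (d * W)\<^sup>2)) ^ q"
  proof (intro power_mono mult_left_mono)
    have "(\<Sum>j<m. (u j * Re (h j))\<^sup>2) \<le> (\<Sum>j<m. 4 * (cmod (h j))\<^sup>2)"
    proof (rule sum_mono)
      fix j assume "j \<in> {..<m}"
      hence "\<bar>u j * Re (h j)\<bar> \<le> 2 * cmod (h j)"
        unfolding abs_mult by (intro mult_mono u abs_Re_le_cmod) auto
      hence "\<bar>u j * Re (h j)\<bar>\<^sup>2 \<le> (2 * cmod (h j))\<^sup>2" by (intro power_mono) auto
      thus "(u j * Re (h j))\<^sup>2 \<le> 4 * (cmod (h j))\<^sup>2" by (simp add: power_mult_distrib)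
    qed
    also have "\<dots> = 4 * (norm2 m h)\<^sup>2" by (simp add: norm2_sq sum_distrib_left)
    also have "\<dots> \<le> 4 * (d * W)\<^sup>2"
    proof (intro mult_left_mono power_mono)
      have "norm2 m h \<le> d * norm2 m w" unfolding h_def by (intro op_norm_leD op_norm_le_adj \<Delta>)
      also have "\<dots> \<le> d * W" using w \<Delta>(2) by (rule mult_left_mono)
      finally show "norm2 m h \<le> d * W" .
    qed auto
    finally show "(\<Sum>j<m. (u j * Re (h j))\<^sup>2) \<le> 4 * (d * W)\<^sup>2" by simp
  qed (auto intro!: mult_nonneg_nonneg sum_nonneg)
  also have "6 * real q * (4 * (d * W)\<^sup>2) = 24 * real q * (d * W)\<^sup>2" by simp
  finally show ?thesis .
qed

text \<open>For independent sign vectors, \<open>\<epsilon> + \<epsilon>'\<close> and \<open>\<epsilon> - \<epsilon>'\<close> have disjoint supports, and given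
  the second one, the first one is twice a uniformly distributed sign vector on its support. This
  replaces a decoupling argument.\<close>

lemma avg_randomise:
  fixes g :: "(nat \<Rightarrow> real) \<Rightarrow> (nat \<Rightarrow> real) \<Rightarrow> real"
  assumes \<eta>: "\<eta> \<in> signs m"
  shows "avg m (\<lambda>\<epsilon>. avg m (\<lambda>\<epsilon>'. g (\<lambda>j. \<epsilon> j + \<epsilon>' j) (\<lambda>j. \<epsilon> j - \<epsilon>' j)))
    = avg m (\<lambda>\<epsilon>. avg m (\<lambda>\<epsilon>'. g (\<lambda>j. \<eta> j * (\<epsilon> j + \<epsilon>' j)) (\<lambda>j. \<epsilon> j - \<epsilon>' j)))"
proof -
  \<comment> \<open>Flipping both vectors by \<open>\<eta>\<close> where they agree is an involution; it multiplies the sum by \<open>\<eta>\<close>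
    and keeps the difference.\<close>
  define \<phi> :: "(nat \<Rightarrow> real) \<times> (nat \<Rightarrow> real) \<Rightarrow> (nat \<Rightarrow> real) \<times> (nat \<Rightarrow> real)" where
    "\<phi> = (\<lambda>(\<epsilon>, \<epsilon>'). (\<lambda>j. if \<epsilon> j = \<epsilon>' j then \<eta> j * \<epsilon> j else \<epsilon> j, \<lambda>j. if \<epsilon> j = \<epsilon>' j then \<eta> j * \<epsilon>' j else \<epsilon>' j))"
  have \<phi>: "\<phi> z \<in> signs m \<times> signs m" if z: "z \<in> signs m \<times> signs m" for z
  proof -
    obtain \<epsilon> \<epsilon>' where z': "z = (\<epsilon>, \<epsilon>')" "\<epsilon> \<in> signs m" "\<epsilon>' \<in> signs m" using z by auto
    have "\<eta> j * \<epsilon> j = 1 \<or> \<eta> j * \<epsilon> j = -1" "\<eta> j * \<epsilon>' j = 1 \<or> \<eta> j * \<epsilon>' j = -1" if "j < m" for j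
    proof -
      have "\<eta> j = 1 \<or> \<eta> j = -1" "\<epsilon> j = 1 \<or> \<epsilon> j = -1" "\<epsilon>' j = 1 \<or> \<epsilon>' j = -1"
        using \<eta> z' that by (simp_all add: mem_signs_iff)
      thus "\<eta> j * \<epsilon> j = 1 \<or> \<eta> j * \<epsilon> j = -1" "\<eta> j * \<epsilon>' j = 1 \<or> \<eta> j * \<epsilon>' j = -1" by auto
    qed
    thus ?thesis using z'(2,3) by (simp add: \<phi>_def mem_signs_iff z'(1))
  qed
  have \<eta>\<eta>: "\<eta> j * (\<eta> j * x) = x" if "j < m" for j x
    using \<eta> that by (auto simp: mem_signs_iff)
  have inv: "\<phi> (\<phi> z) = z" if z: "z \<in> signs m \<times> signs m" for z
  proof -
    obtain \<epsilon> \<epsilon>' where z': "z = (\<epsilon>, \<epsilon>')" "\<epsilon> \<in> signs m" "\<epsilon>' \<in> signs m" using z by auto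
    have "fst (\<phi> (\<phi> z)) j = \<epsilon> j \<and> snd (\<phi> (\<phi> z)) j = \<epsilon>' j" for j
      using z' \<eta>\<eta>[of j] by (cases "j < m") (auto simp: \<phi>_def mem_signs_iff)
    thus ?thesis unfolding z'(1) by (intro prod_eqI ext) auto
  qed
  have "(\<Sum>(\<epsilon>,\<epsilon>')\<in>signs m \<times> signs m. g (\<lambda>j. \<epsilon> j + \<epsilon>' j) (\<lambda>j. \<epsilon> j - \<epsilon>' j))
      = (\<Sum>(\<epsilon>,\<epsilon>')\<in>signs m \<times> signs m. g (\<lambda>j. \<eta> j * (\<epsilon> j + \<epsilon>' j)) (\<lambda>j. \<epsilon> j - \<epsilon>' j))"
  proof (rule sum.reindex_bij_witness[where i = \<phi> and j = \<phi>])
    fix z assume z: "z \<in> signs m \<times> signs m"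
    obtain \<epsilon> \<epsilon>' where z': "z = (\<epsilon>, \<epsilon>')" "\<epsilon> \<in> signs m" "\<epsilon>' \<in> signs m" using z by auto
    have "(if \<epsilon> j = \<epsilon>' j then \<eta> j * \<epsilon> j else \<epsilon> j) - (if \<epsilon> j = \<epsilon>' j then \<eta> j * \<epsilon>' j else \<epsilon>' j) = \<epsilon> j - \<epsilon>' j" for j
      by simp
    moreover have "\<eta> j * ((if \<epsilon> j = \<epsilon>' j then \<eta> j * \<epsilon> j else \<epsilon> j) + (if \<epsilon> j = \<epsilon>' j then \<eta> j * \<epsilon>' j else \<epsilon>' j))
        = \<epsilon> j + \<epsilon>' j" for j
    proof (cases "j < m")
      case True
      have "\<epsilon> j = 1 \<or> \<epsilon> j = -1" "\<epsilon>' j = 1 \<or> \<epsilon>' j = -1"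
        using z' True by (simp_all add: mem_signs_iff)
      hence "\<epsilon> j = \<epsilon>' j \<or> \<epsilon> j + \<epsilon>' j = 0" by auto
      thus ?thesis
      proof
        assume "\<epsilon> j = \<epsilon>' j"
        thus ?thesis using \<eta>\<eta>[OF True, of "\<epsilon>' j"] by (simp add: distrib_left)
      next
        assume "\<epsilon> j + \<epsilon>' j = 0"
        thus ?thesis by (cases "\<epsilon> j = \<epsilon>' j") auto
      qed
    next
      case False
      thus ?thesis using z' by (auto simp: mem_signs_iff)
    qed
    ultimately show "(case \<phi> z of (\<epsilon>, \<epsilon>') \<Rightarrow> g (\<lambda>j. \<eta> j * (\<epsilon> j + \<epsilon>' j)) (\<lambda>j. \<epsilon> j - \<epsilon>' j))
        = (case z of (\<epsilon>, \<epsilon>') \<Rightarrow> g (\<lambda>j. \<epsilon> j + \<epsilon>' j) (\<lambda>j. \<epsilon> j - \<epsilon>' j))"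
      by (simp add: z'(1) \<phi>_def)
  qed (use \<phi> inv in auto)
  thus ?thesis by (simp only: avg_avg_eq_sum)
qed

text \<open>Replacing \<open>\<epsilon>'\<close> by its negative exchanges the roles of the two vectors.\<close>

lemma avg_swap_sum_diff:
  fixes g :: "(nat \<Rightarrow> real) \<Rightarrow> (nat \<Rightarrow> real) \<Rightarrow> real"
  shows "avg m (\<lambda>\<epsilon>. avg m (\<lambda>\<epsilon>'. g (\<lambda>j. \<epsilon> j + \<epsilon>' j) (\<lambda>j. \<epsilon> j - \<epsilon>' j)))
    = avg m (\<lambda>\<epsilon>. avg m (\<lambda>\<epsilon>'. g (\<lambda>j. \<epsilon> j - \<epsilon>' j) (\<lambda>j. \<epsilon> j + \<epsilon>' j)))"
proof (rule avg_cong)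
  fix \<epsilon>
  have "(\<Sum>\<epsilon>'\<in>signs m. g (\<lambda>j. \<epsilon> j + \<epsilon>' j) (\<lambda>j. \<epsilon> j - \<epsilon>' j)) = (\<Sum>\<epsilon>'\<in>signs m. g (\<lambda>j. \<epsilon> j - \<epsilon>' j) (\<lambda>j. \<epsilon> j + \<epsilon>' j))"
    by (rule sum.reindex_bij_witness[where i = "\<lambda>\<epsilon>' j. - \<epsilon>' j" and j = "\<lambda>\<epsilon>' j. - \<epsilon>' j"])
      (auto simp: mem_signs_iff)
  thus "avg m (\<lambda>\<epsilon>'. g (\<lambda>j. \<epsilon> j + \<epsilon>' j) (\<lambda>j. \<epsilon> j - \<epsilon>' j)) = avg m (\<lambda>\<epsilon>'. g (\<lambda>j. \<epsilon> j - \<epsilon>' j) (\<lambda>j. \<epsilon> j + \<epsilon>' j))"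
    by (simp add: avg_def)
qed

lemma Max_power_le:
  fixes s :: "'k \<Rightarrow> real"
  assumes P: "finite P" "P \<noteq> {}" and b: "0 < b" "p \<le> 2 * q"
  shows "(MAX k\<in>P. \<bar>s k\<bar>) ^ p \<le> b ^ p + (\<Sum>k\<in>P. s k ^ (2 * q)) / b ^ (2 * q - p)"
proof -
  have "(MAX k\<in>P. \<bar>s k\<bar>) \<in> (\<lambda>k. \<bar>s k\<bar>) ` P" using P by (intro Max_in) auto
  then obtain k where k: "k \<in> P" "(MAX k\<in>P. \<bar>s k\<bar>) = \<bar>s k\<bar>" by auto
  have "\<bar>s k\<bar> ^ p \<le> b ^ p + \<bar>s k\<bar> ^ (2 * q) / b ^ (2 * q - p)"
    by (rule power_le_power_add_higher) (use b in auto)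
  also have "\<bar>s k\<bar> ^ (2 * q) = s k ^ (2 * q)" by (simp add: power_even_abs)
  also have "s k ^ (2 * q) \<le> (\<Sum>k\<in>P. s k ^ (2 * q))"
    using P k by (intro member_le_sum) auto
  finally show ?thesis using k b by (simp add: divide_right_mono)
qed

text \<open>One level of the chain. The union bound over \<open>P\<close> costs only a constant factor because it is
  done for the moment of order \<open>2 q\<close>, which is at least the logarithm of the number of elements.\<close>

lemma chain_level:
  fixes P :: "'k set" and \<Delta> Z :: "'k \<Rightarrow> nat \<Rightarrow> nat \<Rightarrow> complex"
  assumes P: "finite P" "P \<noteq> {}" "real (card P) \<le> exp (real (2 * q))"
    and d: "d > 0" "\<And>k. k \<in> P \<Longrightarrow> op_norm_le m d (\<Delta> k)"
    and q: "q \<ge> 1" "p \<le> 2 * q" and p: "p \<ge> 1" "even p"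
    and W: "\<And>\<epsilon> \<epsilon>'. \<epsilon> \<in> signs m \<Longrightarrow> \<epsilon>' \<in> signs m \<Longrightarrow> 0 < W \<epsilon> \<epsilon>'"
      "\<And>\<epsilon> \<epsilon>' k. \<epsilon> \<in> signs m \<Longrightarrow> \<epsilon>' \<in> signs m \<Longrightarrow> k \<in> P \<Longrightarrow> norm2 m (mat_app m (Z k) (cvec (\<lambda>j. \<epsilon> j - \<epsilon>' j))) \<le> W \<epsilon> \<epsilon>'"
  shows "avg m (\<lambda>\<epsilon>. avg m (\<lambda>\<epsilon>'. (MAX k\<in>P. \<bar>Re (cinner m (mat_app m (\<Delta> k) (cvec (\<lambda>j. \<epsilon> j + \<epsilon>' j)))
      (mat_app m (Z k) (cvec (\<lambda>j. \<epsilon> j - \<epsilon>' j))))\<bar>) ^ p))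
    \<le> (21 * sqrt (real (2 * q)) * d) ^ p * avg m (\<lambda>\<epsilon>. avg m (\<lambda>\<epsilon>'. W \<epsilon> \<epsilon>' ^ p))"
proof -
  define G where "G u v = (MAX k\<in>P. \<bar>Re (cinner m (mat_app m (\<Delta> k) (cvec u)) (mat_app m (Z k) (cvec v)))\<bar>) ^ p" for u v
  \<comment> \<open>The reference level is \<open>3\<close> times the bound for the moment norm of a single sum, and \<open>3 ^ (2 * q)\<close>
    beats the cardinality of \<open>P\<close>.\<close>
  define r where "r = 3 * sqrt (24 * real q) * d"
  have r: "r > 0" using d q by (simp add: r_def)
  have key: "avg m (\<lambda>\<eta>. G (\<lambda>j. \<eta> j * (\<epsilon> j + \<epsilon>' j)) (\<lambda>j. \<epsilon> j - \<epsilon>' j)) \<le> (2 * (r * W \<epsilon> \<epsilon>')) ^ p"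
    if \<epsilon>: "\<epsilon> \<in> signs m" "\<epsilon>' \<in> signs m" for \<epsilon> \<epsilon>'
  proof -
    define s where "s k \<eta> = Re (cinner m (mat_app m (\<Delta> k) (cvec (\<lambda>j. \<eta> j * (\<epsilon> j + \<epsilon>' j))))
      (mat_app m (Z k) (cvec (\<lambda>j. \<epsilon> j - \<epsilon>' j))))" for k \<eta>
    define b where "b = r * W \<epsilon> \<epsilon>'"
    have b: "b > 0" using r W(1)[OF \<epsilon>] by (simp add: b_def)
    have mom: "avg m (\<lambda>\<eta>. s k \<eta> ^ (2 * q)) \<le> (b / 3) ^ (2 * q)" if k: "k \<in> P" for k
    proof -
      have "avg m (\<lambda>\<eta>. s k \<eta> ^ (2 * q)) \<le> (24 * real q * (d * W \<epsilon> \<epsilon>')\<^sup>2) ^ q"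
        unfolding s_def
      proof (rule khintchine_cinner)
        show "\<bar>\<epsilon> j + \<epsilon>' j\<bar> \<le> 2" if "j < m" for j
        proof -
          have "\<epsilon> j = 1 \<or> \<epsilon> j = -1" "\<epsilon>' j = 1 \<or> \<epsilon>' j = -1" using \<epsilon> that by (auto simp: mem_signs_iff)
          thus ?thesis by auto
        qed
      qed (use d k q W(2)[OF \<epsilon> k] in auto)
      also have "24 * real q * (d * W \<epsilon> \<epsilon>')\<^sup>2 = (b / 3)\<^sup>2"
        using q by (simp add: b_def r_def power_mult_distrib)
      finally show ?thesis by (simp add: power_mult)
    qed
    have "avg m (\<lambda>\<eta>. G (\<lambda>j. \<eta> j * (\<epsilon> j + \<epsilon>' j)) (\<lambda>j. \<epsilon> j - \<epsilon>' j))
        \<le> avg m (\<lambda>\<eta>. b ^ p + 1 / b ^ (2 * q - p) * (\<Sum>k\<in>P. s k \<eta> ^ (2 * q)))"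
    proof (rule avg_mono)
      fix \<eta>
      show "G (\<lambda>j. \<eta> j * (\<epsilon> j + \<epsilon>' j)) (\<lambda>j. \<epsilon> j - \<epsilon>' j) \<le> b ^ p + 1 / b ^ (2 * q - p) * (\<Sum>k\<in>P. s k \<eta> ^ (2 * q))"
        using Max_power_le[OF P(1,2) b q(2), of "\<lambda>k. s k \<eta>"] by (simp add: G_def s_def)
    qed
    also have "\<dots> = b ^ p + 1 / b ^ (2 * q - p) * (\<Sum>k\<in>P. avg m (\<lambda>\<eta>. s k \<eta> ^ (2 * q)))"
      by (simp only: avg_add avg_const avg_cmult avg_sum)
    also have "\<dots> \<le> b ^ p + 1 / b ^ (2 * q - p) * (\<Sum>k\<in>P. (b / 3) ^ (2 * q))"
      using b by (intro add_left_mono mult_left_mono sum_mono mom) auto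
    also have "\<dots> = b ^ p + (real (card P) / 3 ^ (2 * q)) * (b ^ (2 * q) / b ^ (2 * q - p))"
      by (simp add: power_divide)
    also have "b ^ (2 * q) / b ^ (2 * q - p) = b ^ p"
    proof -
      have "b ^ (2 * q) = b ^ p * b ^ (2 * q - p)" using q by (simp flip: power_add)
      thus ?thesis using b by simp
    qed
    also have "real (card P) / 3 ^ (2 * q) \<le> 1"
    proof -
      have "exp (real (2 * q)) = exp 1 ^ (2 * q)" by (simp flip: exp_of_nat_mult)
      also have "\<dots> \<le> 3 ^ (2 * q)" by (intro power_mono exp_le) auto
      finally have "real (card P) \<le> 3 ^ (2 * q)" using P(3) by linarith
      thus ?thesis by (subst divide_le_eq_1_pos) auto
    qed
    also have "b ^ p + 1 * b ^ p \<le> (2 * b) ^ p"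
    proof -
      have "(2::real) ^ 1 \<le> 2 ^ p" using p by (intro power_increasing) auto
      hence "2 * b ^ p \<le> 2 ^ p * b ^ p" using b by (intro mult_right_mono) auto
      thus ?thesis by (simp add: power_mult_distrib)
    qed
    finally show ?thesis using b by (simp add: b_def)
  qed
  have "avg m (\<lambda>\<epsilon>. avg m (\<lambda>\<epsilon>'. G (\<lambda>j. \<epsilon> j + \<epsilon>' j) (\<lambda>j. \<epsilon> j - \<epsilon>' j)))
      = avg m (\<lambda>\<eta>. avg m (\<lambda>\<epsilon>. avg m (\<lambda>\<epsilon>'. G (\<lambda>j. \<epsilon> j + \<epsilon>' j) (\<lambda>j. \<epsilon> j - \<epsilon>' j))))"
    by simp
  also have "\<dots> = avg m (\<lambda>\<eta>. avg m (\<lambda>\<epsilon>. avg m (\<lambda>\<epsilon>'. G (\<lambda>j. \<eta> j * (\<epsilon> j + \<epsilon>' j)) (\<lambda>j. \<epsilon> j - \<epsilon>' j))))"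
    by (intro avg_cong avg_randomise)
  also have "\<dots> = avg m (\<lambda>\<epsilon>. avg m (\<lambda>\<eta>. avg m (\<lambda>\<epsilon>'. G (\<lambda>j. \<eta> j * (\<epsilon> j + \<epsilon>' j)) (\<lambda>j. \<epsilon> j - \<epsilon>' j))))"
    by (rule avg_swap)
  also have "\<dots> = avg m (\<lambda>\<epsilon>. avg m (\<lambda>\<epsilon>'. avg m (\<lambda>\<eta>. G (\<lambda>j. \<eta> j * (\<epsilon> j + \<epsilon>' j)) (\<lambda>j. \<epsilon> j - \<epsilon>' j))))"
    by (intro avg_cong avg_swap)
  also have "\<dots> \<le> avg m (\<lambda>\<epsilon>. avg m (\<lambda>\<epsilon>'. (2 * (r * W \<epsilon> \<epsilon>')) ^ p))"
    by (intro avg_mono key)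
  also have "\<dots> = (2 * r) ^ p * avg m (\<lambda>\<epsilon>. avg m (\<lambda>\<epsilon>'. W \<epsilon> \<epsilon>' ^ p))"
  proof -
    have "(2 * (r * W \<epsilon> \<epsilon>')) ^ p = (2 * r) ^ p * W \<epsilon> \<epsilon>' ^ p" for \<epsilon> \<epsilon>'
      by (simp add: power_mult_distrib)
    thus ?thesis by (simp only: avg_cmult)
  qed
  also have "\<dots> \<le> (21 * sqrt (real (2 * q)) * d) ^ p * avg m (\<lambda>\<epsilon>. avg m (\<lambda>\<epsilon>'. W \<epsilon> \<epsilon>' ^ p))"
  proof (intro mult_right_mono power_mono avg_nonneg)
    have "sqrt (24 * real q) = sqrt 12 * sqrt (real (2 * q))" by (simp flip: real_sqrt_mult)
    moreover have "sqrt 12 \<le> 7 / 2" by (rule real_le_lsqrt) (auto simp: power2_eq_square)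
    ultimately have "sqrt (24 * real q) \<le> 7 / 2 * sqrt (real (2 * q))"
      by (simp only:) (intro mult_right_mono, auto)
    thus "2 * r \<le> 21 * sqrt (real (2 * q)) * d"
      using d by (simp add: r_def)
  qed (use r p W in \<open>auto simp: zero_le_even_power less_imp_le\<close>)
  finally show ?thesis unfolding G_def .
qed


lemma norm2_sq_diff: "(norm2 m a)\<^sup>2 - (norm2 m b)\<^sup>2 = Re (cinner m (\<lambda>i. a i + b i) (\<lambda>i. a i - b i))"
proof -
  have "Re (cinner m a a) = (norm2 m a)\<^sup>2" "Re (cinner m b b) = (norm2 m b)\<^sup>2" by (simp_all add: cinner_self)
  moreover have "cinner m (\<lambda>i. a i + b i) (\<lambda>i. a i - b i) = cinner m a a - cinner m a b + cinner m b a - cinner m b b"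
    by (simp add: cinner_def algebra_simps sum.distrib sum_subtractf)
  ultimately show ?thesis using Re_cinner_sym[of m a b] by simp
qed

lemma Re_cinner_step:
  "Re (cinner m a' b') - Re (cinner m a b) = Re (cinner m (\<lambda>i. a' i - a i) b') + Re (cinner m a (\<lambda>i. b' i - b i))"
  by (simp add: cinner_def algebra_simps sum.distrib sum_subtractf)

definition chaos_sup :: "nat \<Rightarrow> ('x \<Rightarrow> nat \<Rightarrow> nat \<Rightarrow> complex) \<Rightarrow> 'x set \<Rightarrow> (nat \<Rightarrow> real) \<Rightarrow> real" where
  "chaos_sup m A F \<epsilon> = (MAX x\<in>F. \<bar>(norm2 m (mat_app m (A x) (cvec \<epsilon>)))\<^sup>2 - frobenius_sq m (A x)\<bar>)"

lemma le_chaos_sup: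
  "finite F \<Longrightarrow> x \<in> F \<Longrightarrow> \<bar>(norm2 m (mat_app m (A x) (cvec \<epsilon>)))\<^sup>2 - frobenius_sq m (A x)\<bar> \<le> chaos_sup m A F \<epsilon>"
  unfolding chaos_sup_def by (rule Max_ge) auto

lemma chaos_sup_nonneg: "finite F \<Longrightarrow> F \<noteq> {} \<Longrightarrow> 0 \<le> chaos_sup m A F \<epsilon>"
  using le_chaos_sup by (metis abs_ge_zero all_not_in_conv order_trans)

text \<open>By \<open>2 * t \<le> 1 + t\<^sup>2\<close> the bound for the norms is linear in the supremum, and so is the
  inequality for its moments below.\<close>

lemma norm2_le_chaos_sup:
  assumes "finite F" "x \<in> F" "frobenius_sq m (A x) \<le> 1"
  shows "norm2 m (mat_app m (A x) (cvec \<epsilon>)) \<le> 1 + chaos_sup m A F \<epsilon> / 2"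
proof -
  let ?t = "norm2 m (mat_app m (A x) (cvec \<epsilon>))"
  have "?t\<^sup>2 \<le> 1 + chaos_sup m A F \<epsilon>" using le_chaos_sup[OF assms(1,2), of m A \<epsilon>] assms(3) by linarith
  moreover have "2 * ?t \<le> 1 + ?t\<^sup>2" using zero_le_power2[of "?t - 1"] by (simp add: power2_eq_square algebra_simps)
  ultimately show ?thesis by linarith
qed


text \<open>Let \<open>a\<close> be the \<open>p\<close>-th moment norm of the supremum. It is at most \<open>42 * T * (2 + a)\<close>: the
  supremum itself reappears because it controls the norms of the vectors against which the increments
  of the chain are tested. For small \<open>T\<close> the term with \<open>a\<close> can be absorbed.\<close>

theorem chaos_sup_moment:
  fixes A :: "'x \<Rightarrow> nat \<Rightarrow> nat \<Rightarrow> complex" and \<pi> :: "nat \<Rightarrow> 'x \<Rightarrow> 'x"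
  assumes F: "finite F" "F \<noteq> {}" "\<And>x. x \<in> F \<Longrightarrow> frobenius_sq m (A x) \<le> 1"
    and \<pi>: "\<And>i x. i \<le> R \<Longrightarrow> x \<in> F \<Longrightarrow> \<pi> i x \<in> F" "\<And>x. x \<in> F \<Longrightarrow> \<pi> R x = x"
      "\<And>x i j. x \<in> F \<Longrightarrow> A (\<pi> 0 x) i j = 0" and R: "R \<ge> 1"
    and d: "\<And>i. i < R \<Longrightarrow> 0 < d i"
      "\<And>i x. i < R \<Longrightarrow> x \<in> F \<Longrightarrow> op_norm_le m (d i) (\<lambda>j k. A (\<pi> (Suc i) x) j k - A (\<pi> i x) j k)"
    and q: "\<And>i. i < R \<Longrightarrow> 1 \<le> q i" "\<And>i. i < R \<Longrightarrow> p \<le> 2 * q i"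
      "\<And>i. i < R \<Longrightarrow> real (card (\<pi> i ` F) * card (\<pi> (Suc i) ` F)) \<le> exp (real (2 * q i))"
    and p: "p \<ge> 1" "even p"
  defines "T \<equiv> \<Sum>i<R. sqrt (real (2 * q i)) * d i"
  assumes T: "84 * T \<le> 1"
  shows "avg m (\<lambda>\<epsilon>. chaos_sup m A F \<epsilon> ^ p) \<le> (168 * T) ^ p"
proof -
  define X where "X = chaos_sup m A F"
  have X0: "0 \<le> X \<epsilon>" for \<epsilon> unfolding X_def by (rule chaos_sup_nonneg[OF F(1,2)])
  define a where "a = root p (avg m (\<lambda>\<epsilon>. X \<epsilon> ^ p))"
  have mX0: "0 \<le> avg m (\<lambda>\<epsilon>. X \<epsilon> ^ p)" by (intro avg_nonneg) (simp add: X0)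
  have ap: "a ^ p = avg m (\<lambda>\<epsilon>. X \<epsilon> ^ p)" unfolding a_def using p mX0 by (intro real_root_pow_pos2) auto
  have a0: "0 \<le> a" unfolding a_def using mX0 by (rule real_root_ge_zero)
  have T0: "0 \<le> T" unfolding T_def by (intro sum_nonneg mult_nonneg_nonneg) (use d(1) in \<open>auto simp: less_imp_le\<close>)
  show ?thesis
  proof (cases "a = 0")
    case True
    hence "avg m (\<lambda>\<epsilon>. X \<epsilon> ^ p) = 0" using ap p by (simp add: zero_power)
    thus ?thesis using p by (simp add: X_def zero_le_even_power)
  next
    case False
    hence a: "a > 0" using a0 by simp
    \<comment> \<open>\<open>W\<close> dominates all the norms against which the increments are tested, and its moment norm is at
      most \<open>2 + a\<close>.\<close>
    define W where "W \<epsilon> \<epsilon>' = 2 + (X \<epsilon> / 2 + X \<epsilon>' / 2)" for \<epsilon> \<epsilon>'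
    have W0: "0 < W \<epsilon> \<epsilon>'" for \<epsilon> \<epsilon>' using X0[of \<epsilon>] X0[of \<epsilon>'] by (simp add: W_def)
    have W: "norm2 m (mat_app m (A x) (cvec (\<lambda>j. \<epsilon> j - \<epsilon>' j))) \<le> W \<epsilon> \<epsilon>'" if "x \<in> F" for x \<epsilon> \<epsilon>'
    proof -
      have "norm2 m (mat_app m (A x) (cvec (\<lambda>j. \<epsilon> j - \<epsilon>' j)))
          \<le> norm2 m (mat_app m (A x) (cvec \<epsilon>)) + norm2 m (mat_app m (A x) (cvec \<epsilon>'))"
        unfolding cvec_diff mat_app_diff by (rule norm2_triangle_diff)
      thus ?thesis
        using norm2_le_chaos_sup[where A = A and x = x and m = m, OF F(1) that F(3)[OF that], of \<epsilon>] norm2_le_chaos_sup[where A = A and x = x and m = m, OF F(1) that F(3)[OF that], of \<epsilon>']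
        by (simp add: W_def X_def)
    qed
    have momW: "avg m (\<lambda>\<epsilon>. avg m (\<lambda>\<epsilon>'. W \<epsilon> \<epsilon>' ^ p)) \<le> (2 + a) ^ p"
    proof -
      define Y :: "nat \<Rightarrow> (nat \<Rightarrow> real) \<times> (nat \<Rightarrow> real) \<Rightarrow> real" where
        "Y i z = (if i = 0 then 2 else if i = 1 then X (fst z) / 2 else X (snd z) / 2)" for i z
      define b where "b i = (if i = 0 then 2 else a / 2)" for i :: nat
      let ?S = "signs m \<times> signs m"
      have four: "(4::real) ^ m = 2 ^ m * 2 ^ m" by (simp flip: power_mult_distrib)
      have sX: "(\<Sum>\<epsilon>\<in>signs m. X \<epsilon> ^ p) = 2 ^ m * a ^ p" by (simp add: ap avg_def)
      have mom: "(\<Sum>z\<in>?S. Y i z ^ p) \<le> 4 ^ m * b i ^ p" if "i \<in> {0, 1, 2}" for i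
      proof -
        have "(\<Sum>z\<in>?S. (X (fst z) / 2) ^ p) = 4 ^ m * (a / 2) ^ p"
          by (simp add: sum.cartesian_product' power_divide sum_divide_distrib[symmetric] sum_distrib_left[symmetric] sX four)
        moreover have "(\<Sum>z\<in>?S. (X (snd z) / 2) ^ p) = 4 ^ m * (a / 2) ^ p"
          by (simp add: sum.cartesian_product' power_divide sum_divide_distrib[symmetric] sum_distrib_left[symmetric] sX four)
        moreover have "(\<Sum>z\<in>?S. 2 ^ p) = (4 ^ m * 2 ^ p :: real)" by (simp add: card_cartesian_product four)
        ultimately show ?thesis using that by (auto simp: Y_def b_def)
      qed
      have "(\<Sum>z\<in>?S. (\<Sum>i\<in>{0, 1, 2}. Y i z) ^ p) \<le> 4 ^ m * (\<Sum>i\<in>{0, 1, 2}. b i) ^ p"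
        by (rule minkowski_even[OF p(2) _ _ _ mom]) (auto simp: b_def a)
      moreover have "(\<Sum>i\<in>{0, 1, 2}. Y i z) = W (fst z) (snd z)" for z by (simp add: Y_def W_def)
      moreover have "(\<Sum>i\<in>{0, 1, 2}. b i) = 2 + a" by (simp add: b_def)
      ultimately have "(\<Sum>z\<in>?S. W (fst z) (snd z) ^ p) \<le> 4 ^ m * (2 + a) ^ p" by simp
      thus ?thesis unfolding avg_avg_eq_sum by (simp add: case_prod_beta field_simps)
    qed
    \<comment> \<open>A link of the chain at level \<open>i\<close> is a pair of successive points, and \<open>Y1\<close> and \<open>Y2\<close> are the
      maxima of the two halves of the increment of the bilinear form over all links.\<close>
    define P where "P i = (\<lambda>x. (\<pi> i x, \<pi> (Suc i) x)) ` F" for i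
    define D where "D k = (\<lambda>j l. A (snd k) j l - A (fst k) j l)" for k :: "'x \<times> 'x"
    define Y1 where "Y1 i u v = (MAX k\<in>P i. \<bar>Re (cinner m (mat_app m (D k) (cvec u)) (mat_app m (A (snd k)) (cvec v)))\<bar>)" for i u v
    define Y2 where "Y2 i u v = (MAX k\<in>P i. \<bar>Re (cinner m (mat_app m (D k) (cvec v)) (mat_app m (A (fst k)) (cvec u)))\<bar>)" for i u v
    have Pfin: "finite (P i)" "P i \<noteq> {}" for i using F by (auto simp: P_def)
    have PF: "fst k \<in> F" "snd k \<in> F" "op_norm_le m (d i) (D k)" if "k \<in> P i" "i < R" for i k
      using that \<pi>(1) d(2) by (auto simp: P_def D_def)
    have Pcard: "real (card (P i)) \<le> exp (real (2 * q i))" if "i < R" for i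
    proof -
      have "card (P i) \<le> card (\<pi> i ` F \<times> \<pi> (Suc i) ` F)"
        unfolding P_def using F(1) by (intro card_mono) auto
      hence "real (card (P i)) \<le> real (card (\<pi> i ` F) * card (\<pi> (Suc i) ` F))"
        by (simp only: card_cartesian_product of_nat_le_iff)
      thus ?thesis using q(3)[OF that] by linarith
    qed
    define b where "b i = 21 * sqrt (real (2 * q i)) * d i * (2 + a)" for i
    have b0: "0 < b i" if "i < R" for i using d(1)[OF that] q(1)[OF that] a by (simp add: b_def)
    have level: "(21 * sqrt (real (2 * q i)) * d i) ^ p * avg m (\<lambda>\<epsilon>. avg m (\<lambda>\<epsilon>'. W \<epsilon> \<epsilon>' ^ p)) \<le> b i ^ p"
      for i
    proof -
      have "b i ^ p = (21 * sqrt (real (2 * q i)) * d i) ^ p * (2 + a) ^ p"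
        by (simp add: b_def power_mult_distrib)
      thus ?thesis using p(2) momW by (simp add: mult_left_mono zero_le_even_power)
    qed
    have mom1: "avg m (\<lambda>\<epsilon>. avg m (\<lambda>\<epsilon>'. Y1 i (\<lambda>j. \<epsilon> j + \<epsilon>' j) (\<lambda>j. \<epsilon> j - \<epsilon>' j) ^ p)) \<le> b i ^ p" if i: "i < R" for i
      unfolding Y1_def
      by (rule order_trans[OF chain_level[OF Pfin Pcard[OF i] d(1)[OF i] PF(3)[OF _ i] q(1,2)[OF i] p W0 W[OF PF(2)[OF _ i]]] level])
    have mom2: "avg m (\<lambda>\<epsilon>. avg m (\<lambda>\<epsilon>'. Y2 i (\<lambda>j. \<epsilon> j + \<epsilon>' j) (\<lambda>j. \<epsilon> j - \<epsilon>' j) ^ p)) \<le> b i ^ p" if i: "i < R" for i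
      unfolding Y2_def avg_swap_sum_diff[where g = "\<lambda>u v. (MAX k\<in>P i. \<bar>Re (cinner m (mat_app m (D k) (cvec v)) (mat_app m (A (fst k)) (cvec u)))\<bar>) ^ p"]
      by (rule order_trans[OF chain_level[OF Pfin Pcard[OF i] d(1)[OF i] PF(3)[OF _ i] q(1,2)[OF i] p W0 W[OF PF(1)[OF _ i]]] level])
    define Z where "Z u v = (\<Sum>i<R. Y1 i u v + Y2 i u v)" for u v
    have momZ: "avg m (\<lambda>\<epsilon>. avg m (\<lambda>\<epsilon>'. Z (\<lambda>j. \<epsilon> j + \<epsilon>' j) (\<lambda>j. \<epsilon> j - \<epsilon>' j) ^ p)) \<le> (42 * T * (2 + a)) ^ p"
    proof -
      let ?S = "signs m \<times> signs m" and ?I = "{..<R} \<times> (UNIV :: bool set)"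
      define Y where "Y = (\<lambda>(i, c) (\<epsilon>, \<epsilon>'). (if c then Y1 else Y2) i (\<lambda>j. \<epsilon> j + \<epsilon>' j :: real) (\<lambda>j. \<epsilon> j - \<epsilon>' j))"
      have mom: "(\<Sum>z\<in>?S. Y k z ^ p) \<le> 4 ^ m * b (fst k) ^ p" if "k \<in> ?I" for k
      proof -
        have "(\<Sum>z\<in>?S. Y (i, c) z ^ p) \<le> 4 ^ m * b i ^ p" if "i < R" for i c
          using mom1[OF that] mom2[OF that] unfolding avg_avg_eq_sum
          by (cases c) (simp_all add: Y_def case_prod_beta field_simps)
        thus ?thesis using that by auto
      qed
      have "(\<Sum>z\<in>?S. (\<Sum>k\<in>?I. Y k z) ^ p) \<le> 4 ^ m * (\<Sum>k\<in>?I. b (fst k)) ^ p"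
        by (rule minkowski_even[OF p(2) _ _ _ mom]) (use b0 R in \<open>auto simp: lessThan_empty_iff\<close>)
      moreover have "(\<Sum>k\<in>?I. b (fst k)) = 42 * T * (2 + a)"
        by (simp add: sum.cartesian_product' UNIV_bool b_def T_def sum_distrib_left sum_distrib_right mult_ac)
      moreover have "(\<Sum>k\<in>?I. Y k z) = Z (\<lambda>j. fst z j + snd z j) (\<lambda>j. fst z j - snd z j)" for z
        by (simp add: sum.cartesian_product' UNIV_bool Y_def Z_def case_prod_beta add.commute)
      ultimately have "(\<Sum>z\<in>?S. Z (\<lambda>j. fst z j + snd z j) (\<lambda>j. fst z j - snd z j) ^ p) \<le> 4 ^ m * (42 * T * (2 + a)) ^ p"
        by simp
      thus ?thesis unfolding avg_avg_eq_sum by (simp add: case_prod_beta field_simps)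
    qed
    have tele: "\<bar>Re (cinner m (mat_app m (A x) (cvec u)) (mat_app m (A x) (cvec v)))\<bar> \<le> Z u v" if x: "x \<in> F" for x u v
    proof -
      define f where "f i = Re (cinner m (mat_app m (A (\<pi> i x)) (cvec u)) (mat_app m (A (\<pi> i x)) (cvec v)))" for i
      have "f 0 = 0" using \<pi>(3)[OF x] by (simp add: f_def cinner_def mat_app_def)
      hence "f R = (\<Sum>i<R. f (Suc i) - f i)" by (simp add: sum_lessThan_telescope)
      hence "\<bar>f R\<bar> \<le> (\<Sum>i<R. \<bar>f (Suc i) - f i\<bar>)" by (simp only: sum_abs)
      also have "\<dots> \<le> Z u v"
        unfolding Z_def
      proof (rule sum_mono)
        fix i assume "i \<in> {..<R}"
        define k where "k = (\<pi> i x, \<pi> (Suc i) x)"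
        have k: "k \<in> P i" using x by (auto simp: P_def k_def)
        have "f (Suc i) - f i = Re (cinner m (mat_app m (D k) (cvec u)) (mat_app m (A (snd k)) (cvec v)))
            + Re (cinner m (mat_app m (D k) (cvec v)) (mat_app m (A (fst k)) (cvec u)))"
          unfolding f_def Re_cinner_step D_def mat_app_matrix_diff k_def by (simp add: Re_cinner_sym)
        moreover have "\<bar>Re (cinner m (mat_app m (D k) (cvec u)) (mat_app m (A (snd k)) (cvec v)))\<bar> \<le> Y1 i u v"
          unfolding Y1_def using Pfin k by (intro Max_ge) auto
        moreover have "\<bar>Re (cinner m (mat_app m (D k) (cvec v)) (mat_app m (A (fst k)) (cvec u)))\<bar> \<le> Y2 i u v"
          unfolding Y2_def using Pfin k by (intro Max_ge) auto
        ultimately show "\<bar>f (Suc i) - f i\<bar> \<le> Y1 i u v + Y2 i u v" by linarith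
      qed
      finally show ?thesis using \<pi>(2)[OF x] by (simp add: f_def)
    qed
    have sym: "X \<epsilon> ^ p \<le> avg m (\<lambda>\<epsilon>'. Z (\<lambda>j. \<epsilon> j + \<epsilon>' j) (\<lambda>j. \<epsilon> j - \<epsilon>' j) ^ p)" for \<epsilon>
    proof -
      have "X \<epsilon> \<in> (\<lambda>x. \<bar>(norm2 m (mat_app m (A x) (cvec \<epsilon>)))\<^sup>2 - frobenius_sq m (A x)\<bar>) ` F"
        unfolding X_def chaos_sup_def using F by (intro Max_in) auto
      then obtain x where x: "x \<in> F" "X \<epsilon> = \<bar>(norm2 m (mat_app m (A x) (cvec \<epsilon>)))\<^sup>2 - frobenius_sq m (A x)\<bar>" by auto
      define D' where "D' \<epsilon>' = (norm2 m (mat_app m (A x) (cvec \<epsilon>)))\<^sup>2 - (norm2 m (mat_app m (A x) (cvec \<epsilon>')))\<^sup>2" for \<epsilon>'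
      have "(norm2 m (mat_app m (A x) (cvec \<epsilon>)))\<^sup>2 - frobenius_sq m (A x) = avg m D'"
        unfolding D'_def avg_diff avg_norm2_sq by simp
      hence "X \<epsilon> ^ p = avg m D' ^ p" using x p by (simp add: power_even_abs)
      also have "\<dots> \<le> avg m (\<lambda>\<epsilon>'. D' \<epsilon>' ^ p)" by (rule avg_power_le[OF p(2)])
      also have "\<dots> \<le> avg m (\<lambda>\<epsilon>'. Z (\<lambda>j. \<epsilon> j + \<epsilon>' j) (\<lambda>j. \<epsilon> j - \<epsilon>' j) ^ p)"
      proof (rule avg_mono)
        fix \<epsilon>'
        have "D' \<epsilon>' = Re (cinner m (mat_app m (A x) (cvec (\<lambda>j. \<epsilon> j + \<epsilon>' j))) (mat_app m (A x) (cvec (\<lambda>j. \<epsilon> j - \<epsilon>' j))))"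
          unfolding D'_def norm2_sq_diff cvec_diff cvec_add mat_app_diff mat_app_add ..
        hence "\<bar>D' \<epsilon>'\<bar> \<le> Z (\<lambda>j. \<epsilon> j + \<epsilon>' j) (\<lambda>j. \<epsilon> j - \<epsilon>' j)" using tele[OF x(1)] by simp
        hence "\<bar>D' \<epsilon>'\<bar> ^ p \<le> Z (\<lambda>j. \<epsilon> j + \<epsilon>' j) (\<lambda>j. \<epsilon> j - \<epsilon>' j) ^ p" by (intro power_mono) auto
        thus "D' \<epsilon>' ^ p \<le> Z (\<lambda>j. \<epsilon> j + \<epsilon>' j) (\<lambda>j. \<epsilon> j - \<epsilon>' j) ^ p" using p by (simp add: power_even_abs)
      qed
      finally show ?thesis .
    qed
    have "a ^ p \<le> (42 * T * (2 + a)) ^ p"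
      unfolding ap by (rule order_trans[OF avg_mono[OF sym] momZ])
    hence "a \<le> 42 * T * (2 + a)"
      using p a T0 by (subst (asm) power_mono_iff) auto
    also have "\<dots> = 84 * T + 42 * T * a" by (simp add: algebra_simps)
    also have "42 * T * a \<le> 1 / 2 * a" using T a by (intro mult_right_mono) auto
    finally have "a \<le> 168 * T" by simp
    hence "a ^ p \<le> (168 * T) ^ p" using a by (intro power_mono) auto
    thus ?thesis by (simp add: ap X_def)
  qed
qed

section \<open>Sparse combinations of orthogonal contractions\<close>

lemma exists_power_two_between:
  fixes x :: real
  assumes "x \<ge> 1 / 2"
  shows "\<exists>t::nat. x \<le> 2 ^ t \<and> 2 ^ t \<le> 2 * x"
proof -
  define t where "t = (LEAST t::nat. x \<le> 2 ^ t)"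
  obtain n where "x < 2 ^ n" using real_arch_pow[of 2 x] by auto
  hence "x \<le> 2 ^ n" by simp
  hence t: "x \<le> 2 ^ t" unfolding t_def by (rule LeastI)
  have "2 ^ t \<le> 2 * x"
  proof (cases t)
    case 0
    thus ?thesis using assms by simp
  next
    case (Suc u)
    hence "\<not> x \<le> 2 ^ u" unfolding t_def by (intro not_less_Least) auto
    thus ?thesis using Suc by simp
  qed
  thus ?thesis using t by blast
qed

lemma l1_le_sqrt_sparsity:
  fixes y :: "'k \<Rightarrow> real"
  assumes K: "finite K" and s: "card {k \<in> K. y k \<noteq> 0} \<le> s"
  shows "(\<Sum>k\<in>K. \<bar>y k\<bar>) \<le> sqrt (real s) * sqrt (\<Sum>k\<in>K. (y k)\<^sup>2)"
proof -
  define S where "S = {k \<in> K. y k \<noteq> 0}"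
  have "(\<Sum>k\<in>K. \<bar>y k\<bar>) = (\<Sum>k\<in>S. \<bar>y k\<bar> * \<bar>1\<bar>)"
    using K by (intro sum.mono_neutral_cong_right) (auto simp: S_def)
  also have "\<dots> \<le> L2_set y S * L2_set (\<lambda>_. 1) S" by (rule L2_set_mult_ineq)
  also have "\<dots> = sqrt (\<Sum>k\<in>S. (y k)\<^sup>2) * sqrt (real (card S))"
    by (simp add: L2_set_def)
  also have "\<dots> \<le> sqrt (\<Sum>k\<in>K. (y k)\<^sup>2) * sqrt (real s)"
    using K s by (intro mult_mono real_sqrt_le_mono sum_mono2) (auto simp: S_def sum_nonneg)
  finally show ?thesis by (simp add: mult.commute)
qed

lemma op_norm_le_combination:
  assumes "\<And>k. k \<in> K \<Longrightarrow> op_norm_le m 1 (B k)"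
  shows "op_norm_le m (\<Sum>k\<in>K. \<bar>y k\<bar>) (combination K B y)"
proof -
  have "op_norm_le m (cmod (complex_of_real (y k)) * 1) (\<lambda>i j. complex_of_real (y k) * B k i j)" if "k \<in> K" for k
    by (intro op_norm_le_cmult assms that)
  hence "op_norm_le m (\<Sum>k\<in>K. cmod (complex_of_real (y k)) * 1) (combination K B y)"
    unfolding combination_def by (rule op_norm_le_sum)
  thus ?thesis by simp
qed

lemma combination_diff:
  "combination K B (\<lambda>k. x k - y k) = (\<lambda>i j. combination K B x i j - combination K B y i j)"
  by (simp add: combination_def algebra_simps sum_subtractf)

definition sparse_grid :: "'k set \<Rightarrow> nat \<Rightarrow> real \<Rightarrow> ('k \<Rightarrow> real) set" where
  "sparse_grid K s h = {y. (\<forall>k. k \<notin> K \<longrightarrow> y k = 0) \<and> grid_vec K h y \<and>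
     card {k \<in> K. y k \<noteq> 0} \<le> s \<and> (\<Sum>k\<in>K. (y k)\<^sup>2) \<le> 1}"

text \<open>A sparse grid vector is determined by the list of at most \<open>s\<close> positions and grid values, padded
  by entries with value \<open>0\<close>.\<close>

lemma card_sparse_grid:
  fixes K :: "'k set"
  assumes K: "finite K" "k0 \<in> K" and h: "h > 0" "1 \<le> h * real N"
  shows "finite (sparse_grid K s h)" "card (sparse_grid K s h) \<le> (card K * (2 * N + 1)) ^ s"
proof -
  define T where "T = PiE {..<s} (\<lambda>_. K \<times> {- int N..int N})"
  define \<Phi> :: "(nat \<Rightarrow> 'k \<times> int) \<Rightarrow> 'k \<Rightarrow> real" where
    "\<Phi> f = (\<lambda>k. \<Sum>i<s. if fst (f i) = k then of_int (snd (f i)) * h else 0)" for f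
  have finT: "finite T" unfolding T_def using K by (intro finite_PiE) auto
  have sub: "sparse_grid K s h \<subseteq> \<Phi> ` T"
  proof
    fix y assume y: "y \<in> sparse_grid K s h"
    define S where "S = {k \<in> K. y k \<noteq> 0}"
    have S: "finite S" "card S \<le> s" "S \<subseteq> K" using K y by (auto simp: S_def sparse_grid_def)
    have "\<forall>k\<in>K. \<exists>z::int. y k = of_int z * h" using y by (simp add: sparse_grid_def grid_vec_def)
    from bchoice[OF this] obtain z :: "'k \<Rightarrow> int" where z: "\<And>k. k \<in> K \<Longrightarrow> y k = of_int (z k) * h" by auto
    have zN: "z k \<in> {- int N..int N}" if "k \<in> K" for k
    proof -
      have "(y k)\<^sup>2 \<le> (\<Sum>k\<in>K. (y k)\<^sup>2)" using K that by (intro member_le_sum) auto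
      hence "(y k)\<^sup>2 \<le> 1" using y by (simp add: sparse_grid_def)
      hence "\<bar>y k\<bar> \<le> h * real N" using h(2) abs_square_le_1[of "y k"] by linarith
      hence "\<bar>of_int (z k)\<bar> \<le> real N" using z[OF that] h(1) by (simp add: abs_mult)
      hence "\<bar>z k\<bar> \<le> int N" by linarith
      thus ?thesis by auto
    qed
    obtain e where e: "bij_betw e {0..<card S} S" using ex_bij_betw_nat_finite[OF S(1)] by blast
    have eK: "e i \<in> K" if "i < card S" for i using e that S(3) by (auto simp: bij_betw_def)
    define f where "f = restrict (\<lambda>i. if i < card S then (e i, z (e i)) else (k0, 0)) {..<s}"
    have "f \<in> T" using eK zN K by (auto simp: f_def T_def)
    moreover have "y = \<Phi> f"
    proof
      fix k
      have "\<Phi> f k = (\<Sum>i<s. if i < card S then (if e i = k then y (e i) else 0) else 0)"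
        unfolding \<Phi>_def by (intro sum.cong) (use eK z in \<open>auto simp: f_def\<close>)
      also have "\<dots> = (\<Sum>i\<in>{0..<card S}. if e i = k then y (e i) else 0)"
        using S(2) by (intro sum.mono_neutral_cong_right) auto
      also have "\<dots> = (\<Sum>l\<in>S. if l = k then y l else 0)"
        by (rule sum.reindex_bij_betw[OF e])
      also have "\<dots> = y k"
        using S y by (auto simp: S_def sparse_grid_def)
      finally show "y k = \<Phi> f k" by simp
    qed
    ultimately show "y \<in> \<Phi> ` T" by blast
  qed
  show "finite (sparse_grid K s h)" using sub finT by (rule finite_subset[OF _ finite_imageI])
  have "card (sparse_grid K s h) \<le> card (\<Phi> ` T)" using sub finT by (intro card_mono) auto
  also have "\<dots> \<le> card T" using finT by (rule card_image_le)
  also have "card T = (card K * (2 * N + 1)) ^ s"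
  proof -
    have "card {- int N..int N} = 2 * N + 1" unfolding card_atLeastAtMost_int by linarith
    hence "card (K \<times> {- int N..int N}) = card K * (2 * N + 1)" by (simp only: card_cartesian_product)
    thus ?thesis unfolding T_def by (subst card_PiE) (simp_all del: power_mult_distrib)
  qed
  finally show "card (sparse_grid K s h) \<le> (card K * (2 * N + 1)) ^ s" .
qed

text \<open>Rounding towards \<open>0\<close> increases neither the support nor the norm.\<close>

lemma exists_grid_rounding:
  fixes y :: "'k \<Rightarrow> real"
  assumes K: "finite K" and h: "h > 0"
    and y: "card {k \<in> K. y k \<noteq> 0} \<le> s" "(\<Sum>k\<in>K. (y k)\<^sup>2) \<le> 1"
  shows "\<exists>x\<in>sparse_grid K s h. \<forall>k\<in>K. \<bar>x k\<bar> \<le> \<bar>y k\<bar> \<and> \<bar>y k - x k\<bar> \<le> h \<and> (y k = 0 \<longrightarrow> x k = 0)"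
proof -
  define x where "x k = (if k \<in> K then sgn (y k) * of_int \<lfloor>\<bar>y k\<bar> / h\<rfloor> * h else 0)" for k
  have fl: "of_int \<lfloor>\<bar>y k\<bar> / h\<rfloor> * h \<le> \<bar>y k\<bar>" "\<bar>y k\<bar> - of_int \<lfloor>\<bar>y k\<bar> / h\<rfloor> * h \<le> h"
    "0 \<le> of_int \<lfloor>\<bar>y k\<bar> / h\<rfloor> * h" for k
  proof -
    show "of_int \<lfloor>\<bar>y k\<bar> / h\<rfloor> * h \<le> \<bar>y k\<bar>"
      using pos_le_divide_eq[OF h, of "of_int \<lfloor>\<bar>y k\<bar> / h\<rfloor>" "\<bar>y k\<bar>"] by simp
    have *: "\<bar>y k\<bar> / h \<le> of_int \<lfloor>\<bar>y k\<bar> / h\<rfloor> + 1"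
      "(0::real) \<le> of_int \<lfloor>\<bar>y k\<bar> / h\<rfloor>"
      using h by (linarith, simp)
    from * show "\<bar>y k\<bar> - of_int \<lfloor>\<bar>y k\<bar> / h\<rfloor> * h \<le> h"
      "0 \<le> of_int \<lfloor>\<bar>y k\<bar> / h\<rfloor> * h"
      using h by (simp_all add: field_simps)
  qed
  have x: "\<bar>x k\<bar> \<le> \<bar>y k\<bar> \<and> \<bar>y k - x k\<bar> \<le> h \<and> (y k = 0 \<longrightarrow> x k = 0)" if "k \<in> K" for k
    using fl[of k] that unfolding x_def by (cases "y k" "0::real" rule: linorder_cases) auto
  have "x \<in> sparse_grid K s h"
  proof -
    have "grid_vec K h x"
      unfolding grid_vec_def
    proof
      fix k assume "k \<in> K"
      hence "x k = of_int 0 * h \<or> x k = of_int \<lfloor>\<bar>y k\<bar> / h\<rfloor> * h \<or> x k = of_int (- \<lfloor>\<bar>y k\<bar> / h\<rfloor>) * h"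
        unfolding x_def by (cases "y k" "0::real" rule: linorder_cases) auto
      thus "\<exists>z::int. x k = of_int z * h" by blast
    qed
    moreover have "card {k \<in> K. x k \<noteq> 0} \<le> s"
      by (rule order_trans[OF card_mono y(1)]) (use K x in auto)
    moreover have "(\<Sum>k\<in>K. (x k)\<^sup>2) \<le> (\<Sum>k\<in>K. (y k)\<^sup>2)"
      by (intro sum_mono) (use x in \<open>auto simp: abs_le_square_iff[symmetric]\<close>)
    ultimately show ?thesis using y(2) by (auto simp: sparse_grid_def x_def)
  qed
  thus ?thesis using x by blast
qed

lemma norm2_cvec_sign: "\<epsilon> \<in> signs m \<Longrightarrow> norm2 m (cvec \<epsilon>) = sqrt (real m)"
proof -
  assume \<epsilon>: "\<epsilon> \<in> signs m"
  have "(norm2 m (cvec \<epsilon>))\<^sup>2 = (\<Sum>i<m. 1)"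
    unfolding norm2_sq by (intro sum.cong) (use \<epsilon> in \<open>auto simp: cvec_def mem_signs_iff power2_eq_1_iff\<close>)
  thus ?thesis by (simp add: real_sqrt_unique)
qed

lemma discretisation_error:
  fixes y x :: "'k \<Rightarrow> real"
  assumes K: "finite K" and B: "\<And>k. k \<in> K \<Longrightarrow> op_norm_le m 1 (B k)" and m: "m > 0" and \<epsilon>: "\<epsilon> \<in> signs m"
    and s: "s \<ge> 1" and y: "card {k \<in> K. y k \<noteq> 0} \<le> s" "(\<Sum>k\<in>K. (y k)\<^sup>2) \<le> 1"
    and x: "\<And>k. k \<in> K \<Longrightarrow> \<bar>x k\<bar> \<le> \<bar>y k\<bar> \<and> \<bar>y k - x k\<bar> \<le> h \<and> (y k = 0 \<longrightarrow> x k = 0)" and h: "h > 0"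
  shows "\<bar>((norm2 m (mat_app m (combination K B y) (cvec \<epsilon>)))\<^sup>2 / m - (\<Sum>k\<in>K. (y k)\<^sup>2))
      - ((norm2 m (mat_app m (combination K B x) (cvec \<epsilon>)))\<^sup>2 / m - (\<Sum>k\<in>K. (x k)\<^sup>2))\<bar> \<le> 4 * real s * sqrt (real s) * h"
proof -
  define N where "N v = norm2 m (mat_app m (combination K B v) (cvec \<epsilon>)) / sqrt m" for v
  have N: "N v \<le> (\<Sum>k\<in>K. \<bar>v k\<bar>)" for v
  proof -
    have "norm2 m (mat_app m (combination K B v) (cvec \<epsilon>)) \<le> (\<Sum>k\<in>K. \<bar>v k\<bar>) * sqrt m"
      using op_norm_leD[OF op_norm_le_combination[where B = B and K = K and m = m and y = v, OF B], of "cvec \<epsilon>"]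
      by (simp add: norm2_cvec_sign[OF \<epsilon>])
    thus ?thesis using m by (simp add: N_def field_simps)
  qed
  have N0: "0 \<le> N v" for v by (simp add: N_def)
  have y1: "(\<Sum>k\<in>K. \<bar>y k\<bar>) \<le> sqrt s"
  proof -
    have "(\<Sum>k\<in>K. \<bar>y k\<bar>) \<le> sqrt s * sqrt (\<Sum>k\<in>K. (y k)\<^sup>2)" by (rule l1_le_sqrt_sparsity[OF K y(1)])
    also have "\<dots> \<le> sqrt s * 1" using y(2) by (intro mult_left_mono) auto
    finally show ?thesis by simp
  qed
  have x1: "(\<Sum>k\<in>K. \<bar>x k\<bar>) \<le> sqrt s"
    using x by (intro order_trans[OF sum_mono y1]) blast
  have d1: "(\<Sum>k\<in>K. \<bar>y k - x k\<bar>) \<le> s * h"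
  proof -
    have "(\<Sum>k\<in>K. \<bar>y k - x k\<bar>) = (\<Sum>k\<in>{k \<in> K. y k \<noteq> 0}. \<bar>y k - x k\<bar>)"
      using K x by (intro sum.mono_neutral_right) auto
    also have "\<dots> \<le> (\<Sum>k\<in>{k \<in> K. y k \<noteq> 0}. h)" using x by (intro sum_mono) auto
    also have "\<dots> = real (card {k \<in> K. y k \<noteq> 0}) * h" by simp
    also have "\<dots> \<le> s * h" using y(1) h by (intro mult_right_mono) auto
    finally show ?thesis .
  qed
  have "\<bar>N y - N x\<bar> \<le> N (\<lambda>k. y k - x k)"
  proof -
    let ?a = "mat_app m (combination K B y) (cvec \<epsilon>)" and ?b = "mat_app m (combination K B x) (cvec \<epsilon>)"
    have "norm2 m ?a \<le> norm2 m (\<lambda>i. ?a i - ?b i) + norm2 m ?b" "norm2 m ?b \<le> norm2 m (\<lambda>i. ?b i - ?a i) + norm2 m ?a"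
      using norm2_triangle[of m "\<lambda>i. ?a i - ?b i" ?b] norm2_triangle[of m "\<lambda>i. ?b i - ?a i" ?a] by simp_all
    hence "\<bar>norm2 m ?a - norm2 m ?b\<bar> \<le> norm2 m (\<lambda>i. ?a i - ?b i)"
      using norm2_diff_commute[of m ?a ?b] by linarith
    hence "\<bar>norm2 m ?a - norm2 m ?b\<bar> / sqrt m \<le> norm2 m (\<lambda>i. ?a i - ?b i) / sqrt m"
      by (intro divide_right_mono) auto
    thus ?thesis
      unfolding N_def combination_diff mat_app_matrix_diff diff_divide_distrib[symmetric] by (simp add: abs_divide)
  qed
  also have "\<dots> \<le> s * h" by (rule order_trans[OF N d1])
  finally have NN: "\<bar>N y - N x\<bar> \<le> s * h" .
  have "\<bar>(N y)\<^sup>2 - (N x)\<^sup>2\<bar> = \<bar>N y - N x\<bar> * (N y + N x)"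
  proof -
    have "(N y)\<^sup>2 - (N x)\<^sup>2 = (N y - N x) * (N y + N x)" by (simp add: power2_eq_square algebra_simps)
    thus ?thesis using N0[of x] N0[of y] by (simp add: abs_mult)
  qed
  also have "\<dots> \<le> (s * h) * (sqrt s + sqrt s)"
    using N0[of x] N0[of y] N[of x] N[of y] x1 y1 h by (intro mult_mono NN) auto
  finally have quad: "\<bar>(N y)\<^sup>2 - (N x)\<^sup>2\<bar> \<le> 2 * s * sqrt s * h" by (simp add: mult_ac)
  have "\<bar>(\<Sum>k\<in>K. (y k)\<^sup>2) - (\<Sum>k\<in>K. (x k)\<^sup>2)\<bar> \<le> (\<Sum>k\<in>K. \<bar>(y k)\<^sup>2 - (x k)\<^sup>2\<bar>)"
    by (simp add: sum_subtractf[symmetric])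
  also have "\<dots> \<le> (\<Sum>k\<in>K. h * (2 * \<bar>y k\<bar>))"
  proof (rule sum_mono)
    fix k assume k: "k \<in> K"
    have "\<bar>(y k)\<^sup>2 - (x k)\<^sup>2\<bar> = \<bar>y k - x k\<bar> * \<bar>y k + x k\<bar>"
      by (simp add: power2_eq_square abs_mult[symmetric] algebra_simps)
    also have "\<dots> \<le> h * (2 * \<bar>y k\<bar>)" using x[OF k] h by (intro mult_mono) auto
    finally show "\<bar>(y k)\<^sup>2 - (x k)\<^sup>2\<bar> \<le> h * (2 * \<bar>y k\<bar>)" .
  qed
  also have "\<dots> = 2 * h * (\<Sum>k\<in>K. \<bar>y k\<bar>)" by (simp add: sum_distrib_left mult_ac)
  also have "\<dots> \<le> 2 * h * sqrt s" using y1 h by (intro mult_left_mono) auto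
  also have "\<dots> \<le> 2 * s * sqrt s * h"
  proof -
    have "1 * (2 * h * sqrt s) \<le> s * (2 * h * sqrt s)" using s h by (intro mult_right_mono) auto
    thus ?thesis by (simp add: mult_ac)
  qed
  finally have sq: "\<bar>(\<Sum>k\<in>K. (y k)\<^sup>2) - (\<Sum>k\<in>K. (x k)\<^sup>2)\<bar> \<le> 2 * s * sqrt s * h" .
  have "(N v)\<^sup>2 = (norm2 m (mat_app m (combination K B v) (cvec \<epsilon>)))\<^sup>2 / m" for v
    by (simp add: N_def power_divide)
  thus ?thesis using quad sq by (simp add: abs_le_iff)
qed

lemma frobenius_sq_cmult: "frobenius_sq m (\<lambda>i j. c * A i j) = (cmod c)\<^sup>2 * frobenius_sq m A"
  by (simp add: frobenius_sq_def norm_mult power_mult_distrib sum_distrib_left)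

lemma sum_inverse_sqrt_power_two: "(\<Sum>i<n. 1 / sqrt (2 ^ i)) \<le> 4"
proof -
  have "(\<Sum>i<n. 1 / sqrt (2 ^ i)) \<le> (\<Sum>i<n. (3 / 4) ^ i)"
  proof (rule sum_mono)
    fix i :: nat
    have "(4 / 3 :: real) ^ i \<le> sqrt 2 ^ i"
      by (intro power_mono real_le_rsqrt) (auto simp: power2_eq_square)
    hence "1 / sqrt 2 ^ i \<le> 1 / (4 / 3 :: real) ^ i" by (intro divide_left_mono) auto
    thus "1 / sqrt (2 ^ i) \<le> (3 / 4) ^ i" by (simp add: real_sqrt_power power_divide)
  qed
  also have "\<dots> = 4 * (1 - (3 / 4) ^ n)" by (simp add: sum_gp_strict)
  also have "\<dots> \<le> 4" by simp
  finally show ?thesis .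
qed

lemma ln_ge_two_thirds: "2 \<le> m \<Longrightarrow> 2 / 3 \<le> ln (real m)"
  using ln2_ge_two_thirds ln_le_cancel_iff[of 2 "real m"] by linarith

text \<open>The scale \<open>2 ^ (t + i)\<close> of the nets starts at the order of \<open>ln m\<close>, where the approximation
  error is comparable to the size of the whole set, and ends at the order of \<open>s * ln m\<close>, where a
  single further step to the full grid is affordable. This is why the number of levels is
  logarithmic in \<open>s\<close>, and not in \<open>m\<close>.\<close>

lemma sparse_grid_chaos_moment:
  fixes K :: "'k set"
  assumes m: "m \<ge> 2" and K: "finite K" "k0 \<in> K" "card K \<le> m ^ 3"
    and B: "\<And>k. k \<in> K \<Longrightarrow> op_norm_le m 1 (B k)"
    and orth: "\<And>y. frobenius_sq m (combination K B y) = m * (\<Sum>k\<in>K. (y k)\<^sup>2)"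
    and s: "s \<ge> 1" "s \<le> m\<^sup>2" and p: "p \<ge> 2" "even p"
    and J: "real m ^ 8 \<le> 2 ^ J" "2 ^ J \<le> real m ^ 9"
  defines "A \<equiv> \<lambda>y i j. complex_of_real (1 / sqrt (real m)) * combination K B y i j"
    and "\<tau> \<equiv> 80 * sqrt (real s) / sqrt (real m) * (8 * sqrt (real p) + 6 * (log 2 (real s) + 2) * ln (real m))"
  assumes \<tau>: "84 * \<tau> \<le> 1"
  shows "avg m (\<lambda>\<epsilon>. chaos_sup m A (sparse_grid K s (sqrt (real s) / 2 ^ J)) \<epsilon> ^ p) \<le> (168 * \<tau>) ^ p"
proof -
  define L where "L = ln (real m)"
  have L: "2 / 3 \<le> L" using ln_ge_two_thirds[OF m] by (simp add: L_def)
  have expL: "exp L = real m" using m by (simp add: L_def)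
  have Lm: "L \<le> real m" using m ln_le_minus_one[of "real m"] by (simp add: L_def)
  define \<sigma> where "\<sigma> = sqrt (real s)"
  have \<sigma>: "\<sigma> \<ge> 1" using s by (simp add: \<sigma>_def)
  define F where "F = sparse_grid K s (\<sigma> / 2 ^ J)"
  \<comment> \<open>\<open>2 ^ t\<close> is the order of the trace moments, and \<open>R\<close> the index of the last net.\<close>
  obtain t where t: "L \<le> 2 ^ t" "2 ^ t \<le> 2 * L" using exists_power_two_between[of L] L by auto
  obtain R where R: "real s \<le> 2 ^ R" "2 ^ R \<le> 2 * real s" using exists_power_two_between[of "real s"] s by auto
  have mt: "real m \<le> exp (2 ^ t)" using t expL by (metis exp_le_cancel_iff)
  have m2: "2 \<le> real m" using m by simp
  have mpow: "real m ^ a \<le> real m ^ b" if "a \<le> b" for a b using m2 that by (intro power_increasing) auto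
  have m4: "4 \<le> real m ^ 2" using m2 power_mono[of 2 "real m" 2] by simp
  have tRJ: "t + R \<le> J"
  proof -
    have "(2::real) ^ (t + R) = 2 ^ t * 2 ^ R" by (simp add: power_add)
    also have "\<dots> \<le> (2 * real m) * (2 * real m ^ 2)"
    proof (intro mult_mono)
      show "(2::real) ^ t \<le> 2 * real m" using t Lm by linarith
      have "real s \<le> real m ^ 2" using s(2) by (metis of_nat_le_iff of_nat_power)
      thus "(2::real) ^ R \<le> 2 * real m ^ 2" using R by linarith
    qed auto
    also have "\<dots> = 4 * real m ^ 3" by (simp add: eval_nat_numeral)
    also have "\<dots> \<le> real m ^ 2 * real m ^ 3" using m4 by (intro mult_right_mono) auto
    also have "\<dots> = real m ^ 5" by (simp flip: power_add)
    also have "\<dots> \<le> real m ^ 8" by (intro mpow) simp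
    also have "\<dots> \<le> 2 ^ J" by (rule J)
    finally show ?thesis by simp
  qed
  have grid: "grid_vec K (\<sigma> / 2 ^ J) y \<and> (\<Sum>k\<in>K. \<bar>y k\<bar>) \<le> \<sigma>" if y: "y \<in> F" for y
  proof -
    have "(\<Sum>k\<in>K. \<bar>y k\<bar>) \<le> \<sigma> * sqrt (\<Sum>k\<in>K. (y k)\<^sup>2)"
      unfolding \<sigma>_def using y by (intro l1_le_sqrt_sparsity K) (auto simp: F_def sparse_grid_def)
    also have "\<dots> \<le> \<sigma> * 1" using y \<sigma> by (intro mult_left_mono) (auto simp: F_def sparse_grid_def)
    finally show ?thesis using y by (simp add: F_def sparse_grid_def)
  qed
  have h: "\<sigma> / 2 ^ J > 0" "1 \<le> \<sigma> / 2 ^ J * real (2 ^ J)" using \<sigma> by auto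
  note Ffin = card_sparse_grid(1)[OF K(1,2) h, of s, folded F_def]
  have zero: "(\<lambda>_. 0) \<in> F" by (auto simp: F_def sparse_grid_def grid_vec_def intro: exI[of _ 0])
  define V where "V = combination K B"
  define net where "net i \<rho> \<longleftrightarrow> (\<forall>y\<in>F. \<rho> y \<in> F \<and>
      op_norm_le m (40 * \<sigma> * sqrt (2 ^ t / 2 ^ (t + i))) (\<lambda>j k. V y j k - V (\<rho> y) j k)) \<and>
      card (\<rho> ` F) \<le> (3 * card K) ^ (2 ^ (t + i))" for i \<rho>
  define \<rho> where "\<rho> i = (SOME \<rho>. net i \<rho>)" for i
  have net: "net i (\<rho> i)" if "i \<le> R" for i
    unfolding \<rho>_def
  proof (rule someI_ex[of "net i"])
    show "\<exists>\<rho>. net i \<rho>"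
      unfolding net_def V_def
      by (rule exists_net[OF K(1,2) B mt _ _ grid]) (use that tRJ \<sigma> in auto)
  qed
  \<comment> \<open>The chain starts at \<open>0\<close>, passes through the nets, and ends at the identity map.\<close>
  define \<pi> where "\<pi> i = (if i = 0 then (\<lambda>_ _. 0) else if i \<le> R then \<rho> i else (\<lambda>y. y))" for i
  have \<pi>F: "\<pi> i y \<in> F" if "y \<in> F" for i y
    using that net[of i] zero by (auto simp: \<pi>_def net_def)
  have near: "op_norm_le m (40 * \<sigma> / sqrt (2 ^ i)) (\<lambda>j k. V y j k - V (\<pi> i y) j k)" if y: "y \<in> F" and i: "i \<le> R" for y i
  proof (cases "i = 0")
    case True
    have "op_norm_le m (\<Sum>k\<in>K. \<bar>y k\<bar>) (V y)" unfolding V_def by (intro op_norm_le_combination B)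
    hence "op_norm_le m (40 * \<sigma>) (V y)" by (rule op_norm_le_mono) (use grid[OF y] \<sigma> in auto)
    thus ?thesis using True by (simp add: \<pi>_def V_def combination_def)
  next
    case False
    have "sqrt (2 ^ t / 2 ^ (t + i)) = 1 / sqrt (2 ^ i)" by (simp add: power_add real_sqrt_divide)
    thus ?thesis using net[OF i] y False i by (simp add: net_def \<pi>_def)
  qed
  define d where "d i = 80 * \<sigma> / (sqrt (real m) * sqrt (2 ^ i))" for i :: nat
  \<comment> \<open>\<open>2 * q i\<close> has to exceed both \<open>p\<close> and the logarithm of the number of links, which is at most
    \<open>31 * 2 ^ i * L\<^sup>2\<close>.\<close>
  define r where "r i = nat \<lceil>16 * 2 ^ i * L\<^sup>2\<rceil>" for i :: nat
  define q where "q i = p + r i" for i :: nat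
  have r: "16 * 2 ^ i * L\<^sup>2 \<le> real (r i)" "real (r i) \<le> 16 * 2 ^ i * L\<^sup>2 + 1" for i
  proof -
    have "0 \<le> 16 * 2 ^ i * L\<^sup>2" by simp
    thus "16 * 2 ^ i * L\<^sup>2 \<le> real (r i)" "real (r i) \<le> 16 * 2 ^ i * L\<^sup>2 + 1"
      unfolding r_def by linarith+
  qed
  have step: "op_norm_le m (80 * \<sigma> / sqrt (2 ^ i)) (\<lambda>j k. V (\<pi> (Suc i) y) j k - V (\<pi> i y) j k)"
    if y: "y \<in> F" and i: "i \<le> R" for y i
  proof (cases "i = R")
    case True
    have "op_norm_le m (80 * \<sigma> / sqrt (2 ^ i)) (\<lambda>j k. V y j k - V (\<pi> i y) j k)"
      by (rule op_norm_le_mono[OF near[OF y i]]) (use \<sigma> in \<open>auto intro: divide_right_mono\<close>)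
    thus ?thesis using True by (simp add: \<pi>_def)
  next
    case False
    hence i': "Suc i \<le> R" using i by simp
    have "op_norm_le m (40 * \<sigma> / sqrt (2 ^ Suc i) + 40 * \<sigma> / sqrt (2 ^ i)) (\<lambda>j k. V (\<pi> (Suc i) y) j k - V (\<pi> i y) j k)"
      by (rule op_norm_le_triangle[OF op_norm_le_diff_commute[OF near[OF y i']] near[OF y i]])
    moreover have "40 * \<sigma> / sqrt (2 ^ Suc i) \<le> 40 * \<sigma> / sqrt (2 ^ i)"
      using \<sigma> by (intro divide_left_mono real_sqrt_le_mono power_increasing) auto
    hence "40 * \<sigma> / sqrt (2 ^ Suc i) + 40 * \<sigma> / sqrt (2 ^ i) \<le> 80 * \<sigma> / sqrt (2 ^ i)" by simp
    ultimately show ?thesis by (rule op_norm_le_mono)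
  qed
  have Km: "real (card K) \<le> real m ^ 3" using K(3) by (metis of_nat_le_iff of_nat_power)
  have cardK: "real (3 * card K) \<le> exp (5 * L)"
  proof -
    have "real (3 * card K) = 3 * real (card K)" "0 \<le> real m ^ 3" by simp_all
    hence "real (3 * card K) \<le> 4 * real m ^ 3" using Km by linarith
    also have "\<dots> \<le> real m ^ 2 * real m ^ 3" using m4 by (intro mult_right_mono) auto
    also have "\<dots> = exp (5 * L)" using expL exp_of_nat_mult[of 5 L] by (simp flip: power_add)
    finally show ?thesis .
  qed
  have card_net: "real (card (\<pi> i ` F)) \<le> exp (10 * 2 ^ i * L\<^sup>2)" if i: "i \<le> R" for i
  proof (cases "i = 0")
    case True
    have "\<pi> i ` F \<subseteq> {\<lambda>_. 0}" using True by (auto simp: \<pi>_def)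
    hence "card (\<pi> i ` F) \<le> 1" using card_mono[of "{\<lambda>_. 0}" "\<pi> i ` F"] by simp
    hence "real (card (\<pi> i ` F)) \<le> 1" by simp
    also have "\<dots> \<le> exp (10 * 2 ^ i * L\<^sup>2)" by simp
    finally show ?thesis .
  next
    case False
    have "real (card (\<pi> i ` F)) \<le> real ((3 * card K) ^ (2 ^ (t + i)))"
      using net[OF i] False i by (simp only: of_nat_le_iff) (simp add: net_def \<pi>_def)
    also have "\<dots> = real (3 * card K) ^ (2 ^ (t + i))" by simp
    also have "\<dots> \<le> exp (5 * L) ^ (2 ^ (t + i))" using cardK by (intro power_mono) auto
    also have "\<dots> = exp (2 ^ (t + i) * (5 * L))" by (simp flip: exp_of_nat_mult)
    also have "\<dots> \<le> exp (10 * 2 ^ i * L\<^sup>2)"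
    proof -
      have "2 ^ t * (2 ^ i * (5 * L)) \<le> 2 * L * (2 ^ i * (5 * L))"
        using t L by (intro mult_right_mono) auto
      thus ?thesis by (simp add: power_add power2_eq_square mult_ac)
    qed
    finally show ?thesis .
  qed
  have cardF: "real (card F) \<le> exp (21 * real s * L\<^sup>2)"
  proof -
    have "real (card F) \<le> real ((card K * (2 * 2 ^ J + 1)) ^ s)"
      using card_sparse_grid(2)[OF K(1,2) h, of s] unfolding F_def by (simp only: of_nat_le_iff)
    also have "\<dots> = (real (card K) * (2 * 2 ^ J + 1)) ^ s"
      by (simp only: of_nat_power of_nat_mult of_nat_add of_nat_numeral of_nat_1)
    also have "\<dots> \<le> (real m ^ 14) ^ s"
    proof (intro power_mono)
      have "2 * 2 ^ J + 1 \<le> real m ^ 11"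
      proof -
        have "1 \<le> real m ^ 9" using m2 by (intro one_le_power) auto
        hence "2 * 2 ^ J + 1 \<le> 4 * real m ^ 9" using J by linarith
        also have "\<dots> \<le> real m ^ 2 * real m ^ 9" using m4 by (intro mult_right_mono) auto
        finally show ?thesis by (simp flip: power_add)
      qed
      with Km have "real (card K) * (2 * 2 ^ J + 1) \<le> real m ^ 3 * real m ^ 11"
        by (intro mult_mono) auto
      thus "real (card K) * (2 * 2 ^ J + 1) \<le> real m ^ 14" by (simp flip: power_add)
    qed auto
    also have "\<dots> = exp L ^ (14 * s)" using expL by (simp flip: power_mult)
    also have "\<dots> = exp (14 * real s * L)" by (simp flip: exp_of_nat_mult)
    also have "\<dots> \<le> exp (21 * real s * L\<^sup>2)"
    proof -
      have "14 * real s * L * 1 \<le> 14 * real s * L * (3 / 2 * L)" using L by (intro mult_left_mono) auto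
      thus ?thesis by (simp add: power2_eq_square mult_ac)
    qed
    finally show ?thesis .
  qed
  have cards: "real (card (\<pi> i ` F) * card (\<pi> (Suc i) ` F)) \<le> exp (real (2 * q i))" if i: "i \<le> R" for i
  proof -
    have next_card: "real (card (\<pi> (Suc i) ` F)) \<le> exp (21 * 2 ^ i * L\<^sup>2)"
    proof (cases "i = R")
      case True
      have "real (card (\<pi> (Suc i) ` F)) = real (card F)" using True by (simp add: \<pi>_def)
      also have "\<dots> \<le> exp (21 * real s * L\<^sup>2)" by (rule cardF)
      also have "\<dots> \<le> exp (21 * 2 ^ i * L\<^sup>2)" using R(1) True by (simp add: mult_right_mono)
      finally show ?thesis .
    next
      case False
      hence "real (card (\<pi> (Suc i) ` F)) \<le> exp (10 * 2 ^ Suc i * L\<^sup>2)" using i by (intro card_net) simp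
      also have "\<dots> \<le> exp (21 * 2 ^ i * L\<^sup>2)" by (simp add: mult_right_mono)
      finally show ?thesis .
    qed
    have "real (card (\<pi> i ` F) * card (\<pi> (Suc i) ` F)) \<le> exp (10 * 2 ^ i * L\<^sup>2) * exp (21 * 2 ^ i * L\<^sup>2)"
      unfolding of_nat_mult by (intro mult_mono card_net next_card i) auto
    also have "\<dots> = exp (31 * 2 ^ i * L\<^sup>2)" by (simp flip: exp_add)
    also have "\<dots> \<le> exp (real (2 * q i))"
    proof -
      have "31 * 2 ^ i * L\<^sup>2 \<le> 2 * (16 * 2 ^ i * L\<^sup>2)" by (simp add: mult_right_mono)
      also have "\<dots> \<le> real (2 * q i)" using r(1)[of i] by (simp add: q_def)
      finally show ?thesis by simp
    qed
    finally show ?thesis .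
  qed
  \<comment> \<open>In each summand the part with \<open>p\<close> decays geometrically in \<open>i\<close>, while the part with \<open>L\<close> is constant
    and hence counts the levels.\<close>
  define T where "T = (\<Sum>i<Suc R. sqrt (real (2 * q i)) * d i)"
  have T: "T \<le> \<tau>"
  proof -
    have level: "sqrt (real (2 * q i)) * d i \<le> 80 * \<sigma> / sqrt m * (2 * sqrt p * (1 / sqrt (2 ^ i)) + 6 * L)" for i
    proof -
      have "real (2 * q i) \<le> 3 * real p + 32 * 2 ^ i * L\<^sup>2"
      proof -
        have "real (2 * q i) = 2 * real p + 2 * real (r i)" by (simp add: q_def)
        thus ?thesis using p(1) r(2)[of i] by linarith
      qed
      also have "\<dots> \<le> (2 * sqrt p + 6 * sqrt (2 ^ i) * L)\<^sup>2"
      proof -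
        have "(2 * sqrt p + 6 * sqrt (2 ^ i) * L)\<^sup>2 = 4 * real p + 36 * 2 ^ i * L\<^sup>2 + 24 * (sqrt p * sqrt (2 ^ i) * L)"
          by (simp add: power2_sum power_mult_distrib)
        moreover have "0 \<le> sqrt p * sqrt (2 ^ i) * L" using L by simp
        moreover have "32 * 2 ^ i * L\<^sup>2 \<le> 36 * 2 ^ i * L\<^sup>2" by (simp add: mult_right_mono)
        ultimately show ?thesis by linarith
      qed
      finally have "sqrt (real (2 * q i)) \<le> 2 * sqrt p + 6 * sqrt (2 ^ i) * L"
        using L by (intro real_le_lsqrt) auto
      hence "sqrt (real (2 * q i)) * d i \<le> (2 * sqrt p + 6 * sqrt (2 ^ i) * L) * d i"
        using \<sigma> by (intro mult_right_mono) (auto simp: d_def)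
      also have "\<dots> = 80 * \<sigma> / sqrt m * (2 * sqrt p * (1 / sqrt (2 ^ i)) + 6 * L)"
        using m by (simp add: d_def field_simps)
      finally show ?thesis .
    qed
    have "T \<le> (\<Sum>i<Suc R. 80 * \<sigma> / sqrt m * (2 * sqrt p * (1 / sqrt (2 ^ i)) + 6 * L))"
      unfolding T_def by (rule sum_mono) (rule level)
    also have "\<dots> = 80 * \<sigma> / sqrt m * (2 * sqrt p * (\<Sum>i<Suc R. 1 / sqrt (2 ^ i)) + (\<Sum>i<Suc R. 6 * L))"
      by (simp only: sum_distrib_left[symmetric] sum.distrib)
    also have "\<dots> \<le> 80 * \<sigma> / sqrt m * (2 * sqrt p * 4 + 6 * (log 2 s + 2) * L)"
    proof (intro mult_left_mono add_mono sum_inverse_sqrt_power_two)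
      have "real R = log 2 (2 ^ R)" by simp
      also have "\<dots> \<le> log 2 (2 * real s)" using R s by (subst log_le_cancel_iff) auto
      also have "\<dots> = 1 + log 2 s" using s by (simp add: log_mult)
      finally have "real (Suc R) \<le> log 2 s + 2" by simp
      hence "real (Suc R) * (6 * L) \<le> (log 2 s + 2) * (6 * L)" using L by (intro mult_right_mono) auto
      thus "(\<Sum>i<Suc R. 6 * L) \<le> 6 * (log 2 s + 2) * L" by (simp add: algebra_simps)
    qed (use \<sigma> in auto)
    also have "\<dots> = \<tau>" by (simp add: \<tau>_def \<sigma>_def L_def)
    finally show ?thesis .
  qed
  have T0: "0 \<le> T" unfolding T_def d_def using \<sigma> by (intro sum_nonneg) auto
  have fA: "frobenius_sq m (A y) = (\<Sum>k\<in>K. (y k)\<^sup>2)" for y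
    unfolding A_def frobenius_sq_cmult orth using m by (simp add: norm_divide power_divide)
  have "avg m (\<lambda>\<epsilon>. chaos_sup m A F \<epsilon> ^ p) \<le> (168 * T) ^ p"
    unfolding T_def
  proof (rule chaos_sup_moment[where \<pi> = \<pi>])
    show "op_norm_le m (d i) (\<lambda>j k. A (\<pi> (Suc i) y) j k - A (\<pi> i y) j k)" if "i < Suc R" "y \<in> F" for i y
    proof -
      have "op_norm_le m (cmod (complex_of_real (1 / sqrt m)) * (80 * \<sigma> / sqrt (2 ^ i)))
          (\<lambda>j k. complex_of_real (1 / sqrt m) * (V (\<pi> (Suc i) y) j k - V (\<pi> i y) j k))"
        using that by (intro op_norm_le_cmult step) auto
      moreover have "cmod (complex_of_real (1 / sqrt m)) * (80 * \<sigma> / sqrt (2 ^ i)) = d i"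
        by (simp add: d_def norm_divide)
      moreover have "(\<lambda>j k. complex_of_real (1 / sqrt m) * (V (\<pi> (Suc i) y) j k - V (\<pi> i y) j k))
          = (\<lambda>j k. A (\<pi> (Suc i) y) j k - A (\<pi> i y) j k)"
        by (simp add: A_def V_def right_diff_distrib)
      ultimately show ?thesis by simp
    qed
    show "F \<noteq> {}" using zero by blast
    show "frobenius_sq m (A y) \<le> 1" if "y \<in> F" for y using that by (simp add: fA F_def sparse_grid_def)
    show "A (\<pi> 0 y) i j = 0" for y i j by (simp add: A_def \<pi>_def combination_def)
    show "84 * (\<Sum>i<Suc R. sqrt (real (2 * q i)) * d i) \<le> 1" using T \<tau> by (simp only: T_def)
    show "0 < d i" for i using \<sigma> m by (simp add: d_def)
    show "p \<le> 2 * q i" for i by (simp add: q_def)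
    show "1 \<le> q i" for i using p by (simp add: q_def)
    show "real (card (\<pi> i ` F) * card (\<pi> (Suc i) ` F)) \<le> exp (real (2 * q i))" if "i < Suc R" for i
      using that by (intro cards) simp
  qed (use Ffin \<pi>F p in \<open>auto simp: \<pi>_def\<close>)
  also have "\<dots> \<le> (168 * \<tau>) ^ p" using T T0 by (intro power_mono) auto
  finally show ?thesis by (simp only: F_def \<sigma>_def)
qed

text \<open>Markov's inequality for the \<open>p\<close>-th moment turns the moment bound into an exponentially small
  failure probability.\<close>

theorem sparse_combinations_rip:
  fixes K :: "'k set" and \<delta> :: real
  assumes m: "m \<ge> 2" and K: "finite K" "a \<in> K" "card K \<le> m ^ 3"
    and B: "\<And>k. k \<in> K \<Longrightarrow> op_norm_le m 1 (B k)"
    and orth: "\<And>y. frobenius_sq m (combination K B y) = m * (\<Sum>k\<in>K. (y k)\<^sup>2)"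
    and s: "s \<ge> 1" "s \<le> m\<^sup>2" and p: "p \<ge> 2" "even p" and \<delta>: "1 / real m \<le> \<delta>" "\<delta> \<le> 1"
    and small: "1008 * (80 * sqrt (real s) / sqrt (real m) *
      (8 * sqrt (real p) + 6 * (log 2 (real s) + 2) * ln (real m))) \<le> \<delta>"
  shows "avg m (\<lambda>\<epsilon>. of_bool (\<exists>y. card {k \<in> K. y k \<noteq> 0} \<le> s \<and> (\<Sum>k\<in>K. (y k)\<^sup>2) = 1 \<and>
      \<delta> < \<bar>(norm2 m (mat_app m (combination K B y) (cvec \<epsilon>)))\<^sup>2 / m - 1\<bar>)) \<le> exp (- real p)"
proof -
  define \<tau> where "\<tau> = 80 * sqrt (real s) / sqrt (real m) *
      (8 * sqrt (real p) + 6 * (log 2 (real s) + 2) * ln (real m))"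
  have \<delta>0: "\<delta> > 0" using \<delta>(1) m by (auto intro: less_le_trans[of 0 "1 / real m"])
  have \<tau>0: "0 \<le> \<tau>" using s m by (simp add: \<tau>_def)
  have \<tau>1: "1008 * \<tau> \<le> \<delta>" using small by (simp only: \<tau>_def)
  have \<tau>2: "84 * \<tau> \<le> 1" using \<tau>0 \<tau>1 \<delta> by linarith
  have m2: "2 \<le> real m" using m by simp
  have "1 \<le> real m ^ 8" using m2 by (intro one_le_power) auto
  hence "1 / 2 \<le> real m ^ 8" by linarith
  from exists_power_two_between[OF this] obtain J where J: "real m ^ 8 \<le> 2 ^ J" "2 ^ J \<le> 2 * real m ^ 8" by blast
  have J9: "2 ^ J \<le> real m ^ 9"
  proof -
    have "2 * real m ^ 8 \<le> real m * real m ^ 8" using m2 by (intro mult_right_mono) auto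
    thus ?thesis using J(2) by (simp flip: power_Suc)
  qed
  \<comment> \<open>The mesh is so fine, \<open>2 ^ J\<close> being at least \<open>m ^ 8\<close>, that rounding to the grid costs at most \<open>\<delta> / 2\<close>.\<close>
  define h where "h = sqrt (real s) / 2 ^ J"
  have h: "h > 0" using s by (simp add: h_def)
  define A where "A y = (\<lambda>i j. complex_of_real (1 / sqrt (real m)) * combination K B y i j)" for y
  define F where "F = sparse_grid K s h"
  have Ffin: "finite F"
    unfolding F_def by (rule card_sparse_grid(1)[OF K(1,2) h, of "2 ^ J"]) (use s in \<open>simp add: h_def\<close>)
  have fine: "4 * real s * sqrt (real s) * h \<le> \<delta> / 2"
  proof -
    have "4 * real s * sqrt (real s) * h = 4 * (real s)\<^sup>2 / 2 ^ J" by (simp add: h_def power2_eq_square)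
    also have "\<dots> \<le> 4 * (real m ^ 2)\<^sup>2 / real m ^ 8"
    proof (intro frac_le mult_left_mono power_mono)
      show "real s \<le> real m ^ 2" using s(2) by (metis of_nat_le_iff of_nat_power)
    qed (use J m2 in auto)
    also have "\<dots> = 4 / (real m ^ 3 * real m)" using m2 by (simp add: field_simps eval_nat_numeral)
    also have "\<dots> \<le> 4 / (8 * real m)"
      using m2 power_mono[of 2 "real m" 3] by (intro divide_left_mono mult_right_mono) auto
    also have "\<dots> \<le> \<delta> / 2" using \<delta>(1) by simp
    finally show ?thesis .
  qed
  define bad where "bad \<epsilon> \<longleftrightarrow> (\<exists>y. card {k \<in> K. y k \<noteq> 0} \<le> s \<and> (\<Sum>k\<in>K. (y k)\<^sup>2) = 1 \<and>
      \<delta> < \<bar>(norm2 m (mat_app m (combination K B y) (cvec \<epsilon>)))\<^sup>2 / m - 1\<bar>)" for \<epsilon>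
  have bad: "of_bool (bad \<epsilon>) \<le> (2 / \<delta>) ^ p * chaos_sup m A F \<epsilon> ^ p" if \<epsilon>: "\<epsilon> \<in> signs m" for \<epsilon>
  proof (cases "bad \<epsilon>")
    case False
    have "0 \<le> (2 / \<delta>) ^ p * chaos_sup m A F \<epsilon> ^ p" using p \<delta>0 by (intro mult_nonneg_nonneg) (auto simp: zero_le_even_power)
    thus ?thesis using False by simp
  next
    case True
    then obtain y where y: "card {k \<in> K. y k \<noteq> 0} \<le> s" "(\<Sum>k\<in>K. (y k)\<^sup>2) = 1"
      "\<delta> < \<bar>(norm2 m (mat_app m (combination K B y) (cvec \<epsilon>)))\<^sup>2 / m - 1\<bar>" by (auto simp: bad_def)
    obtain x where x: "x \<in> F" "\<And>k. k \<in> K \<Longrightarrow> \<bar>x k\<bar> \<le> \<bar>y k\<bar> \<and> \<bar>y k - x k\<bar> \<le> h \<and> (y k = 0 \<longrightarrow> x k = 0)"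
      using exists_grid_rounding[OF K(1) h y(1)] y(2) unfolding F_def by auto
    have "\<bar>((norm2 m (mat_app m (combination K B y) (cvec \<epsilon>)))\<^sup>2 / m - (\<Sum>k\<in>K. (y k)\<^sup>2))
        - ((norm2 m (mat_app m (combination K B x) (cvec \<epsilon>)))\<^sup>2 / m - (\<Sum>k\<in>K. (x k)\<^sup>2))\<bar> \<le> 4 * real s * sqrt (real s) * h"
      by (rule discretisation_error[OF K(1) _ _ \<epsilon> s(1) y(1)]) (use B m y x(2) h in auto)
    hence "\<delta> / 2 < \<bar>(norm2 m (mat_app m (combination K B x) (cvec \<epsilon>)))\<^sup>2 / m - (\<Sum>k\<in>K. (x k)\<^sup>2)\<bar>"
      using y(2,3) fine by linarith
    also have "\<dots> = \<bar>(norm2 m (mat_app m (A x) (cvec \<epsilon>)))\<^sup>2 - frobenius_sq m (A x)\<bar>"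
      unfolding A_def mat_app_matrix_cmult norm2_cmult frobenius_sq_cmult orth using m
      by (simp add: norm_divide power_divide power_mult_distrib)
    also have "\<dots> \<le> chaos_sup m A F \<epsilon>" by (rule le_chaos_sup[OF Ffin x(1)])
    finally have "1 \<le> (2 / \<delta>) * chaos_sup m A F \<epsilon>" using \<delta>0 by (simp add: field_simps)
    hence "1 \<le> ((2 / \<delta>) * chaos_sup m A F \<epsilon>) ^ p" by (rule one_le_power)
    thus ?thesis using True by (simp only: power_mult_distrib) simp
  qed
  have "avg m (\<lambda>\<epsilon>. of_bool (bad \<epsilon>)) \<le> avg m (\<lambda>\<epsilon>. (2 / \<delta>) ^ p * chaos_sup m A F \<epsilon> ^ p)"
    by (intro avg_mono bad)
  also have "\<dots> = (2 / \<delta>) ^ p * avg m (\<lambda>\<epsilon>. chaos_sup m A F \<epsilon> ^ p)" by (rule avg_cmult)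
  also have "\<dots> \<le> (2 / \<delta>) ^ p * (168 * \<tau>) ^ p"
  proof (intro mult_left_mono)
    show "avg m (\<lambda>\<epsilon>. chaos_sup m A F \<epsilon> ^ p) \<le> (168 * \<tau>) ^ p"
      unfolding \<tau>_def A_def F_def h_def
      by (rule sparse_grid_chaos_moment[where B = B and K = K, OF m K B orth s p J(1) J9 \<tau>2[unfolded \<tau>_def]])
  qed (use \<delta>0 in simp)
  also have "\<dots> = (336 * \<tau> / \<delta>) ^ p"
  proof -
    have "2 / \<delta> * (168 * \<tau>) = 336 * \<tau> / \<delta>" by simp
    thus ?thesis by (simp only: power_mult_distrib[symmetric])
  qed
  also have "\<dots> \<le> (1 / 3) ^ p"
  proof (rule power_mono)
    have "336 * \<tau> \<le> 1 / 3 * \<delta>" using \<tau>1 by linarith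
    thus "336 * \<tau> / \<delta> \<le> 1 / 3" using \<delta>0 by (subst pos_divide_le_eq)
    show "0 \<le> 336 * \<tau> / \<delta>" using \<tau>0 \<delta>0 by simp
  qed
  also have "\<dots> \<le> exp (- real p)"
  proof -
    have "exp (real p) = exp 1 ^ p" by (simp flip: exp_of_nat_mult)
    also have "\<dots> \<le> 3 ^ p" by (intro power_mono exp_le) auto
    finally have "1 / 3 ^ p \<le> 1 / exp (real p)" by (intro divide_left_mono) auto
    thus ?thesis by (simp only: exp_minus power_one_over inverse_eq_divide)
  qed
  finally show ?thesis unfolding bad_def .
qed

section \<open>Gabor matrices\<close>

text \<open>The matrix of \<open>\<pi>(k, l)\<close> for \<open>p = k * m + l\<close>, the lexicographic position of \<open>(k, l)\<close>.\<close>

definition tf_matrix :: "nat \<Rightarrow> nat \<Rightarrow> nat \<Rightarrow> nat \<Rightarrow> complex" where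
  "tf_matrix m p = (\<lambda>i j. exp (2 * complex_of_real pi * \<i> / of_nat m) ^ ((p mod m) * i) *
     (if j = nat ((int i - int (p div m)) mod int m) then 1 else 0))"

lemma shift_less: "m > 0 \<Longrightarrow> nat ((int i - int k) mod int m) < m"
  by (simp add: nat_less_iff)

lemma mat_app_tf_matrix:
  assumes "m > 0"
  shows "mat_app m (tf_matrix m p) f i =
    exp (2 * complex_of_real pi * \<i> / of_nat m) ^ ((p mod m) * i) * f (nat ((int i - int (p div m)) mod int m))"
proof -
  have "mat_app m (tf_matrix m p) f i = (\<Sum>j<m. if j = nat ((int i - int (p div m)) mod int m)
      then exp (2 * complex_of_real pi * \<i> / of_nat m) ^ ((p mod m) * i) * f j else 0)"
    unfolding mat_app_def tf_matrix_def by (intro sum.cong) auto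
  thus ?thesis using shift_less[OF assms] by simp
qed

lemma shift_eqD:
  assumes "nat ((int i - int k) mod int m) = nat ((int i' - int k') mod int m)" "m > 0"
    and "i + k' < i' + k + m" "i' + k < i + k' + m"
  shows "i + k' = i' + k"
proof -
  have "(int i - int k) mod int m = (int i' - int k') mod int m"
    using assms(1,2) by (metis nat_eq_iff2 of_nat_0_less_iff pos_mod_sign)
  hence "int m dvd (int i - int k) - (int i' - int k')" by (simp add: mod_eq_dvd_iff)
  moreover have "\<bar>(int i - int k) - (int i' - int k')\<bar> < int m" using assms(3,4) by linarith
  ultimately have "(int i - int k) - (int i' - int k') = 0" by (metis zdvd_not_zless abs_0_eq abs_ge_zero dvd_abs_iff order_less_le)
  thus ?thesis by linarith
qed

lemma cmod_root_of_unity: "cmod (exp (2 * complex_of_real pi * \<i> / of_nat m)) = 1"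
proof -
  have "2 * complex_of_real pi * \<i> / of_nat m = \<i> * complex_of_real (2 * pi / real m)" by simp
  thus ?thesis by (simp only: norm_exp_i_times)
qed

lemma op_norm_le_tf_matrix:
  assumes m: "m > 0"
  shows "op_norm_le m 1 (tf_matrix m p)"
  unfolding op_norm_le_def
proof
  fix f
  let ?\<sigma> = "\<lambda>i. nat ((int i - int (p div m)) mod int m)"
  have inj: "inj_on ?\<sigma> {..<m}"
    by (rule inj_onI) (use m in \<open>auto dest!: shift_eqD\<close>)
  have "?\<sigma> ` {..<m} = {..<m}"
    by (rule endo_inj_surj[OF _ _ inj]) (use shift_less[OF m] in auto)
  hence bij: "bij_betw ?\<sigma> {..<m} {..<m}" using inj by (simp add: bij_betw_def)
  have "(norm2 m (mat_app m (tf_matrix m p) f))\<^sup>2 = (\<Sum>i<m. (cmod (f (?\<sigma> i)))\<^sup>2)"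
    unfolding norm2_sq by (simp add: mat_app_tf_matrix[OF m] norm_mult norm_power cmod_root_of_unity)
  also have "\<dots> = (norm2 m f)\<^sup>2" unfolding norm2_sq by (rule sum.reindex_bij_betw[OF bij])
  finally show "norm2 m (mat_app m (tf_matrix m p) f) \<le> 1 * norm2 m f" by simp
qed

text \<open>Shifts by different amounts have disjoint supports as matrices. For equal translations, the
  product is a power sum over a root of unity, which vanishes unless the modulations agree.\<close>

lemma tf_matrix_orthogonal:
  assumes p: "p < m\<^sup>2" "p' < m\<^sup>2"
  shows "(\<Sum>i<m. \<Sum>j<m. tf_matrix m p i j * cnj (tf_matrix m p' i j)) = (if p = p' then of_nat m else 0)"
proof -
  have m: "m > 0" using p by (cases m) auto
  define \<omega> where "\<omega> = exp (2 * complex_of_real pi * \<i> / of_nat m)"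
  have \<omega>1: "\<omega> * cnj \<omega> = 1" using cmod_root_of_unity[of m] by (simp add: \<omega>_def complex_mult_cnj cmod_def complex_eq_iff power2_eq_square)
  have \<omega>m: "\<omega> ^ m = 1"
  proof -
    have "\<omega> ^ m = exp (of_nat m * (2 * complex_of_real pi * \<i> / of_nat m))" by (simp only: \<omega>_def exp_of_nat_mult)
    also have "of_nat m * (2 * complex_of_real pi * \<i> / of_nat m) = 2 * complex_of_real pi * \<i>" using m by simp
    finally show ?thesis by simp
  qed
  define k l k' l' where "k = p div m" and "l = p mod m" and "k' = p' div m" and "l' = p' mod m"
  have less: "k < m" "k' < m" "l < m" "l' < m"
    using p m by (auto simp: k_def k'_def l_def l'_def power2_eq_square less_mult_imp_div_less)
  have pp: "p = p' \<longleftrightarrow> k = k' \<and> l = l'"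
    by (metis k_def k'_def l_def l'_def div_mult_mod_eq)
  define z where "z = \<omega> ^ l * cnj (\<omega> ^ l')"
  have inner: "(\<Sum>j<m. tf_matrix m p i j * cnj (tf_matrix m p' i j)) = (if k = k' then z ^ i else 0)" for i
  proof -
    let ?a = "nat ((int i - int k) mod int m)" and ?b = "nat ((int i - int k') mod int m)"
    have "(\<Sum>j<m. tf_matrix m p i j * cnj (tf_matrix m p' i j)) = (\<Sum>j<m. if j = ?a then (if ?a = ?b then z ^ i else 0) else 0)"
      unfolding tf_matrix_def \<omega>_def[symmetric] k_def[symmetric] l_def[symmetric] k'_def[symmetric] l'_def[symmetric]
      by (intro sum.cong refl) (auto simp: z_def power_mult power_mult_distrib)
    also have "\<dots> = (if ?a = ?b then z ^ i else 0)" using shift_less[OF m] by simp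
    also have "?a = ?b \<longleftrightarrow> k = k'" using shift_eqD[of i k m i k'] m less by auto
    finally show ?thesis .
  qed
  have "(\<Sum>i<m. z ^ i) = (if l = l' then of_nat m else 0)"
  proof (cases "l = l'")
    case True
    have "z = (\<omega> * cnj \<omega>) ^ l" using True by (simp add: z_def power_mult_distrib)
    thus ?thesis using True \<omega>1 by simp
  next
    case False
    have "z \<noteq> 1"
    proof
      assume "z = 1"
      hence "z * \<omega> ^ l' = \<omega> ^ l'" by simp
      moreover have "z * \<omega> ^ l' = \<omega> ^ l * (\<omega> * cnj \<omega>) ^ l'" by (simp add: z_def power_mult_distrib)
      ultimately have "\<omega> ^ l = \<omega> ^ l'" using \<omega>1 by simp
      hence "exp (2 * of_real pi * \<i> * of_nat l / of_nat m) = exp (2 * of_real pi * \<i> * of_nat l' / of_nat m)"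
        by (simp add: \<omega>_def exp_of_nat_mult[symmetric] mult_ac)
      hence "l mod m = l' mod m" using complex_root_unity_eq[of m l l'] m by simp
      thus False using False less by simp
    qed
    moreover have "z ^ m = 1"
    proof -
      have "z ^ m = (\<omega> ^ m) ^ l * cnj ((\<omega> ^ m) ^ l')"
        by (simp add: z_def power_mult_distrib mult.commute flip: power_mult)
      thus ?thesis by (simp add: \<omega>m)
    qed
    ultimately show ?thesis using False by (simp add: geometric_sum)
  qed
  thus ?thesis by (cases "k = k'") (simp_all add: inner pp)
qed

lemma sum_rotate: "(\<Sum>a\<in>A. \<Sum>b\<in>B. \<Sum>c\<in>C. f a b c) = (\<Sum>b\<in>B. \<Sum>c\<in>C. \<Sum>a\<in>A. f a b c)"
  for f :: "'a \<Rightarrow> 'b \<Rightarrow> 'c \<Rightarrow> 'd::comm_monoid_add"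
proof -
  have "(\<Sum>a\<in>A. \<Sum>b\<in>B. \<Sum>c\<in>C. f a b c) = (\<Sum>b\<in>B. \<Sum>a\<in>A. \<Sum>c\<in>C. f a b c)" by (rule sum.swap)
  also have "\<dots> = (\<Sum>b\<in>B. \<Sum>c\<in>C. \<Sum>a\<in>A. f a b c)" by (intro sum.cong refl sum.swap)
  finally show ?thesis .
qed

lemma frobenius_sq_sum_tf_matrix:
  "frobenius_sq m (\<lambda>i j. \<Sum>p<m\<^sup>2. x p * tf_matrix m p i j) = m * (\<Sum>p<m\<^sup>2. (cmod (x p))\<^sup>2)"
proof -
  let ?G = "tf_matrix m" and ?P = "{..<m\<^sup>2}"
  have "complex_of_real (frobenius_sq m (\<lambda>i j. \<Sum>p\<in>?P. x p * ?G p i j))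
      = (\<Sum>i<m. \<Sum>j<m. \<Sum>p\<in>?P. \<Sum>p'\<in>?P. (x p * cnj (x p')) * (?G p i j * cnj (?G p' i j)))"
    unfolding frobenius_sq_def of_real_sum complex_norm_square cnj_sum sum_product
    by (intro sum.cong refl) simp
  also have "\<dots> = (\<Sum>i<m. \<Sum>p\<in>?P. \<Sum>p'\<in>?P. (x p * cnj (x p')) * (\<Sum>j<m. ?G p i j * cnj (?G p' i j)))"
    unfolding sum_distrib_left by (intro sum.cong refl sum_rotate)
  also have "\<dots> = (\<Sum>p\<in>?P. \<Sum>p'\<in>?P. (x p * cnj (x p')) * (\<Sum>i<m. \<Sum>j<m. ?G p i j * cnj (?G p' i j)))"
    unfolding sum_distrib_left by (rule sum_rotate)
  also have "\<dots> = (\<Sum>p\<in>?P. \<Sum>p'\<in>?P. if p = p' then of_nat m * (x p * cnj (x p)) else 0)"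
    by (intro sum.cong refl) (auto simp: tf_matrix_orthogonal mult.commute)
  also have "\<dots> = (\<Sum>p\<in>?P. of_nat m * (x p * cnj (x p)))" by simp
  also have "\<dots> = complex_of_real (m * (\<Sum>p\<in>?P. (cmod (x p))\<^sup>2))"
    by (simp only: of_real_mult of_real_sum complex_norm_square sum_distrib_left of_real_of_nat_eq)
  finally show ?thesis by (simp only: of_real_eq_iff)
qed

text \<open>Complex coefficients are split into real ones: each time-frequency shift contributes two
  contractions, itself and its multiple by the imaginary unit.\<close>

definition real_atoms :: "nat \<Rightarrow> nat \<times> bool \<Rightarrow> nat \<Rightarrow> nat \<Rightarrow> complex" where
  "real_atoms m = (\<lambda>(p, c) i j. (if c then \<i> else 1) * tf_matrix m p i j)"

definition real_coeffs :: "(nat \<Rightarrow> complex) \<Rightarrow> nat \<times> bool \<Rightarrow> real" where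
  "real_coeffs x = (\<lambda>(p, c). if c then Im (x p) else Re (x p))"

abbreviation atom_index :: "nat \<Rightarrow> (nat \<times> bool) set" where
  "atom_index m \<equiv> {..<m\<^sup>2} \<times> UNIV"

lemma combination_real_atoms:
  "combination (atom_index m) (real_atoms m) y
    = (\<lambda>i j. \<Sum>p<m\<^sup>2. Complex (y (p, False)) (y (p, True)) * tf_matrix m p i j)"
  unfolding combination_def sum.cartesian_product'
  by (intro ext sum.cong refl) (simp add: UNIV_bool real_atoms_def Complex_eq algebra_simps)

lemma sum_atom_index: "(\<Sum>k\<in>atom_index m. (y k)\<^sup>2) = (\<Sum>p<m\<^sup>2. (cmod (Complex (y (p, False)) (y (p, True))))\<^sup>2)"
  for y :: "nat \<times> bool \<Rightarrow> real"
  unfolding sum.cartesian_product' by (intro sum.cong refl) (simp add: UNIV_bool cmod_power2 add.commute)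

lemma frobenius_sq_real_atoms:
  "frobenius_sq m (combination (atom_index m) (real_atoms m) y) = m * (\<Sum>k\<in>atom_index m. (y k)\<^sup>2)"
  unfolding combination_real_atoms frobenius_sq_sum_tf_matrix sum_atom_index ..

lemma op_norm_le_real_atoms:
  assumes "m > 0"
  shows "op_norm_le m 1 (real_atoms m k)"
proof -
  obtain p c where k: "k = (p, c)" by fastforce
  have "op_norm_le m (cmod (if c then \<i> else 1) * 1) (\<lambda>i j. (if c then \<i> else 1) * tf_matrix m p i j)"
    by (intro op_norm_le_cmult op_norm_le_tf_matrix assms)
  thus ?thesis by (simp add: k real_atoms_def split: if_splits)
qed

lemma l2_norm_gabor:
  fixes \<epsilon> :: "nat \<Rightarrow> real"
  assumes m: "m > 0" and x: "x \<in> carrier_vec (m\<^sup>2)"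
  defines "h \<equiv> complex_of_real (1 / sqrt (real m)) \<cdot>\<^sub>v map_vec complex_of_real (vec m \<epsilon>)"
  shows "(l2_norm (gabor_matrix h *\<^sub>v x))\<^sup>2 =
    (norm2 m (mat_app m (combination (atom_index m) (real_atoms m) (real_coeffs (\<lambda>p. x $ p))) (cvec \<epsilon>)))\<^sup>2 / m"
proof -
  define c where "c = complex_of_real (1 / sqrt (real m))"
  have dim: "dim_vec h = m" by (simp add: h_def)
  have car: "gabor_matrix h \<in> carrier_mat m (m\<^sup>2)"
    by (intro gabor_matrix_carrier carrier_vecI dim)
  have entry: "gabor_matrix h $$ (i, p) = c * mat_app m (tf_matrix m p) (cvec \<epsilon>) i" if i: "i < m" and p: "p < m\<^sup>2" for i p
  proof -
    have len: "length (List.product [0..<m] [0..<m]) = m\<^sup>2" by (simp add: power2_eq_square)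
    have "List.product [0..<m] [0..<m] ! p = (p div m, p mod m)"
      using p m by (subst product_nth) (auto simp: power2_eq_square less_mult_imp_div_less)
    hence "gabor_matrix h $$ (i, p) = tf_shift (p div m, p mod m) h $ i"
      using i p len by (simp add: gabor_matrix_def Let_def dim mat_of_cols_index)
    also have "\<dots> = exp (2 * complex_of_real pi * \<i> / of_nat m) ^ ((p mod m) * i) *
        h $ nat ((int i - int (p div m)) mod int m)"
      using i by (simp add: tf_shift_def modulation_pow translation_pow dim)
    also have "h $ nat ((int i - int (p div m)) mod int m) = c * cvec \<epsilon> (nat ((int i - int (p div m)) mod int m))"
      using shift_less[OF m] by (simp add: h_def c_def cvec_def)
    finally show ?thesis by (simp add: mat_app_tf_matrix[OF m])
  qed
  have coef: "Complex (real_coeffs (\<lambda>p. x $ p) (p, False)) (real_coeffs (\<lambda>p. x $ p) (p, True)) = x $ p" for p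
    by (simp add: real_coeffs_def)
  have "(gabor_matrix h *\<^sub>v x) $ i = c * mat_app m (combination (atom_index m) (real_atoms m) (real_coeffs (\<lambda>p. x $ p))) (cvec \<epsilon>) i"
    if i: "i < m" for i
  proof -
    have "(gabor_matrix h *\<^sub>v x) $ i = (\<Sum>p<m\<^sup>2. gabor_matrix h $$ (i, p) * x $ p)"
      using car x i by (auto simp: scalar_prod_def atLeast0LessThan carrier_matD)
    also have "\<dots> = c * (\<Sum>p<m\<^sup>2. x $ p * mat_app m (tf_matrix m p) (cvec \<epsilon>) i)"
      unfolding sum_distrib_left by (intro sum.cong) (auto simp: entry i)
    also have "(\<Sum>p<m\<^sup>2. x $ p * mat_app m (tf_matrix m p) (cvec \<epsilon>) i)
        = mat_app m (combination (atom_index m) (real_atoms m) (real_coeffs (\<lambda>p. x $ p))) (cvec \<epsilon>) i"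
      unfolding combination_real_atoms coef mat_app_matrix_sum mat_app_matrix_cmult ..
    finally show ?thesis .
  qed
  moreover have "dim_vec (gabor_matrix h *\<^sub>v x) = m" using car by (simp add: carrier_matD)
  ultimately have "(l2_norm (gabor_matrix h *\<^sub>v x))\<^sup>2 =
      (\<Sum>i<m. (cmod c)\<^sup>2 * (cmod (mat_app m (combination (atom_index m) (real_atoms m) (real_coeffs (\<lambda>p. x $ p))) (cvec \<epsilon>) i))\<^sup>2)"
    unfolding l2_norm_sq by (simp add: norm_mult power_mult_distrib)
  also have "(cmod c)\<^sup>2 = 1 / m" by (simp add: c_def norm_divide power_divide)
  finally show ?thesis by (simp add: norm2_sq sum_divide_distrib)
qed

lemma prob_rademacher_vec_eq_avg:
  "measure_pmf.prob (rademacher_vec m) {v. Q v} = avg m (\<lambda>\<epsilon>. of_bool (Q (vec m \<epsilon>)))"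
proof -
  have ne: "signs m \<noteq> {}" by (metis card.empty card_signs power_not_zero zero_neq_numeral)
  have "rademacher_vec m = map_pmf (vec m) (pmf_of_set (signs m))"
    unfolding rademacher_vec_def signs_def by (subst Pi_pmf_of_set) auto
  hence "measure_pmf.prob (rademacher_vec m) {v. Q v} = measure_pmf.prob (pmf_of_set (signs m)) (vec m -` {v. Q v})"
    by simp
  also have "\<dots> = real (card (signs m \<inter> vec m -` {v. Q v})) / 2 ^ m"
    using ne by (simp add: measure_pmf_of_set)
  also have "real (card (signs m \<inter> vec m -` {v. Q v})) = (\<Sum>\<epsilon>\<in>signs m. of_bool (Q (vec m \<epsilon>)))"
    by (simp add: sum.If_cases of_bool_def vimage_def)
  finally show ?thesis by (simp add: avg_def)
qed

text \<open>The exceptional event, in terms of real coefficients. Its complement gives the restricted isometry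
  property after normalisation; a complex \<open>s\<close>-sparse vector has at most \<open>2 s\<close> nonzero real coefficients.\<close>

definition gabor_deviates :: "nat \<Rightarrow> nat \<Rightarrow> real \<Rightarrow> (nat \<Rightarrow> real) \<Rightarrow> bool" where
  "gabor_deviates m s \<delta> \<epsilon> \<longleftrightarrow> (\<exists>y. card {k \<in> atom_index m. y k \<noteq> 0} \<le> s \<and> (\<Sum>k\<in>atom_index m. (y k)\<^sup>2) = 1 \<and>
      \<delta> < \<bar>(norm2 m (mat_app m (combination (atom_index m) (real_atoms m) y) (cvec \<epsilon>)))\<^sup>2 / m - 1\<bar>)"

lemma restricted_isometry_constant_gabor_le:
  assumes m: "m > 0" and s: "s > 0" and good: "\<not> gabor_deviates m (2 * s) \<delta> \<epsilon>"
  shows "restricted_isometry_constant s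
    (gabor_matrix (complex_of_real (1 / sqrt (real m)) \<cdot>\<^sub>v map_vec complex_of_real (vec m \<epsilon>))) \<le> \<delta>"
proof -
  let ?h = "complex_of_real (1 / sqrt (real m)) \<cdot>\<^sub>v map_vec complex_of_real (vec m \<epsilon>)"
  let ?\<Psi> = "gabor_matrix ?h" and ?C = "combination (atom_index m) (real_atoms m)"
  have car: "?\<Psi> \<in> carrier_mat m (m\<^sup>2)" by (intro gabor_matrix_carrier carrier_vecI) simp
  hence dim: "dim_col ?\<Psi> = m\<^sup>2" by (rule carrier_matD)
  have "restricted_isometry_bound s ?\<Psi> \<delta>"
    unfolding restricted_isometry_bound_def dim
  proof (intro ballI impI)
    fix x :: "complex vec" assume x: "x \<in> carrier_vec (m\<^sup>2)" and sp: "sparse s x"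
    define y where "y = real_coeffs (\<lambda>p. x $ p)"
    have norm_x: "(l2_norm x)\<^sup>2 = (\<Sum>k\<in>atom_index m. (y k)\<^sup>2)"
      unfolding sum_atom_index l2_norm_sq using x by (simp add: y_def real_coeffs_def carrier_vecD)
    have norm_\<Psi>: "(l2_norm (?\<Psi> *\<^sub>v x))\<^sup>2 = (norm2 m (mat_app m (?C y) (cvec \<epsilon>)))\<^sup>2 / m"
      unfolding y_def by (rule l2_norm_gabor[OF m x])
    show "(1 - \<delta>) * (l2_norm x)\<^sup>2 \<le> (l2_norm (?\<Psi> *\<^sub>v x))\<^sup>2 \<and> (l2_norm (?\<Psi> *\<^sub>v x))\<^sup>2 \<le> (1 + \<delta>) * (l2_norm x)\<^sup>2"
    proof (cases "l2_norm x = 0")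
      case True
      have "(l2_norm (?\<Psi> *\<^sub>v x))\<^sup>2 \<le> 0"
        using l2_norm_mult_mat_vec_bound[of x ?\<Psi>] x dim True by simp
      thus ?thesis using True by simp
    next
      case False
      define n where "n = l2_norm x"
      have n: "n\<^sup>2 > 0" using False by (simp add: n_def)
      define y' where "y' k = (1 / n) * y k" for k
      have y'1: "(\<Sum>k\<in>atom_index m. (y' k)\<^sup>2) = 1"
        using n norm_x by (simp add: y'_def power_mult_distrib power_divide sum_divide_distrib[symmetric] n_def)
      have y's: "card {k \<in> atom_index m. y' k \<noteq> 0} \<le> 2 * s"
      proof -
        have "{k \<in> atom_index m. y' k \<noteq> 0} \<subseteq> {p. p < dim_vec x \<and> x $ p \<noteq> 0} \<times> (UNIV :: bool set)"
          using x by (auto simp: y'_def y_def real_coeffs_def carrier_vecD split: if_splits)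
        hence "card {k \<in> atom_index m. y' k \<noteq> 0} \<le> card ({p. p < dim_vec x \<and> x $ p \<noteq> 0} \<times> (UNIV :: bool set))"
          by (intro card_mono) auto
        also have "\<dots> \<le> 2 * s" using sp by (simp add: card_cartesian_product sparse_def)
        finally show ?thesis .
      qed
      have "\<bar>(norm2 m (mat_app m (?C y') (cvec \<epsilon>)))\<^sup>2 / m - 1\<bar> \<le> \<delta>"
      proof (rule leI, rule notI)
        assume "\<delta> < \<bar>(norm2 m (mat_app m (?C y') (cvec \<epsilon>)))\<^sup>2 / m - 1\<bar>"
        with y's y'1 have "gabor_deviates m (2 * s) \<delta> \<epsilon>"
          unfolding gabor_deviates_def by (intro exI[of _ y'] conjI)
        thus False using good by contradiction
      qed
      moreover have "(norm2 m (mat_app m (?C y') (cvec \<epsilon>)))\<^sup>2 / m = (l2_norm (?\<Psi> *\<^sub>v x))\<^sup>2 / n\<^sup>2"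
      proof -
        have scaled: "?C y' = (\<lambda>i j. complex_of_real (1 / n) * ?C y i j)"
          by (simp add: combination_def y'_def sum_distrib_left mult_ac)
        show ?thesis unfolding norm_\<Psi> scaled mat_app_matrix_cmult norm2_cmult
          by (simp add: power_mult_distrib norm_divide power_divide)
      qed
      ultimately have "\<bar>(l2_norm (?\<Psi> *\<^sub>v x))\<^sup>2 / n\<^sup>2 - 1\<bar> \<le> \<delta>" by simp
      thus ?thesis using n unfolding n_def[symmetric] by (auto simp: abs_le_iff field_simps)
    qed
  qed
  thus ?thesis using restricted_isometry_constant_least(2)[of s ?\<Psi> \<delta>] s m dim by simp
qed


text \<open>The order \<open>p\<close> of the moment is at least, and of the order of, \<open>(ln s * ln m)\<^sup>2\<close>, so that both
  terms of the chaining bound are of the order \<open>sqrt (s / m) * ln s * ln m\<close>. Additive constants are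
  absorbed with \<open>ln 2 \<ge> 2 / 3\<close>, as \<open>s\<close> and \<open>m\<close> are at least \<open>2\<close>. The total factor is
  \<open>1008 * 9120\<close>, which is less than \<open>10 ^ 7\<close>; this explains \<open>10 ^ 14\<close>.\<close>

lemma gabor_deviates_avg_le:
  assumes m: "m \<ge> 2" and s: "s \<ge> 2" and \<delta>: "0 < \<delta>" "\<delta> \<le> 1"
    and large: "10 ^ 14 * (real s * (ln (real s) * ln (real m))\<^sup>2) \<le> \<delta>\<^sup>2 * real m"
  shows "avg m (\<lambda>\<epsilon>. of_bool (gabor_deviates m (2 * s) \<delta> \<epsilon>)) \<le> exp (- ((ln (real s) * ln (real m))\<^sup>2))"
proof -
  define D where "D = ln (real s) * ln (real m)"
  have D: "4 / 9 \<le> D"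
    using mult_mono[OF ln_ge_two_thirds[OF s] ln_ge_two_thirds[OF m]] ln_ge_two_thirds[OF s] by (simp add: D_def)
  have D2: "16 / 81 \<le> D\<^sup>2" using power_mono[OF D, of 2] by (simp add: power2_eq_square)
  define p where "p = 2 * (nat \<lceil>D\<^sup>2\<rceil> + 1)"
  have p: "p \<ge> 2" "even p" by (simp_all add: p_def)
  have ceil: "D\<^sup>2 \<le> real (nat \<lceil>D\<^sup>2\<rceil>)" "real (nat \<lceil>D\<^sup>2\<rceil>) \<le> D\<^sup>2 + 1"
  proof -
    have "0 \<le> D\<^sup>2" by simp
    thus "D\<^sup>2 \<le> real (nat \<lceil>D\<^sup>2\<rceil>)" "real (nat \<lceil>D\<^sup>2\<rceil>) \<le> D\<^sup>2 + 1" by linarith+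
  qed
  have preal: "real p = 2 * real (nat \<lceil>D\<^sup>2\<rceil>) + 2" by (simp add: p_def)
  have pD: "D\<^sup>2 \<le> real p" using preal ceil by linarith
  have sqrtp: "sqrt (real p) \<le> 5 * D"
  proof (rule real_le_lsqrt)
    have "real p \<le> 25 * D\<^sup>2" using preal ceil D2 by linarith
    thus "real p \<le> (5 * D)\<^sup>2" by (simp add: power_mult_distrib)
  qed (use D in auto)
  have m0: "real m > 0" using m by simp
  have one: "1 \<le> \<delta>\<^sup>2 * real m" and twos: "2 * real s \<le> real m"
  proof -
    have "real s * (16 / 81) \<le> real s * D\<^sup>2" using D2 by (intro mult_left_mono) auto
    hence *: "2 * real s \<le> \<delta>\<^sup>2 * real m" using large by (simp add: D_def)
    moreover have "\<delta>\<^sup>2 * real m \<le> 1 * real m" using \<delta> by (intro mult_right_mono power_le_one) auto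
    ultimately show "2 * real s \<le> real m" by linarith
    show "1 \<le> \<delta>\<^sup>2 * real m" using * s by linarith
  qed
  have \<delta>m: "1 / real m \<le> \<delta>"
  proof -
    have "\<delta>\<^sup>2 * real m \<le> \<delta> * real m" using \<delta> by (intro mult_right_mono) (auto simp: power2_eq_square mult_left_le)
    hence "1 \<le> \<delta> * real m" using one by linarith
    thus ?thesis using m0 by (simp add: field_simps)
  qed
  have s2: "2 * s \<le> m\<^sup>2"
  proof -
    have "2 * s \<le> m" using twos by linarith
    also have "\<dots> \<le> m\<^sup>2" by (simp add: power2_nat_le_imp_le self_le_power)
    finally show ?thesis .
  qed
  have lg: "log 2 (real (2 * s)) + 2 \<le> 6 * ln (real s)"
  proof -
    have ls: "2 / 3 \<le> ln (2 :: real)" by (rule ln2_ge_two_thirds)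
    have "ln 2 \<le> ln (real s)" using s by simp
    define r where "r = ln (real s) / ln 2"
    have "1 \<le> r" using \<open>ln 2 \<le> ln (real s)\<close> by (simp add: r_def)
    moreover have "r \<le> ln (real s) / (2 / 3)"
      unfolding r_def using ls s by (intro divide_left_mono) auto
    moreover have "log 2 (real (2 * s)) = 1 + r"
      using s by (simp add: r_def log_def ln_mult add_divide_distrib)
    ultimately show ?thesis by simp
  qed
  have small: "1008 * (80 * sqrt (real (2 * s)) / sqrt (real m) *
      (8 * sqrt (real p) + 6 * (log 2 (real (2 * s)) + 2) * ln (real m))) \<le> \<delta>"
  proof -
    have lm: "0 \<le> ln (real m)" using ln_ge_two_thirds[OF m] by linarith
    have "(log 2 (real (2 * s)) + 2) * ln (real m) \<le> 6 * ln (real s) * ln (real m)"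
      using lg lm by (rule mult_right_mono)
    hence "(log 2 (real (2 * s)) + 2) * ln (real m) \<le> 6 * D" by (simp only: D_def mult.assoc)
    hence "8 * sqrt (real p) + 6 * ((log 2 (real (2 * s)) + 2) * ln (real m)) \<le> 76 * D"
      using sqrtp by linarith
    hence "8 * sqrt (real p) + 6 * (log 2 (real (2 * s)) + 2) * ln (real m) \<le> 76 * D"
      by (simp only: mult.assoc)
    moreover have "sqrt (real (2 * s)) \<le> 3 / 2 * sqrt (real s)"
    proof -
      have "sqrt 2 \<le> 3 / 2" by (rule real_le_lsqrt) (auto simp: power2_eq_square)
      hence "sqrt 2 * sqrt (real s) \<le> 3 / 2 * sqrt (real s)" by (intro mult_right_mono) auto
      thus ?thesis by (simp add: real_sqrt_mult)
    qed
    ultimately have "80 * sqrt (real (2 * s)) / sqrt (real m) *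
        (8 * sqrt (real p) + 6 * (log 2 (real (2 * s)) + 2) * ln (real m))
        \<le> 80 * (3 / 2 * sqrt (real s)) / sqrt (real m) * (76 * D)"
      using lm s by (intro mult_mono divide_right_mono mult_left_mono) (auto intro!: add_nonneg_nonneg mult_nonneg_nonneg)
    also have "\<dots> = 9120 * (sqrt (real s) * D / sqrt (real m))" by simp
    finally have "1008 * (80 * sqrt (real (2 * s)) / sqrt (real m) *
        (8 * sqrt (real p) + 6 * (log 2 (real (2 * s)) + 2) * ln (real m)))
        \<le> 1008 * (9120 * (sqrt (real s) * D / sqrt (real m)))" by (intro mult_left_mono) auto
    also have "\<dots> \<le> 10 ^ 7 * (sqrt (real s) * D / sqrt (real m))"
    proof -
      have "1008 * (9120 * z) \<le> 10 ^ 7 * z" if "0 \<le> z" for z :: real using that by simp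
      moreover have "0 \<le> sqrt (real s) * D / sqrt (real m)" using D by simp
      ultimately show ?thesis .
    qed
    also have "\<dots> \<le> \<delta>"
    proof -
      have "(10 ^ 7 * (sqrt (real s) * D))\<^sup>2 = 10 ^ 14 * (real s * D\<^sup>2)" by (simp add: power_mult_distrib)
      also have "\<dots> \<le> (\<delta> * sqrt (real m))\<^sup>2" using large by (simp add: D_def power_mult_distrib)
      finally have "10 ^ 7 * (sqrt (real s) * D) \<le> \<delta> * sqrt (real m)"
        by (rule power2_le_imp_le) (use \<delta> in auto)
      thus ?thesis using m0 by (simp add: field_simps)
    qed
    finally show ?thesis .
  qed
  have "card (atom_index m) \<le> m ^ 3"
  proof -
    have "card (atom_index m) = m\<^sup>2 * 2" by (simp add: card_cartesian_product)
    also have "\<dots> \<le> m\<^sup>2 * m" using m by (intro mult_left_mono) auto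
    finally show ?thesis by (simp add: eval_nat_numeral)
  qed
  hence "avg m (\<lambda>\<epsilon>. of_bool (gabor_deviates m (2 * s) \<delta> \<epsilon>)) \<le> exp (- real p)"
    unfolding gabor_deviates_def
    by (intro sparse_combinations_rip[where a = "(0, False)"] m op_norm_le_real_atoms frobenius_sq_real_atoms p \<delta>m \<delta>(2) small s2)
      (use m s in auto)
  also have "\<dots> \<le> exp (- (D\<^sup>2))" using pD by simp
  finally show ?thesis by (simp add: D_def)
qed

theorem theorem1p3:
  shows "\<exists>c::real. c > 0 \<and>
    (\<forall>(m::nat) (s::nat) (\<delta>::real).
       m \<ge> 1 \<longrightarrow> s \<ge> 1 \<longrightarrow> s \<le> m\<^sup>2 \<longrightarrow> 0 < \<delta> \<longrightarrow> \<delta> < 1 \<longrightarrow>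
       real m \<ge> c * \<delta> powi (-2) * real s * (ln (real s))\<^sup>2 * (ln (real m))\<^sup>2 \<longrightarrow>
       measure_pmf.prob (rademacher_vec m)
         {\<epsilon>. restricted_isometry_constant s
               (gabor_matrix (complex_of_real (1 / sqrt (real m)) \<cdot>\<^sub>v map_vec complex_of_real \<epsilon>)) \<le> \<delta>}
       \<ge> 1 - real m powr (- (ln (real m) * (ln (real s))\<^sup>2)))"
proof (rule exI[of _ "10 ^ 14"], intro conjI allI impI)
  fix m s :: nat and \<delta> :: real
  assume ms: "m \<ge> 1" "s \<ge> 1" "s \<le> m\<^sup>2" and \<delta>: "0 < \<delta>" "\<delta> < 1"
    and large: "real m \<ge> 10 ^ 14 * \<delta> powi (-2) * real s * (ln (real s))\<^sup>2 * (ln (real m))\<^sup>2"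
  let ?good = "\<lambda>v. restricted_isometry_constant s
      (gabor_matrix (complex_of_real (1 / sqrt (real m)) \<cdot>\<^sub>v map_vec complex_of_real v)) \<le> \<delta>"
  show "measure_pmf.prob (rademacher_vec m) {\<epsilon>. ?good \<epsilon>} \<ge> 1 - real m powr (- (ln (real m) * (ln (real s))\<^sup>2))"
  proof (cases "m = 1 \<or> s = 1")
    case True
    \<comment> \<open>A logarithm vanishes, so the claimed probability is \<open>0\<close>.\<close>
    hence "real m powr (- (ln (real m) * (ln (real s))\<^sup>2)) = 1" using ms by auto
    thus ?thesis by simp
  next
    case False
    hence m: "m \<ge> 2" and s: "s \<ge> 2" using ms by auto
    have "10 ^ 14 * (real s * (ln (real s) * ln (real m))\<^sup>2)
        = \<delta>\<^sup>2 * (10 ^ 14 * \<delta> powi (-2) * real s * (ln (real s))\<^sup>2 * (ln (real m))\<^sup>2)"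
      using \<delta> by (simp add: power_int_minus power_mult_distrib)
    also have "\<dots> \<le> \<delta>\<^sup>2 * real m" using large by (intro mult_left_mono) auto
    finally have "avg m (\<lambda>\<epsilon>. of_bool (gabor_deviates m (2 * s) \<delta> \<epsilon>)) \<le> exp (- ((ln (real s) * ln (real m))\<^sup>2))"
      using \<delta> by (intro gabor_deviates_avg_le[OF m s]) auto
    also have "\<dots> = real m powr (- (ln (real m) * (ln (real s))\<^sup>2))"
      using m by (simp add: powr_def power_mult_distrib power2_eq_square mult_ac)
    finally have "1 - real m powr (- (ln (real m) * (ln (real s))\<^sup>2))
        \<le> 1 - avg m (\<lambda>\<epsilon>. of_bool (gabor_deviates m (2 * s) \<delta> \<epsilon>))" by simp
    also have "\<dots> = avg m (\<lambda>\<epsilon>. 1 - of_bool (gabor_deviates m (2 * s) \<delta> \<epsilon>))"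
      by (simp add: avg_diff)
    also have "\<dots> \<le> avg m (\<lambda>\<epsilon>. of_bool (?good (vec m \<epsilon>)))"
    proof (rule avg_mono)
      fix \<epsilon>
      show "1 - of_bool (gabor_deviates m (2 * s) \<delta> \<epsilon>) \<le> (of_bool (?good (vec m \<epsilon>)) :: real)"
        using restricted_isometry_constant_gabor_le[of m s \<delta> \<epsilon>] m s
        by (cases "gabor_deviates m (2 * s) \<delta> \<epsilon>") auto
    qed
    also have "\<dots> = measure_pmf.prob (rademacher_vec m) {\<epsilon>. ?good \<epsilon>}"
      by (rule prob_rademacher_vec_eq_avg[symmetric])
    finally show ?thesis .
  qed
qed simp

end
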